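(* For $x\in M$ and $\xi\in T_x^*M$, the principal symbol of $\mathcal{D}_{t,\lambda}:\mathcal{S}^N\to\mathcal{S}^{N+1}$ is $$\sigma(\mathcal{D}_{t,\lambda})(\xi)=(\xi\wedge\cdot)\otimes\mathrm{id}_{\mathrm{Sym}^\bullet(\mathcal{G}_x)}:\ \Omega^p_x\otimes\mathrm{Sym}^q(\mathcal{G}_x)\longrightarrow\Omega^{p+1}_x\otimes\mathrm{Sym}^q(\mathcal{G}_x).$$ In particular, it is independent of $t$ and $\lambda$.
   Context: Setting: $M$ is a closed connected smooth manifold, $G$ a compact connected semisimple Lie group, $P\to M$ a principal $G$-bundle with connection, $\mathcal{G}=\mathrm{ad}P$, $\lambda\in\Gamma(\mathrm{ad}^*P)\cong\Gamma(\mathrm{ad}P)$ (covariantly constant), $t\in\mathbb{R}$. Put $\mathcal{S}^N=\bigoplus_{p+q=N}\Omega^p(M)\otimes\mathrm{Sym}^q(\mathcal{G})$ and $\mathcal{D}_{t,\lambda}=d+(-1)^{\deg_{\mathrm{dR}}}\,t\,\delta^\lambda$, where $(-1)^{\deg_{\mathrm{dR}}}=(-1)^p$ on $\Omega^p(M)\otimes\mathrm{Sym}^q(\mathcal{G})$ and $\delta^\lambda:\mathrm{Sym}^q(\mathcal{G})\to\mathrm{Sym}^{q+1}(\mathcal{G})$ is a zero-order (fiberwise linear) operator with $(\delta^\lambda)^2=0$ and $[d,\delta^\lambda]=0$. $\Omega^p_x$ denotes $\Lambda^pT_x^*M$. *)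

theory Defs
  imports "HOL-Analysis.Analysis" "HOL-Library.Function_Algebras" "HOL-Library.Multiset"
begin

section \<open>Linear algebra in spaces of functions\<close>

text \<open>
  All fibres below are linear subspaces of spaces of functions with pointwise operations.  A map
  that is only meaningful on a subspace \<open>V\<close> (or on lists over \<open>V\<close>) is required to vanish
  elsewhere, so that equality of maps on \<open>V\<close> is equality of HOL functions.
\<close>

instantiation "fun" :: (type, real_vector) real_vector
begin

definition scaleR_fun :: "real \<Rightarrow> ('a \<Rightarrow> 'b) \<Rightarrow> 'a \<Rightarrow> 'b"
  where "scaleR_fun c f = (\<lambda>x. c *\<^sub>R f x)"

instance
  by standard (simp_all add: scaleR_fun_def fun_eq_iff scaleR_add_right scaleR_add_left)

end

definition linear_map_on :: "'v::real_vector set \<Rightarrow> ('v \<Rightarrow> 'w::real_vector) \<Rightarrow> bool"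
  where "linear_map_on V L \<longleftrightarrow>
    (\<forall>u\<in>V. \<forall>w\<in>V. L (u + w) = L u + L w) \<and> (\<forall>c. \<forall>u\<in>V. L (c *\<^sub>R u) = c *\<^sub>R L u)"

definition dual_space :: "'v::real_vector set \<Rightarrow> ('v \<Rightarrow> real) set"
  where "dual_space V = {\<phi>. linear_map_on V \<phi> \<and> (\<forall>u. u \<notin> V \<longrightarrow> \<phi> u = 0)}"

definition multilinear_maps ::
    "nat \<Rightarrow> 'v::real_vector set \<Rightarrow> 'w::real_vector set \<Rightarrow> ('v list \<Rightarrow> 'w) set"
  where "multilinear_maps n V W = {F.
    (\<forall>us. length us = n \<and> set us \<subseteq> V \<longrightarrow>
        F us \<in> W \<and> (\<forall>i<n. linear_map_on V (\<lambda>u. F (us[i := u])))) \<and>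
    (\<forall>us. \<not> (length us = n \<and> set us \<subseteq> V) \<longrightarrow> F us = 0)}"

text \<open>
  \<open>\<Lambda>\<^sup>p V\<^sup>* \<otimes> W\<close>, as the space of alternating \<open>p\<close>-linear maps from \<open>V\<close> to \<open>W\<close>; a decomposable
  element \<open>\<alpha> \<otimes> w\<close> is \<open>\<lambda>us. \<alpha> us *\<^sub>R w\<close>.
\<close>

definition alternating_maps ::
    "nat \<Rightarrow> 'v::real_vector set \<Rightarrow> 'w::real_vector set \<Rightarrow> ('v list \<Rightarrow> 'w) set"
  where "alternating_maps p V W = {F \<in> multilinear_maps p V W.
    \<forall>us i j. i < j \<and> j < length us \<and> us ! i = us ! j \<longrightarrow> F us = 0}"

text \<open>
  \<open>Sym\<^sup>q V\<close> for a finite-dimensional real vector space \<open>V\<close>, as the space of symmetric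
  \<open>q\<close>-linear forms on \<open>V\<^sup>*\<close>: the product \<open>v\<^sub>1 \<dots> v\<^sub>q\<close> is the form sending
  \<open>(\<phi>\<^sub>1, \<dots>, \<phi>\<^sub>q)\<close> to the sum of \<open>\<Prod>\<^sub>i \<phi>\<^sub>i (v (\<pi> i))\<close> over all permutations \<open>\<pi>\<close>.
\<close>

type_synonym 'v sym = "('v \<Rightarrow> real) list \<Rightarrow> real"

definition Sym :: "nat \<Rightarrow> 'v::real_vector set \<Rightarrow> 'v sym set"
  where "Sym q V = {s \<in> multilinear_maps q (dual_space V) UNIV.
    \<forall>us ws. mset us = mset ws \<longrightarrow> s us = s ws}"

definition omit :: "nat \<Rightarrow> 'a list \<Rightarrow> 'a list"
  where "omit i xs = take i xs @ drop (Suc i) xs"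

definition wedge :: "('v \<Rightarrow> real) \<Rightarrow> ('v list \<Rightarrow> 'w::real_vector) \<Rightarrow> 'v list \<Rightarrow> 'w"
  where "wedge \<xi> F = (\<lambda>us. \<Sum>i<length us. ((-1) ^ i * \<xi> (us ! i)) *\<^sub>R F (omit i us))"

text \<open>On vector-valued forms, \<open>wedge \<xi>\<close> is \<open>(\<xi> \<and> \<cdot>) \<otimes> id\<close>:\<close>

lemma wedge_tensor:
  "wedge \<xi> (\<lambda>us. \<alpha> us *\<^sub>R w) = (\<lambda>us. wedge \<xi> \<alpha> us *\<^sub>R (w::'w::real_vector))" for \<alpha> :: "'v list \<Rightarrow> real"
  by (simp add: wedge_def fun_eq_iff scaleR_left.sum)


section \<open>Smooth manifolds\<close>

primrec Ck_on :: "nat \<Rightarrow> 'a::real_normed_vector set \<Rightarrow> ('a \<Rightarrow> 'b::real_normed_vector) \<Rightarrow> bool"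
  where
    "Ck_on 0 S f \<longleftrightarrow> continuous_on S f"
  | "Ck_on (Suc k) S f \<longleftrightarrow>
      (\<forall>x\<in>S. f differentiable (at x)) \<and> (\<forall>v. Ck_on k S (\<lambda>x. frechet_derivative f (at x) v))"

definition smooth_on :: "'a::real_normed_vector set \<Rightarrow> ('a \<Rightarrow> 'b::real_normed_vector) \<Rightarrow> bool"
  where "smooth_on S f \<longleftrightarrow> (\<forall>k. Ck_on k S f)"

type_synonym ('m, 'e) chart = "'m set \<times> ('m \<Rightarrow> 'e)"

text \<open>
  The manifold is a whole type.  Charts take values in a finite-dimensional inner product space
  \<open>'e\<close>; unlike \<open>euclidean_space\<close> this allows dimension zero.  Atlases need not be maximal.
\<close>

definition smooth_manifold ::
    "('m::{t2_space, second_countable_topology}, 'e::real_inner) chart set \<Rightarrow> bool"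
  where "smooth_manifold A \<longleftrightarrow>
    (\<exists>B::'e set. finite B \<and> span B = UNIV) \<and>
    (\<Union>(U, \<phi>)\<in>A. U) = UNIV \<and>
    (\<forall>(U, \<phi>)\<in>A. open U \<and> open (\<phi> ` U) \<and> (\<exists>\<psi>. homeomorphism U (\<phi> ` U) \<phi> \<psi>)) \<and>
    (\<forall>(U, \<phi>)\<in>A. \<forall>(V, \<psi>)\<in>A. smooth_on (\<phi> ` (U \<inter> V)) (\<psi> \<circ> inv_into U \<phi>))"

definition smooth_map_on ::
    "('m::topological_space, 'e::real_normed_vector) chart set \<Rightarrow>
     ('n::topological_space, 'f::real_normed_vector) chart set \<Rightarrow> 'm set \<Rightarrow> ('m \<Rightarrow> 'n) \<Rightarrow> bool"
  where "smooth_map_on A B S F \<longleftrightarrow> continuous_on S F \<and>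
    (\<forall>(U, \<phi>)\<in>A. \<forall>(V, \<psi>)\<in>B. smooth_on (\<phi> ` (U \<inter> S \<inter> F -` V)) (\<psi> \<circ> F \<circ> inv_into U \<phi>))"

definition prod_atlas ::
    "('m, 'e) chart set \<Rightarrow> ('n, 'f) chart set \<Rightarrow> ('m \<times> 'n, 'e \<times> 'f) chart set"
  where "prod_atlas A B = {(U \<times> V, map_prod \<phi> \<psi>) | U \<phi> V \<psi>. (U, \<phi>) \<in> A \<and> (V, \<psi>) \<in> B}"

definition smooth_functions :: "('m, 'e::real_normed_vector) chart set \<Rightarrow> ('m \<Rightarrow> real) set"
  where "smooth_functions A = {f. \<forall>(U, \<phi>)\<in>A. smooth_on (\<phi> ` U) (f \<circ> inv_into U \<phi>)}"

text \<open>Tangent vectors at \<open>x\<close> are the derivations at \<open>x\<close> of the algebra of smooth functions.\<close>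

type_synonym 'm tangent = "('m \<Rightarrow> real) \<Rightarrow> real"

definition tangent_space :: "('m, 'e::real_normed_vector) chart set \<Rightarrow> 'm \<Rightarrow> 'm tangent set"
  where "tangent_space A x = {v \<in> dual_space (smooth_functions A).
    \<forall>f\<in>smooth_functions A. \<forall>g\<in>smooth_functions A. v (\<lambda>y. f y * g y) = f x * v g + g x * v f}"

abbreviation cotangent_space ::
    "('m, 'e::real_normed_vector) chart set \<Rightarrow> 'm \<Rightarrow> ('m tangent \<Rightarrow> real) set"
  where "cotangent_space A x \<equiv> dual_space (tangent_space A x)"

definition differential ::
    "('m, 'e::real_normed_vector) chart set \<Rightarrow> ('m \<Rightarrow> real) \<Rightarrow> 'm \<Rightarrow> 'm tangent \<Rightarrow> real"
  where "differential A f x = (\<lambda>v. if v \<in> tangent_space A x then v f else 0)"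

definition pushforward ::
    "('n, 'f::real_normed_vector) chart set \<Rightarrow> ('m \<Rightarrow> 'n) \<Rightarrow> 'm tangent \<Rightarrow> 'n tangent"
  where "pushforward B F v = (\<lambda>f. if f \<in> smooth_functions B then v (f \<circ> F) else 0)"

definition vector_fields :: "('m, 'e::real_normed_vector) chart set \<Rightarrow> ('m \<Rightarrow> 'm tangent) set"
  where "vector_fields A = {X. (\<forall>x. X x \<in> tangent_space A x) \<and>
    (\<forall>f\<in>smooth_functions A. (\<lambda>x. X x f) \<in> smooth_functions A)}"

definition vf_bracket :: "('m \<Rightarrow> 'm tangent) \<Rightarrow> ('m \<Rightarrow> 'm tangent) \<Rightarrow> 'm \<Rightarrow> 'm tangent"
  where "vf_bracket X Y x = (\<lambda>f. X x (\<lambda>y. Y y f) - Y x (\<lambda>y. X y f))"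


section \<open>Lie groups\<close>

definition lie_group ::
    "('g::{t2_space, second_countable_topology}, 'e::real_inner) chart set \<Rightarrow>
     ('g \<Rightarrow> 'g \<Rightarrow> 'g) \<Rightarrow> 'g \<Rightarrow> ('g \<Rightarrow> 'g) \<Rightarrow> bool"
  where "lie_group A mul e iv \<longleftrightarrow> smooth_manifold A \<and> group mul e iv \<and>
    smooth_map_on (prod_atlas A A) A UNIV (\<lambda>(g, h). mul g h) \<and> smooth_map_on A A UNIV iv"

text \<open>
  The bracket on the tangent space at the unit: the value there of the bracket of the
  left-invariant fields \<open>g \<mapsto> (\<lambda>f. X (\<lambda>h. f (g h)))\<close> extending \<open>X\<close> and \<open>Y\<close>.
\<close>

definition lie_bracket :: "('g \<Rightarrow> 'g \<Rightarrow> 'g) \<Rightarrow> 'g tangent \<Rightarrow> 'g tangent \<Rightarrow> 'g tangent"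
  where "lie_bracket mul X Y =
    (\<lambda>f. X (\<lambda>g. Y (\<lambda>h. f (mul g h))) - Y (\<lambda>g. X (\<lambda>h. f (mul g h))))"

text \<open>Semisimplicity in Bourbaki's form: the Lie algebra has no non-zero abelian ideal.\<close>

definition semisimple ::
    "('g, 'e::real_normed_vector) chart set \<Rightarrow> ('g \<Rightarrow> 'g \<Rightarrow> 'g) \<Rightarrow> 'g \<Rightarrow> bool"
  where "semisimple A mul e \<longleftrightarrow>
    (\<forall>\<aa>. subspace \<aa> \<and> \<aa> \<subseteq> tangent_space A e \<and>
      (\<forall>X\<in>tangent_space A e. \<forall>Y\<in>\<aa>. lie_bracket mul X Y \<in> \<aa>) \<and>
      (\<forall>X\<in>\<aa>. \<forall>Y\<in>\<aa>. lie_bracket mul X Y = 0) \<longrightarrow> \<aa> = {0})"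


section \<open>Principal bundles with connection\<close>

text \<open>
  \<open>conn p v\<close> is the value of the connection 1-form at \<open>p\<close> on the tangent vector \<open>v\<close>.
\<close>

record ('m, 'em, 'g, 'eg, 'p, 'ep) pbundle =
  base :: "('m, 'em) chart set"
  grp :: "('g, 'eg) chart set"
  mul :: "'g \<Rightarrow> 'g \<Rightarrow> 'g"
  gunit :: 'g
  ginv :: "'g \<Rightarrow> 'g"
  total :: "('p, 'ep) chart set"
  proj :: "'p \<Rightarrow> 'm"
  act :: "'p \<Rightarrow> 'g \<Rightarrow> 'p"
  conn :: "'p \<Rightarrow> 'p tangent \<Rightarrow> 'g tangent"

abbreviation lie_algebra ::
    "('m, 'em, 'g, 'eg::real_normed_vector, 'p, 'ep) pbundle \<Rightarrow> 'g tangent set"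
  where "lie_algebra P \<equiv> tangent_space (grp P) (gunit P)"

definition Ad ::
    "('m, 'em, 'g, 'eg::real_normed_vector, 'p, 'ep) pbundle \<Rightarrow> 'g \<Rightarrow> 'g tangent \<Rightarrow> 'g tangent"
  where "Ad P g = pushforward (grp P) (\<lambda>h. mul P (mul P g h) (ginv P g))"

definition fundamental_vector ::
    "('m, 'em, 'g, 'eg, 'p, 'ep::real_normed_vector) pbundle \<Rightarrow> 'p \<Rightarrow> 'g tangent \<Rightarrow> 'p tangent"
  where "fundamental_vector P p = pushforward (total P) (\<lambda>g. act P p g)"

definition principal_bundle ::
    "('m::{t2_space, second_countable_topology}, 'em::real_inner,
      'g::{t2_space, second_countable_topology}, 'eg::real_inner,
      'p::{t2_space, second_countable_topology}, 'ep::real_inner) pbundle \<Rightarrow> bool"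
  where "principal_bundle P \<longleftrightarrow>
    smooth_manifold (base P) \<and> smooth_manifold (total P) \<and>
    lie_group (grp P) (mul P) (gunit P) (ginv P) \<and>
    smooth_map_on (total P) (base P) UNIV (proj P) \<and> surj (proj P) \<and>
    smooth_map_on (prod_atlas (total P) (grp P)) (total P) UNIV (\<lambda>(p, g). act P p g) \<and>
    (\<forall>p. act P p (gunit P) = p) \<and>
    (\<forall>p g h. act P (act P p g) h = act P p (mul P g h)) \<and>
    (\<forall>p g. proj P (act P p g) = proj P p) \<and>
    (\<forall>x. \<exists>U \<Phi> \<tau>. open U \<and> x \<in> U \<and>
      smooth_map_on (total P) (prod_atlas (base P) (grp P)) (proj P -` U) (\<lambda>p. (proj P p, \<Phi> p)) \<and>
      smooth_map_on (prod_atlas (base P) (grp P)) (total P) (U \<times> UNIV) \<tau> \<and>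
      (\<forall>p\<in>proj P -` U. \<tau> (proj P p, \<Phi> p) = p) \<and>
      (\<forall>y\<in>U. \<forall>g. proj P (\<tau> (y, g)) = y \<and> \<Phi> (\<tau> (y, g)) = g) \<and>
      (\<forall>p\<in>proj P -` U. \<forall>g. \<Phi> (act P p g) = mul P (\<Phi> p) g))"

definition principal_connection ::
    "('m, 'em, 'g, 'eg::real_normed_vector, 'p, 'ep::real_normed_vector) pbundle \<Rightarrow> bool"
  where "principal_connection P \<longleftrightarrow>
    (\<forall>p. linear_map_on (tangent_space (total P) p) (conn P p) \<and>
       conn P p ` tangent_space (total P) p \<subseteq> lie_algebra P) \<and>
    (\<forall>Y\<in>vector_fields (total P). \<forall>f\<in>smooth_functions (grp P).
       (\<lambda>p. conn P p (Y p) f) \<in> smooth_functions (total P)) \<and>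
    (\<forall>p. \<forall>X\<in>lie_algebra P. conn P p (fundamental_vector P p X) = X) \<and>
    (\<forall>p g. \<forall>v\<in>tangent_space (total P) p.
       conn P (act P p g) (pushforward (total P) (\<lambda>p'. act P p' g) v) =
         Ad P (ginv P g) (conn P p v))"

text \<open>The horizontal lift to \<open>p\<close>, which is unique, of a tangent vector \<open>v\<close> at \<open>proj P p\<close>.\<close>

definition hlift ::
    "('m, 'em::real_normed_vector, 'g, 'eg, 'p, 'ep::real_normed_vector) pbundle \<Rightarrow>
     'p \<Rightarrow> 'm tangent \<Rightarrow> 'p tangent"
  where "hlift P p v = (SOME w. w \<in> tangent_space (total P) p \<and>
    pushforward (base P) (proj P) w = v \<and> conn P p w = 0)"


section \<open>The adjoint bundle and its symmetric powers\<close>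

text \<open>
  An element of the fibre of \<open>ad P = (P \<times> \<gg>) / G\<close> over \<open>x\<close> is an orbit
  \<open>{(p g, Ad (g\<^sup>-\<^sup>1) X) | g \<in> G}\<close>, which is the graph of an equivariant map from the fibre of
  \<open>P\<close> over \<open>x\<close> to \<open>\<gg>\<close>; we use that map.
\<close>

type_synonym ('p, 'g) adj = "'p \<Rightarrow> 'g tangent"

definition ad_fibre ::
    "('m, 'em, 'g, 'eg::real_normed_vector, 'p, 'ep) pbundle \<Rightarrow> 'm \<Rightarrow> ('p, 'g) adj set"
  where "ad_fibre P x = {a.
    (\<forall>p. proj P p = x \<longrightarrow>
       a p \<in> lie_algebra P \<and> (\<forall>g. a (act P p g) = Ad P (ginv P g) (a p))) \<and>
    (\<forall>p. proj P p \<noteq> x \<longrightarrow> a p = 0)}"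

definition ad_sections ::
    "('m, 'em, 'g, 'eg::real_normed_vector, 'p, 'ep::real_normed_vector) pbundle \<Rightarrow>
     ('m \<Rightarrow> ('p, 'g) adj) set"
  where "ad_sections P = {a. (\<forall>x. a x \<in> ad_fibre P x) \<and>
    (\<forall>f\<in>smooth_functions (grp P). (\<lambda>p. a (proj P p) p f) \<in> smooth_functions (total P))}"

text \<open>
  The induced connection on \<open>ad P\<close>: the \<open>\<gg>\<close>-valued function \<open>p \<mapsto> a (proj P p) p\<close> on \<open>P\<close> is
  differentiated along horizontal lifts (a \<open>\<gg>\<close>-valued function is evaluated on a test function
  \<open>f\<close> on \<open>G\<close> to obtain a real-valued one).
\<close>

definition ad_deriv ::
    "('m, 'em::real_normed_vector, 'g, 'eg, 'p, 'ep::real_normed_vector) pbundle \<Rightarrow>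
     'm \<Rightarrow> 'm tangent \<Rightarrow> ('m \<Rightarrow> ('p, 'g) adj) \<Rightarrow> ('p, 'g) adj"
  where "ad_deriv P x v a = (\<lambda>p. if proj P p = x
    then (\<lambda>f. hlift P p v (\<lambda>p'. a (proj P p') p' f)) else 0)"

abbreviation coad_fibre ::
    "('m, 'em, 'g, 'eg::real_normed_vector, 'p, 'ep) pbundle \<Rightarrow> 'm \<Rightarrow> (('p, 'g) adj \<Rightarrow> real) set"
  where "coad_fibre P x \<equiv> dual_space (ad_fibre P x)"

definition coad_sections ::
    "('m, 'em::real_normed_vector, 'g, 'eg::real_normed_vector, 'p, 'ep::real_normed_vector) pbundle
     \<Rightarrow> ('m \<Rightarrow> ('p, 'g) adj \<Rightarrow> real) set"
  where "coad_sections P = {l. (\<forall>x. l x \<in> coad_fibre P x) \<and>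
    (\<forall>a\<in>ad_sections P. (\<lambda>x. l x (a x)) \<in> smooth_functions (base P))}"

definition cov_constant ::
    "('m, 'em::real_normed_vector, 'g, 'eg::real_normed_vector, 'p, 'ep::real_normed_vector) pbundle
     \<Rightarrow> ('m \<Rightarrow> ('p, 'g) adj \<Rightarrow> real) \<Rightarrow> bool"
  where "cov_constant P l \<longleftrightarrow> (\<forall>a\<in>ad_sections P. \<forall>x. \<forall>v\<in>tangent_space (base P) x.
    v (\<lambda>y. l y (a y)) - l x (ad_deriv P x v a) = 0)"

abbreviation Sym_ad ::
    "('m, 'em, 'g, 'eg::real_normed_vector, 'p, 'ep) pbundle \<Rightarrow> nat \<Rightarrow> 'm \<Rightarrow> ('p, 'g) adj sym set"
  where "Sym_ad P q x \<equiv> Sym q (ad_fibre P x)"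

text \<open>
  A point \<open>p\<close> over \<open>x\<close> identifies the fibre of \<open>ad P\<close> over \<open>x\<close> with \<open>\<gg>\<close> via \<open>a \<mapsto> a p\<close>.
  \<open>from_frame\<close> and \<open>to_frame\<close> are the induced mutually inverse maps between \<open>\<gg>\<^sup>*\<close> and the dual
  of the fibre.
\<close>

definition from_frame ::
    "('m, 'em, 'g, 'eg::real_normed_vector, 'p, 'ep) pbundle \<Rightarrow>
     'p \<Rightarrow> ('g tangent \<Rightarrow> real) \<Rightarrow> ('p, 'g) adj \<Rightarrow> real"
  where "from_frame P p \<phi> = (\<lambda>a. if a \<in> ad_fibre P (proj P p) then \<phi> (a p) else 0)"

definition to_frame ::
    "('m, 'em, 'g, 'eg::real_normed_vector, 'p, 'ep) pbundle \<Rightarrow>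
     'p \<Rightarrow> (('p, 'g) adj \<Rightarrow> real) \<Rightarrow> 'g tangent \<Rightarrow> real"
  where "to_frame P p \<psi> = (\<lambda>X. if X \<in> lie_algebra P
    then \<psi> (THE a. a \<in> ad_fibre P (proj P p) \<and> a p = X) else 0)"

definition Sym_ad_sections ::
    "('m, 'em, 'g, 'eg::real_normed_vector, 'p, 'ep::real_normed_vector) pbundle \<Rightarrow>
     nat \<Rightarrow> ('m \<Rightarrow> ('p, 'g) adj sym) set"
  where "Sym_ad_sections P q = {s. (\<forall>x. s x \<in> Sym_ad P q x) \<and>
    (\<forall>\<phi>s. length \<phi>s = q \<and> set \<phi>s \<subseteq> dual_space (lie_algebra P) \<longrightarrow>
       (\<lambda>p. s (proj P p) (map (from_frame P p) \<phi>s)) \<in> smooth_functions (total P))}"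

text \<open>
  The induced connection on \<open>Sym\<^sup>q (ad P)\<close>: the \<open>Sym\<^sup>q \<gg>\<close>-valued function on \<open>P\<close> belonging to a
  section \<open>s\<close> is differentiated along the horizontal lift of \<open>v\<close> to a point \<open>p\<close> over \<open>x\<close>.  By
  equivariance the result does not depend on the choice of \<open>p\<close>.
\<close>

definition Sym_ad_deriv ::
    "('m, 'em::real_normed_vector, 'g, 'eg::real_normed_vector, 'p, 'ep::real_normed_vector) pbundle
     \<Rightarrow> 'm \<Rightarrow> 'm tangent \<Rightarrow> ('m \<Rightarrow> ('p, 'g) adj sym) \<Rightarrow> ('p, 'g) adj sym"
  where "Sym_ad_deriv P x v s = (\<lambda>\<psi>s. if set \<psi>s \<subseteq> coad_fibre P x
    then let p = SOME p. proj P p = x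
         in hlift P p v (\<lambda>p'. s (proj P p') (map (from_frame P p' \<circ> to_frame P p) \<psi>s))
    else 0)"


section \<open>Differential forms with values in \<open>Sym\<^sup>q (ad P)\<close>\<close>

type_synonym ('m, 'p, 'g) form = "'m tangent list \<Rightarrow> ('p, 'g) adj sym"

definition form_fibre ::
    "('m, 'em::real_normed_vector, 'g, 'eg::real_normed_vector, 'p, 'ep) pbundle \<Rightarrow>
     nat \<Rightarrow> nat \<Rightarrow> 'm \<Rightarrow> ('m, 'p, 'g) form set"
  where "form_fibre P p q x = alternating_maps p (tangent_space (base P) x) (Sym_ad P q x)"

definition forms ::
    "('m, 'em::real_normed_vector, 'g, 'eg::real_normed_vector, 'p, 'ep::real_normed_vector) pbundle
     \<Rightarrow> nat \<Rightarrow> nat \<Rightarrow> ('m \<Rightarrow> ('m, 'p, 'g) form) set"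
  where "forms P p q = {\<omega>. (\<forall>x. \<omega> x \<in> form_fibre P p q x) \<and>
    (\<forall>Xs. length Xs = p \<and> set Xs \<subseteq> vector_fields (base P) \<longrightarrow>
       (\<lambda>x. \<omega> x (map (\<lambda>X. X x) Xs)) \<in> Sym_ad_sections P q)}"

text \<open>
  The exterior covariant derivative, by the Koszul formula
  \<open>(d \<omega>) (X\<^sub>0, \<dots>, X\<^sub>p) = \<Sum>\<^sub>i (-1)\<^sup>i \<nabla>\<^sub>X\<^sub>i (\<omega> (\<dots> omit i \<dots>))
     + \<Sum>\<^sub>i\<^sub><\<^sub>j (-1)\<^sup>i\<^sup>+\<^sup>j \<omega> ([X\<^sub>i, X\<^sub>j], \<dots> omit i, j \<dots>)\<close>,
  evaluated on tangent vectors at a point after extending them to vector fields.  The formula is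
  tensorial, hence independent of the extension.
\<close>

definition ext_deriv ::
    "('m, 'em::real_normed_vector, 'g, 'eg::real_normed_vector, 'p, 'ep::real_normed_vector) pbundle
     \<Rightarrow> ('m \<Rightarrow> ('m, 'p, 'g) form) \<Rightarrow> 'm \<Rightarrow> ('m, 'p, 'g) form"
  where "ext_deriv P \<omega> x = (\<lambda>vs. if vs \<noteq> [] \<and> set vs \<subseteq> tangent_space (base P) x
    then let n = length vs;
             Xs = (SOME Xs. set Xs \<subseteq> vector_fields (base P) \<and> map (\<lambda>X. X x) Xs = vs)
         in (\<Sum>i<n. (-1) ^ i *\<^sub>R Sym_ad_deriv P x (vs ! i) (\<lambda>y. \<omega> y (map (\<lambda>X. X y) (omit i Xs))))
          + (\<Sum>j<n. \<Sum>i<j. (-1) ^ (i + j) *\<^sub>R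
               \<omega> x (vf_bracket (Xs ! i) (Xs ! j) x # omit i (omit j vs)))
    else 0)"

text \<open>
  \<open>S\<^sup>N\<close>: the external direct sum over \<open>p + q = N\<close>, an element being the family of its components
  indexed by the form degree \<open>p\<close>.
\<close>

definition S_fibre ::
    "('m, 'em::real_normed_vector, 'g, 'eg::real_normed_vector, 'p, 'ep) pbundle \<Rightarrow>
     nat \<Rightarrow> 'm \<Rightarrow> (nat \<Rightarrow> ('m, 'p, 'g) form) set"
  where "S_fibre P N x = {w. \<forall>p. w p \<in> (if p \<le> N then form_fibre P p (N - p) x else {0})}"

definition S_sections ::
    "('m, 'em::real_normed_vector, 'g, 'eg::real_normed_vector, 'p, 'ep::real_normed_vector) pbundle
     \<Rightarrow> nat \<Rightarrow> ('m \<Rightarrow> nat \<Rightarrow> ('m, 'p, 'g) form) set"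
  where "S_sections P N =
    {s. (\<forall>x. s x \<in> S_fibre P N x) \<and> (\<forall>p\<le>N. (\<lambda>x. s x p) \<in> forms P p (N - p))}"

text \<open>
  The conditions on \<open>\<delta>\<close>: a smooth fibrewise linear map \<open>Sym\<^sup>q (ad P) \<rightarrow> Sym\<^sup>q\<^sup>+\<^sup>1 (ad P)\<close> for
  every \<open>q\<close> with \<open>\<delta>\<^sup>2 = 0\<close>, whose extension \<open>id \<otimes> \<delta>\<close> to forms commutes with \<open>d\<close>.
\<close>

definition admissible_delta ::
    "('m, 'em::real_normed_vector, 'g, 'eg::real_normed_vector, 'p, 'ep::real_normed_vector) pbundle
     \<Rightarrow> ('m \<Rightarrow> ('p, 'g) adj sym \<Rightarrow> ('p, 'g) adj sym) \<Rightarrow> bool"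
  where "admissible_delta P \<delta> \<longleftrightarrow>
    (\<forall>q x. linear_map_on (Sym_ad P q x) (\<delta> x) \<and> \<delta> x ` Sym_ad P q x \<subseteq> Sym_ad P (Suc q) x) \<and>
    (\<forall>q. \<forall>s\<in>Sym_ad_sections P q. (\<lambda>x. \<delta> x (s x)) \<in> Sym_ad_sections P (Suc q)) \<and>
    (\<forall>q x. \<forall>u\<in>Sym_ad P q x. \<delta> x (\<delta> x u) = 0) \<and>
    (\<forall>p q. \<forall>\<omega>\<in>forms P p q.
       ext_deriv P (\<lambda>x vs. \<delta> x (\<omega> x vs)) = (\<lambda>x vs. \<delta> x (ext_deriv P \<omega> x vs)))"

definition D_op ::
    "('m, 'em::real_normed_vector, 'g, 'eg::real_normed_vector, 'p, 'ep::real_normed_vector) pbundle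
     \<Rightarrow> ('m \<Rightarrow> ('p, 'g) adj sym \<Rightarrow> ('p, 'g) adj sym) \<Rightarrow> real
     \<Rightarrow> ('m \<Rightarrow> nat \<Rightarrow> ('m, 'p, 'g) form) \<Rightarrow> 'm \<Rightarrow> nat \<Rightarrow> ('m, 'p, 'g) form"
  where "D_op P \<delta> t s = (\<lambda>x p.
    (case p of 0 \<Rightarrow> 0 | Suc p' \<Rightarrow> ext_deriv P (\<lambda>y. s y p') x)
    + ((-1) ^ p * t) *\<^sub>R (\<lambda>vs. \<delta> x (s x p vs)))"

definition wedge_S ::
    "('m tangent \<Rightarrow> real) \<Rightarrow> (nat \<Rightarrow> ('m, 'p, 'g) form) \<Rightarrow> nat \<Rightarrow> ('m, 'p, 'g) form"
  where "wedge_S \<xi> w = (\<lambda>p. case p of 0 \<Rightarrow> 0 | Suc p' \<Rightarrow> wedge \<xi> (w p'))"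


section \<open>Principal symbols\<close>

text \<open>
  The principal symbol of a differential operator \<open>D\<close> of order \<open>k\<close> on a space \<open>\<Gamma>\<close> of smooth
  sections: \<open>\<sigma>(D)(\<xi>) e = D (f\<^sup>k s) (x) / k!\<close> for any smooth function \<open>f\<close> and any section \<open>s\<close> with
  \<open>f x = 0\<close>, \<open>df\<^sub>x = \<xi>\<close> and \<open>s x = e\<close>.  No power of the imaginary unit is included.
\<close>

definition principal_symbol ::
    "('m, 'e::real_normed_vector) chart set \<Rightarrow> ('m \<Rightarrow> 'u::real_vector) set \<Rightarrow> nat \<Rightarrow>
     (('m \<Rightarrow> 'u) \<Rightarrow> 'm \<Rightarrow> 'w::real_vector) \<Rightarrow> 'm \<Rightarrow> ('m tangent \<Rightarrow> real) \<Rightarrow> 'u \<Rightarrow> 'w"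
  where "principal_symbol A \<Gamma> k D x \<xi> e = (THE r. \<exists>f s.
    f \<in> smooth_functions A \<and> f x = 0 \<and> differential A f x = \<xi> \<and> s \<in> \<Gamma> \<and> s x = e \<and>
    r = (1 / fact k) *\<^sub>R D (\<lambda>y. (f y) ^ k *\<^sub>R s y) x)"

end

theory Submission
  imports Defs
begin

text \<open>
  If \<open>f x = 0\<close>, then \<open>D (f s) (x)\<close> only sees the derivative falling on \<open>f\<close>: the bracket terms of the
  Koszul formula and the zero-order term \<open>t \<delta>\<close> carry the factor \<open>f x\<close>, and a horizontal lift of \<open>v\<close>
  projects to \<open>v\<close>, so \<open>\<nabla>\<^sub>v (f s) = (v f) s x\<close> at \<open>x\<close>.  What remains is \<open>df\<^sub>x \<and> s x\<close>.

  The symbol is defined by a description operator, so suitable \<open>f\<close>, \<open>s\<close>, vector fields and horizontal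
  lifts have to exist.  Hadamard's lemma shows that derivations at a point are spanned by the partial
  derivatives in a chart; bump functions then yield functions with prescribed differential, vector
  fields with prescribed value, and, after transport to \<open>x\<close> with a local section of \<open>P\<close>, forms
  with prescribed value.
\<close>


section \<open>Calculus in finite-dimensional inner product spaces\<close>

text \<open>Tangent vectors are derivations of the algebra of globally defined smooth functions, so
  a function, field or form built near a point must be cut off and extended by zero before a
  derivation can see it. The cut-offs exist because a compact Hausdorff space is regular, which is
  where compactness of \<open>M\<close> and of \<open>G\<close> enters; on the total space they are
  pulled back from \<open>M\<close> along \<open>proj P\<close>.

  Smoothness of a section of an associated bundle is tested on the total space, in the moving frame
  \<open>from_frame P p\<close>. Relative to a local section \<sigma> the point \<open>p\<close> is
  \<open>act P (\<sigma> (proj P p)) (\<Phi> p)\<close>, so the test function of a transported form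
  is assembled from \<open>Ad P (ginv P (\<Phi> p))\<close>. The analytic core is therefore that
  \<open>Ad P g X f\<close> is smooth in \<open>g\<close>, a statement about partial derivatives of
  the conjugation map. \<open>curve_in\<close> carries this through multilinear evaluation, so that
  no basis of the alternating or symmetric powers has to be chosen.\<close>

text \<open>Only the reproducing formula is recorded, so \<open>B\<close> is a Parseval frame: an
  orthonormal basis is one, but \<open>0 \<in> B\<close> and overcomplete \<open>B\<close> are
  allowed as well.\<close>

definition onb :: "'a::real_inner set \<Rightarrow> bool"
  where "onb B \<longleftrightarrow> finite B \<and> (\<forall>v. (\<Sum>b\<in>B. (v \<bullet> b) *\<^sub>R b) = v)"

text \<open>Gram-Schmidt over the finite spanning set. The induction keeps \<open>C\<close>
  orthonormal and keeps the vectors treated so far fixed under the projection to the span of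
  \<open>C\<close>; the fixed vectors form a subspace, so in the end they are everything.\<close>

lemma onb_exists:
  assumes "finite B0" "span B0 = (UNIV :: 'a::real_inner set)"
  shows "\<exists>B::'a set. onb B"
proof -
  have "\<exists>C::'a set. finite C \<and> (\<forall>c\<in>C. \<forall>d\<in>C. c \<bullet> d = (if c = d then 1 else 0)) \<and>
      (\<forall>b\<in>B0. (\<Sum>c\<in>C. (b \<bullet> c) *\<^sub>R c) = b)"
    using assms(1)
  proof (induction B0 rule: finite_induct)
    case empty
    then show ?case by (intro exI[of _ "{}"]) auto
  next
    case (insert x B)
    then obtain C where C: "finite C" "\<And>c d. c \<in> C \<Longrightarrow> d \<in> C \<Longrightarrow> c \<bullet> d = (if c = d then 1 else 0)"
      "\<And>b. b \<in> B \<Longrightarrow> (\<Sum>c\<in>C. (b \<bullet> c) *\<^sub>R c) = b"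
      by blast
    \<comment> \<open>Orthogonal projection of the new vector. The remainder \<open>y\<close> is
      orthogonal to \<open>C\<close> and, unless it is zero, is normalised and adjoined.\<close>
    define p where "p = (\<Sum>c\<in>C. (x \<bullet> c) *\<^sub>R c)"
    define y where "y = x - p"
    have pc: "p \<bullet> c = x \<bullet> c" if "c \<in> C" for c
    proof -
      have "p \<bullet> c = (\<Sum>d\<in>C. (x \<bullet> d) * (d \<bullet> c))" by (simp add: p_def inner_sum_left)
      also have "\<dots> = (\<Sum>d\<in>C. if d = c then x \<bullet> c else 0)"
        by (rule sum.cong) (auto simp: C(2) that)
      finally show ?thesis using C(1) that by simp
    qed
    show ?case
    proof (cases "y = 0")
      case True
      then have "(\<Sum>c\<in>C. (x \<bullet> c) *\<^sub>R c) = x" by (simp add: y_def p_def)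
      then show ?thesis using C by (intro exI[of _ C]) auto
    next
      case False
      define e where "e = (1 / norm y) *\<^sub>R y"
      have ey: "norm y *\<^sub>R e = y" using False by (simp add: e_def)
      have ee: "e \<bullet> e = 1" using False by (simp add: e_def dot_square_norm power2_eq_square)
      have yc: "y \<bullet> c = 0" if "c \<in> C" for c using pc[OF that] by (simp add: y_def inner_diff_left)
      have ec: "e \<bullet> c = 0" if "c \<in> C" for c using yc[OF that] by (simp add: e_def)
      have ce: "c \<bullet> e = 0" if "c \<in> C" for c using ec[OF that] by (simp add: inner_commute)
      have eC: "e \<notin> C" using ec ee by force
      have lin: "(\<Sum>c\<in>C. (b \<bullet> c) *\<^sub>R c) \<bullet> e = 0" for b
        by (simp add: inner_sum_left ce)
      have 1: "(\<Sum>c\<in>insert e C. (b \<bullet> c) *\<^sub>R c) = b" if "b \<in> B" for b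
      proof -
        have "b \<bullet> e = 0" using lin[of b] C(3)[OF that] by simp
        then show ?thesis using C(3)[OF that] eC C(1) by simp
      qed
      have xe: "x \<bullet> e = norm y"
      proof -
        have "x = norm y *\<^sub>R e + p" by (simp only: ey) (simp add: y_def)
        then have "x \<bullet> e = (norm y *\<^sub>R e + p) \<bullet> e" by (rule arg_cong)
        also have "\<dots> = norm y" using lin[of x] ee by (simp add: inner_add_left p_def)
        finally show ?thesis .
      qed
      have 2: "(\<Sum>c\<in>insert e C. (x \<bullet> c) *\<^sub>R c) = x"
        using eC C(1) ey by (simp add: xe p_def[symmetric]) (simp add: y_def)
      show ?thesis
        using C(1) 1 2 C(2) ec ce ee eC by (intro exI[of _ "insert e C"]) auto
    qed
  qed
  then obtain C :: "'a set" where C: "finite C" "\<And>b. b \<in> B0 \<Longrightarrow> (\<Sum>c\<in>C. (b \<bullet> c) *\<^sub>R c) = b"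
    by blast
  have "subspace {v. (\<Sum>c\<in>C. (v \<bullet> c) *\<^sub>R c) = v}"
    by (auto simp: subspace_def inner_add_left scaleR_add_left sum.distrib
        scaleR_sum_right[symmetric] scaleR_scaleR[symmetric] simp del: scaleR_scaleR)
  then have "span B0 \<subseteq> {v. (\<Sum>c\<in>C. (v \<bullet> c) *\<^sub>R c) = v}"
    using C(2) by (intro span_minimal) auto
  then show ?thesis using C(1) assms(2) by (auto simp: onb_def intro!: exI[of _ C])
qed

lemma onb_real: "onb {1::real}"
  by (simp add: onb_def)

text \<open>Both frames may contain 0, and then the two embedded copies meet in
  \<open>(0, 0)\<close>; the zero vector is dropped before the sum over the union is split.\<close>

lemma onb_prod:
  assumes B: "onb (B :: 'a::real_inner set)" and C: "onb (C :: 'b::real_inner set)"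
  shows "onb ((\<lambda>b. (b, 0)) ` B \<union> Pair 0 ` C :: ('a \<times> 'b) set)"
proof -
  have B': "finite B" "\<And>v. (\<Sum>b\<in>B. (v \<bullet> b) *\<^sub>R b) = v" and C': "finite C" "\<And>v. (\<Sum>b\<in>C. (v \<bullet> b) *\<^sub>R b) = v"
    using B C by (auto simp: onb_def)
  have B0: "(\<Sum>b\<in>B - {0}. (v \<bullet> b) *\<^sub>R b) = v" for v
    using B'(1) by (subst (2) B'(2)[of v, symmetric], intro sum.mono_neutral_left) auto
  have C0: "(\<Sum>b\<in>C - {0}. (v \<bullet> b) *\<^sub>R b) = v" for v
    using C'(1) by (subst (2) C'(2)[of v, symmetric], intro sum.mono_neutral_left) auto
  let ?S = "(\<lambda>b. (b, 0)) ` B \<union> Pair 0 ` C :: ('a \<times> 'b) set"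
  let ?f = "\<lambda>v b. (v \<bullet> b) *\<^sub>R b"
  have "(\<Sum>b\<in>?S. ?f v b) = v" for v :: "'a \<times> 'b"
  proof -
    obtain v1 v2 where v: "v = (v1, v2)" by (cases v)
    have "(\<Sum>b\<in>?S. ?f v b) = (\<Sum>b\<in>?S - {0}. ?f v b)"
      using B'(1) C'(1) by (intro sum.mono_neutral_right) auto
    also have "?S - {0} = (\<lambda>b. (b, 0)) ` (B - {0}) \<union> Pair 0 ` (C - {0})"
      by (auto simp: zero_prod_def)
    also have "(\<Sum>b\<in>\<dots>. ?f v b) = (\<Sum>b\<in>(\<lambda>b. (b, 0)) ` (B - {0}). ?f v b) + (\<Sum>b\<in>Pair 0 ` (C - {0}). ?f v b)"
      using B'(1) C'(1) by (intro sum.union_disjoint) auto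
    also have "\<dots> = (\<Sum>b\<in>B - {0}. ((v1 \<bullet> b) *\<^sub>R b, 0)) + (\<Sum>b\<in>C - {0}. (0, (v2 \<bullet> b) *\<^sub>R b))"
      by (simp add: sum.reindex inj_on_def v scaleR_prod_def)
    also have "\<dots> = (\<Sum>b\<in>B - {0}. (v1 \<bullet> b) *\<^sub>R b, \<Sum>b\<in>C - {0}. (v2 \<bullet> b) *\<^sub>R b)"
      by (simp add: prod_eq_iff fst_sum snd_sum)
    finally show ?thesis using v B0 C0 by simp
  qed
  then show ?thesis using B'(1) C'(1) by (auto simp: onb_def)
qed

section \<open>Calculus of maps of class C^k on open sets\<close>

lemma has_derivative_frechet:
  "f differentiable (at x) \<Longrightarrow> (f has_derivative frechet_derivative f (at x)) (at x)"
  by (simp add: frechet_derivative_works)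

lemma frechet_eqI: "(f has_derivative D) (at x) \<Longrightarrow> frechet_derivative f (at x) = D"
  by (metis frechet_derivative_at)

lemma bounded_linear_frechet:
  "f differentiable (at x) \<Longrightarrow> bounded_linear (frechet_derivative f (at x))"
  using has_derivative_frechet has_derivative_bounded_linear by blast

lemma frechet_onb_expand:
  assumes "f differentiable (at x)" "onb B"
  shows "frechet_derivative f (at x) v = (\<Sum>b\<in>B. (v \<bullet> b) *\<^sub>R frechet_derivative f (at x) b)"
proof -
  interpret bounded_linear "frechet_derivative f (at x)"
    by (rule bounded_linear_frechet[OF assms(1)])
  have "(\<Sum>b\<in>B. (v \<bullet> b) *\<^sub>R b) = v" using assms(2) by (auto simp: onb_def)
  then have "frechet_derivative f (at x) v = frechet_derivative f (at x) (\<Sum>b\<in>B. (v \<bullet> b) *\<^sub>R b)" by (rule arg_cong[OF sym])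
  then show ?thesis by (simp only: sum scaleR)
qed

lemma has_derivative_cong_open:
  assumes "open S" "x \<in> S" "\<And>y. y \<in> S \<Longrightarrow> f y = g y"
  shows "(f has_derivative D) (at x) \<longleftrightarrow> (g has_derivative D) (at x)"
  using assms has_derivative_transform_within_open[of f D x UNIV S g]
    has_derivative_transform_within_open[of g D x UNIV S f] by auto

lemma frechet_cong_open:
  assumes "open S" "x \<in> S" "\<And>y. y \<in> S \<Longrightarrow> f y = g y"
  shows "frechet_derivative f (at x) = frechet_derivative g (at x)"
  unfolding frechet_derivative_def using has_derivative_cong_open[OF assms] by simp

lemma Ck_on_cong:
  assumes "open S" "\<And>x. x \<in> S \<Longrightarrow> f x = g x"
  shows "Ck_on k S f \<longleftrightarrow> Ck_on k S g"
  using assms(2)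
proof (induction k arbitrary: f g)
  case 0
  then show ?case by (simp cong: continuous_on_cong)
next
  case (Suc k)
  have "f differentiable (at x) \<longleftrightarrow> g differentiable (at x)" if "x \<in> S" for x
    unfolding differentiable_def using has_derivative_cong_open[OF assms(1) that Suc.prems] by auto
  moreover have "Ck_on k S (\<lambda>x. frechet_derivative f (at x) v) \<longleftrightarrow> Ck_on k S (\<lambda>x. frechet_derivative g (at x) v)" for v
  proof (rule Suc.IH)
    show "frechet_derivative f (at x) v = frechet_derivative g (at x) v" if "x \<in> S" for x
      using frechet_cong_open[OF assms(1) that Suc.prems, THEN fun_cong] .
  qed
  ultimately show ?case by simp
qed

lemma Ck_on_subset: "Ck_on k S f \<Longrightarrow> T \<subseteq> S \<Longrightarrow> Ck_on k T f"
  by (induction k arbitrary: f) (auto intro: continuous_on_subset)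

lemma Ck_on_local:
  assumes "\<And>x. x \<in> S \<Longrightarrow> \<exists>T. open T \<and> x \<in> T \<and> Ck_on k T f"
  shows "Ck_on k S f"
  using assms
proof (induction k arbitrary: f)
  case 0
  then show ?case
    by (force intro: continuous_at_imp_continuous_on simp: continuous_on_eq_continuous_at)
next
  case (Suc k)
  have "f differentiable (at x)" if "x \<in> S" for x using Suc.prems[OF that] by auto
  moreover have "Ck_on k S (\<lambda>x. frechet_derivative f (at x) v)" for v
    using Suc.prems by (intro Suc.IH) (metis Ck_on.simps(2))
  ultimately show ?case by simp
qed

lemma Ck_on_Suc_imp: "Ck_on (Suc k) S f \<Longrightarrow> Ck_on k S f"
proof (induction k arbitrary: f)
  case 0
  then show ?case
    by (auto intro!: continuous_at_imp_continuous_on differentiable_imp_continuous_within)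
next
  case (Suc k)
  then show ?case by (metis Ck_on.simps(2))
qed

lemma Ck_on_const [simp]: "Ck_on k S (\<lambda>x. c)"
  by (induction k arbitrary: c) (auto simp: frechet_derivative_const)

text \<open>The induction step of the closure lemmas: an explicit derivative may stand in for the
  one that \<open>frechet_derivative\<close> picks by choice. Since \<open>S\<close> is open, the
  two agree on \<open>S\<close> and \<open>Ck_on\<close> does not see values elsewhere.\<close>

lemma Ck_on_Suc_deriv:
  assumes "open S" and D: "\<And>x. x \<in> S \<Longrightarrow> (f has_derivative D x) (at x)"
    and "\<And>v. Ck_on k S (\<lambda>x. D x v)"
  shows "Ck_on (Suc k) S f"
proof -
  have "Ck_on k S (\<lambda>x. frechet_derivative f (at x) v)" for v
    using Ck_on_cong[OF assms(1), of "\<lambda>x. frechet_derivative f (at x) v" "\<lambda>x. D x v"]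
      frechet_eqI[OF D] assms(3) by simp
  then show ?thesis using D by (auto simp: differentiable_def)
qed

lemma Ck_on_bounded_linear:
  assumes "open S" "bounded_linear L" "Ck_on k S f"
  shows "Ck_on k S (\<lambda>x. L (f x))"
  using assms(3)
proof (induction k arbitrary: f)
  case 0
  then show ?case by (simp add: bounded_linear.continuous_on[OF assms(2)])
next
  case (Suc k)
  show ?case
  proof (rule Ck_on_Suc_deriv[OF assms(1)])
    show "((\<lambda>x. L (f x)) has_derivative (\<lambda>v. L (frechet_derivative f (at x) v))) (at x)" if "x \<in> S" for x
      using Suc.prems that by (auto intro!: bounded_linear.has_derivative[OF assms(2)] has_derivative_frechet)
    show "Ck_on k S (\<lambda>x. L (frechet_derivative f (at x) v))" for v
      using Suc by simp
  qed
qed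

lemma Ck_on_add:
  assumes "open S" "Ck_on k S f" "Ck_on k S g"
  shows "Ck_on k S (\<lambda>x. f x + g x)"
  using assms(2,3)
proof (induction k arbitrary: f g)
  case 0
  then show ?case by (simp add: continuous_on_add)
next
  case (Suc k)
  show ?case
  proof (rule Ck_on_Suc_deriv[OF assms(1)])
    show "((\<lambda>x. f x + g x) has_derivative (\<lambda>v. frechet_derivative f (at x) v + frechet_derivative g (at x) v)) (at x)"
      if "x \<in> S" for x
      using Suc.prems that by (auto intro!: has_derivative_add has_derivative_frechet)
    show "Ck_on k S (\<lambda>x. frechet_derivative f (at x) v + frechet_derivative g (at x) v)" for v
      using Suc by simp
  qed
qed

lemma Ck_on_sum:
  assumes "open S" "\<And>i. i \<in> I \<Longrightarrow> Ck_on k S (f i)"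
  shows "Ck_on k S (\<lambda>x. \<Sum>i\<in>I. f i x)"
  using assms(2) by (induction I rule: infinite_finite_induct) (auto intro: Ck_on_add[OF assms(1)])

lemma Ck_on_bilinear:
  assumes "open S" "bounded_bilinear pr" "Ck_on k S f" "Ck_on k S g"
  shows "Ck_on k S (\<lambda>x. pr (f x) (g x))"
  using assms(3,4)
proof (induction k arbitrary: f g)
  case 0
  then show ?case by (simp add: bounded_bilinear.continuous_on[OF assms(2)])
next
  case (Suc k)
  show ?case
  proof (rule Ck_on_Suc_deriv[OF assms(1)])
    show "((\<lambda>x. pr (f x) (g x)) has_derivative
        (\<lambda>v. pr (f x) (frechet_derivative g (at x) v) + pr (frechet_derivative f (at x) v) (g x))) (at x)"
      if "x \<in> S" for x
      using Suc.prems that by (auto intro!: bounded_bilinear.FDERIV[OF assms(2)] has_derivative_frechet)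
    show "Ck_on k S (\<lambda>x. pr (f x) (frechet_derivative g (at x) v) + pr (frechet_derivative f (at x) v) (g x))" for v
    proof (intro Ck_on_add[OF assms(1)] Suc.IH)
      show "Ck_on k S f" "Ck_on k S g"
        using Suc.prems by (auto intro: Ck_on_Suc_imp simp del: Ck_on.simps)
    qed (use Suc.prems in auto)
  qed
qed

text \<open>In the chain rule the direction in which \<open>f\<close> is differentiated depends on
  \<open>x\<close>, while \<open>Ck_on\<close> speaks of fixed directions. Expanding that direction
  in the frame \<open>B\<close> leaves a finite sum of products of C^k functions, to which the
  induction hypothesis applies.\<close>

lemma Ck_on_compose:
  fixes g :: "'a::real_normed_vector \<Rightarrow> 'b::real_inner" and f :: "'b \<Rightarrow> 'c::real_normed_vector"
  assumes "open S" "onb (B::'b set)" "g ` S \<subseteq> T" "Ck_on k T f" "Ck_on k S g"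
  shows "Ck_on k S (\<lambda>x. f (g x))"
  using assms(4,5)
proof (induction k arbitrary: f)
  case 0
  then show ?case using continuous_on_compose2[of T f S g] assms(3) by simp
next
  case (Suc k)
  let ?Df = "\<lambda>y. frechet_derivative f (at y)" and ?Dg = "\<lambda>x. frechet_derivative g (at x)"
  show ?case
  proof (rule Ck_on_Suc_deriv[OF assms(1)])
    show "((\<lambda>x. f (g x)) has_derivative (\<lambda>v. \<Sum>b\<in>B. (?Dg x v \<bullet> b) *\<^sub>R ?Df (g x) b)) (at x)"
      if "x \<in> S" for x
    proof -
      have fd: "f differentiable (at (g x))" and gd: "g differentiable (at x)"
        using Suc.prems that assms(3) by auto
      have "((\<lambda>x. f (g x)) has_derivative (\<lambda>v. ?Df (g x) (?Dg x v))) (at x)"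
        using has_derivative_compose[OF has_derivative_frechet[OF gd] has_derivative_frechet[OF fd]] .
      moreover have "?Df (g x) (?Dg x v) = (\<Sum>b\<in>B. (?Dg x v \<bullet> b) *\<^sub>R ?Df (g x) b)" for v
        by (rule frechet_onb_expand[OF fd assms(2)])
      ultimately show ?thesis by simp
    qed
    show "Ck_on k S (\<lambda>x. \<Sum>b\<in>B. (?Dg x v \<bullet> b) *\<^sub>R ?Df (g x) b)" for v
    proof (intro Ck_on_sum Ck_on_bilinear[OF _ bounded_bilinear_scaleR]
          Ck_on_bilinear[OF _ bounded_bilinear_inner] assms(1))
      show "Ck_on k S (\<lambda>x. ?Df (g x) b)" for b
        using Suc.prems by (intro Suc.IH Ck_on_Suc_imp[OF Suc.prems(2)]) auto
      show "Ck_on k S (\<lambda>x. ?Dg x v)" using Suc.prems(2) by simp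
    qed simp
  qed
qed

lemma Ck_on_Pair:
  assumes "open S" "Ck_on k S f" "Ck_on k S g"
  shows "Ck_on k S (\<lambda>x. (f x, g x))"
proof -
  have "Ck_on k S (\<lambda>x. (f x, 0) + (0, g x))"
    by (intro Ck_on_add Ck_on_bounded_linear[of S "\<lambda>y. (y, 0)"] Ck_on_bounded_linear[of S "\<lambda>y. (0, y)"]
        assms bounded_linear_Pair bounded_linear_ident bounded_linear_zero)
  then show ?thesis by simp
qed

lemma Ck_on_id: "Ck_on k S (\<lambda>x. x)"
proof -
  have "Ck_on k UNIV (\<lambda>x::'a. x)"
  proof (cases k)
    case (Suc n)
    then show ?thesis using Ck_on_Suc_deriv[of UNIV "\<lambda>x::'a. x" "\<lambda>x v. v"] by (simp add: has_derivative_ident)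
  qed simp
  then show ?thesis using Ck_on_subset by blast
qed

lemma smooth_on_cong: "open S \<Longrightarrow> (\<And>x. x \<in> S \<Longrightarrow> f x = g x) \<Longrightarrow> smooth_on S f \<longleftrightarrow> smooth_on S g"
  using Ck_on_cong unfolding smooth_on_def by blast

lemma smooth_on_subset: "smooth_on S f \<Longrightarrow> T \<subseteq> S \<Longrightarrow> smooth_on T f"
  using Ck_on_subset unfolding smooth_on_def by blast

lemma smooth_on_local:
  "(\<And>x. x \<in> S \<Longrightarrow> \<exists>T. open T \<and> x \<in> T \<and> smooth_on T f) \<Longrightarrow> smooth_on S f"
  unfolding smooth_on_def by (metis Ck_on_local)

lemma smooth_on_const: "smooth_on S (\<lambda>x. c)"
  by (simp add: smooth_on_def)

lemma smooth_on_id: "smooth_on S (\<lambda>x. x)"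
  by (simp add: smooth_on_def Ck_on_id)

lemma smooth_on_bounded_linear: "open S \<Longrightarrow> bounded_linear L \<Longrightarrow> smooth_on S f \<Longrightarrow> smooth_on S (\<lambda>x. L (f x))"
  by (simp add: smooth_on_def Ck_on_bounded_linear)

lemma smooth_on_add: "open S \<Longrightarrow> smooth_on S f \<Longrightarrow> smooth_on S g \<Longrightarrow> smooth_on S (\<lambda>x. f x + g x)"
  by (simp add: smooth_on_def Ck_on_add)

lemma smooth_on_bilinear:
  "open S \<Longrightarrow> bounded_bilinear pr \<Longrightarrow> smooth_on S f \<Longrightarrow> smooth_on S g \<Longrightarrow> smooth_on S (\<lambda>x. pr (f x) (g x))"
  by (simp add: smooth_on_def Ck_on_bilinear)

lemma smooth_on_compose:
  "open S \<Longrightarrow> \<exists>B :: 'b::real_inner set. onb B \<Longrightarrow> g ` S \<subseteq> T \<Longrightarrow> smooth_on T (f :: 'b \<Rightarrow> _) \<Longrightarrow> smooth_on S g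
    \<Longrightarrow> smooth_on S (\<lambda>x. f (g x))"
  unfolding smooth_on_def by (metis Ck_on_compose)

lemma smooth_on_Pair: "open S \<Longrightarrow> smooth_on S f \<Longrightarrow> smooth_on S g \<Longrightarrow> smooth_on S (\<lambda>x. (f x, g x))"
  by (simp add: smooth_on_def Ck_on_Pair)

lemma smooth_on_frechet: "smooth_on S f \<Longrightarrow> smooth_on S (\<lambda>x. frechet_derivative f (at x) v)"
  unfolding smooth_on_def by (metis Ck_on.simps(2))

lemma smooth_on_differentiable: "smooth_on S f \<Longrightarrow> x \<in> S \<Longrightarrow> f differentiable (at x)"
  unfolding smooth_on_def by (metis Ck_on.simps(2))

lemma smooth_on_continuous: "smooth_on S f \<Longrightarrow> continuous_on S f"
  unfolding smooth_on_def by (metis Ck_on.simps(1))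


lemma Ck_on_le: "i \<le> k \<Longrightarrow> Ck_on k S f \<Longrightarrow> Ck_on i S f"
  by (induction rule: inc_induct) (auto intro: Ck_on_Suc_imp simp del: Ck_on.simps)

section \<open>Integrals along rays and Hadamard's lemma\<close>

lemma ray_in_convex:
  assumes "convex S" "z0 \<in> S" "z \<in> S" "t \<in> {0..1::real}"
  shows "z0 + t *\<^sub>R (z - z0) \<in> S"
proof -
  have "(1 - t) *\<^sub>R z0 + t *\<^sub>R z \<in> S" using assms by (intro convexD) auto
  then show ?thesis by (simp add: algebra_simps)
qed

lemma continuous_on_ray_integrand:
  assumes "convex S" "z0 \<in> S" "continuous_on S (f :: 'a::real_normed_vector \<Rightarrow> real)"
  shows "continuous_on (S \<times> {0..1::real}) (\<lambda>(z, t). t ^ j * f (z0 + t *\<^sub>R (z - z0)))"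
proof -
  have "continuous_on (S \<times> {0..1::real}) (\<lambda>x. f (z0 + snd x *\<^sub>R (fst x - z0)))"
    using ray_in_convex[OF assms(1,2)]
    by (intro continuous_on_compose2[OF assms(3)] continuous_intros) auto
  then show ?thesis by (auto simp: split_beta intro!: continuous_intros)
qed

lemma continuous_on_ray_integrand':
  assumes "convex S" "z0 \<in> S" "continuous_on S (f :: 'a::real_normed_vector \<Rightarrow> real)" "z \<in> S"
  shows "continuous_on {0..1::real} (\<lambda>t. t ^ j * f (z0 + t *\<^sub>R (z - z0)))"
proof -
  have "continuous_on {0..1::real} (\<lambda>t. case (z, t) of (z, t) \<Rightarrow> t ^ j * f (z0 + t *\<^sub>R (z - z0)))"
    using assms(4)
    by (intro continuous_on_compose2[OF continuous_on_ray_integrand[OF assms(1-3), of j], of "{0..1}" "\<lambda>t. (z, t)"])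
      (auto intro!: continuous_intros)
  then show ?thesis by simp
qed

lemma ray_integral_continuous:
  assumes "convex S" "z0 \<in> S" "continuous_on S (f :: 'a::real_normed_vector \<Rightarrow> real)"
  shows "continuous_on S (\<lambda>z. integral {0..1} (\<lambda>t. t ^ j * f (z0 + t *\<^sub>R (z - z0))))"
  using integral_continuous_on_param[of S 0 "1::real" "\<lambda>z t. t ^ j * f (z0 + t *\<^sub>R (z - z0))"]
    continuous_on_ray_integrand[OF assms, of j]
  by (simp add: cbox_interval)

text \<open>A first-order remainder estimate that is uniform in \<open>t\<close>. Since
  \<open>t\<close> runs over a compact interval, a single neighbourhood of \<open>z\<close> controls
  the variation of the partial derivatives along the whole ray, and the mean value inequality does
  the rest.\<close>

lemma ray_increment_bound:
  fixes f :: "'a::real_inner \<Rightarrow> real"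
  assumes S: "open S" "convex S" "z0 \<in> S" and B: "onb B" and f: "Ck_on 1 S f"
    and z: "z \<in> S" and e: "e > 0"
  shows "\<exists>d>0. \<forall>y. norm (y - z) < d \<longrightarrow> y \<in> S \<and> (\<forall>t\<in>{0..1}.
    \<bar>f (z0 + t *\<^sub>R (y - z0)) - f (z0 + t *\<^sub>R (z - z0)) -
       t * (\<Sum>b\<in>B. ((y - z) \<bullet> b) * frechet_derivative f (at (z0 + t *\<^sub>R (z - z0))) b)\<bar> \<le> e * norm (y - z))"
proof -
  let ?D = "\<lambda>y b. frechet_derivative f (at y) b"
  let ?r = "\<lambda>t z. z0 + t *\<^sub>R (z - z0)"
  have finB: "finite B" using B by (simp add: onb_def)
  have fd: "f differentiable (at x)" if "x \<in> S" for x using f that by simp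
  \<comment> \<open>The partial derivatives are made to vary by at most \<open>e / K\<close>, so
    that their weighted sum varies by at most \<open>e * norm v\<close>. The summand 1 keeps
    \<open>K\<close> positive even if all norms in the sum are zero.\<close>
  define K where "K = (\<Sum>b\<in>B. norm b) + 1"
  have K: "K > 0" unfolding K_def by (smt (verit) norm_ge_zero sum_nonneg)
  have "\<exists>X. open X \<and> z \<in> X \<and> (\<forall>w\<in>X \<inter> S. \<forall>t\<in>{0..1}. dist (?D (?r t w) b) (?D (?r t z) b) \<le> e / K)"
    for b
  proof -
    have "continuous_on (S \<times> {0..1::real}) (\<lambda>(z, t). t ^ 0 * ?D (z0 + t *\<^sub>R (z - z0)) b)"
      by (rule continuous_on_ray_integrand) (use S f in auto)
    then have "continuous_on (S \<times> {0..1::real}) (\<lambda>(z, t). ?D (z0 + t *\<^sub>R (z - z0)) b)" by simp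
    from continuous_on_prod_compactE[OF this compact_Icc z, of "e / K"] e K
    show ?thesis by (metis (no_types, lifting) case_prod_conv divide_pos_pos)
  qed
  then obtain X where X: "\<And>b. open (X b)" "\<And>b. z \<in> X b"
    "\<And>b w t. w \<in> X b \<Longrightarrow> w \<in> S \<Longrightarrow> t \<in> {0..1} \<Longrightarrow> dist (?D (?r t w) b) (?D (?r t z) b) \<le> e / K"
    by (metis IntI)
  have "open (S \<inter> (\<Inter>b\<in>B. X b))" "z \<in> S \<inter> (\<Inter>b\<in>B. X b)"
    using X S z finB by auto
  then obtain d where d: "d > 0" "ball z d \<subseteq> S \<inter> (\<Inter>b\<in>B. X b)"
    by (meson open_contains_ball)
  show ?thesis
  proof (intro exI[of _ d] conjI d allI impI)
    fix y assume y: "norm (y - z) < d"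
    then have yb: "y \<in> ball z d" by (simp add: dist_norm norm_minus_commute)
    then show "y \<in> S" using d by auto
    show "\<forall>t\<in>{0..1}. \<bar>f (?r t y) - f (?r t z) - t * (\<Sum>b\<in>B. ((y - z) \<bullet> b) * ?D (?r t z) b)\<bar> \<le> e * norm (y - z)"
    proof
      fix t :: real assume t: "t \<in> {0..1}"
      \<comment> \<open>With the linear part at \<open>z\<close> subtracted, the derivative at
        \<open>w\<close> is a weighted sum of differences of partial derivatives at the ray points
        of \<open>w\<close> and \<open>z\<close>, which are small on the ball.\<close>
      let ?h = "\<lambda>w. f (?r t w) - t * (\<Sum>b\<in>B. (w \<bullet> b) * ?D (?r t z) b)"
      let ?h' = "\<lambda>w v. t * (\<Sum>b\<in>B. (v \<bullet> b) * (?D (?r t w) b - ?D (?r t z) b))"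
      have "norm (?h y - ?h z) \<le> e * norm (y - z)"
      proof (rule differentiable_bound[of "ball z d" ?h ?h'])
        show "convex (ball z d)" by (rule convex_ball)
        fix w assume w: "w \<in> ball z d"
        then have wS: "w \<in> S" and rS: "?r t w \<in> S"
          using d ray_in_convex[OF S(2,3) _ t] by auto
        have 1: "((\<lambda>w. ?r t w) has_derivative (\<lambda>v. t *\<^sub>R v)) (at w)"
          by (auto intro!: derivative_eq_intros)
        have 2: "((\<lambda>w. f (?r t w)) has_derivative (\<lambda>v. ?D (?r t w) (t *\<^sub>R v))) (at w)"
          by (rule has_derivative_compose[OF 1 has_derivative_frechet[OF fd[OF rS]]])
        have 3: "?D (?r t w) (t *\<^sub>R v) = t * (\<Sum>b\<in>B. (v \<bullet> b) * ?D (?r t w) b)" for v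
          using frechet_onb_expand[OF fd[OF rS] B, of "t *\<^sub>R v"] by (simp add: sum_distrib_left mult.assoc)
        have 4: "((\<lambda>w. t * (\<Sum>b\<in>B. (w \<bullet> b) * ?D (?r t z) b)) has_derivative
            (\<lambda>v. t * (\<Sum>b\<in>B. (v \<bullet> b) * ?D (?r t z) b))) (at w)"
          by (rule bounded_linear_imp_has_derivative)
            (intro bounded_linear_mult_right[THEN bounded_linear_compose] bounded_linear_sum
              bounded_linear_mult_left[THEN bounded_linear_compose] bounded_linear_inner_left)
        have "(?h has_derivative ?h' w) (at w)"
          using has_derivative_diff[OF 2 4] 3 by (simp add: right_diff_distrib sum_subtractf)
        then show "(?h has_derivative ?h' w) (at w within ball z d)" by (rule has_derivative_at_withinI)
        show "onorm (?h' w) \<le> e"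
        proof (rule onorm_bound)
          show "norm (?h' w v) \<le> e * norm v" for v
          proof -
            have "norm (?h' w v) \<le> 1 * norm (\<Sum>b\<in>B. (v \<bullet> b) * (?D (?r t w) b - ?D (?r t z) b))"
              unfolding norm_mult using t by (intro mult_right_mono) auto
            also have "\<dots> \<le> (\<Sum>b\<in>B. norm ((v \<bullet> b) * (?D (?r t w) b - ?D (?r t z) b)))"
              by (simp add: sum_abs)
            also have "\<dots> \<le> (\<Sum>b\<in>B. (norm v * norm b) * (e / K))"
            proof (rule sum_mono)
              fix b assume b: "b \<in> B"
              have "w \<in> X b" using w d b by auto
              then have "\<bar>?D (?r t w) b - ?D (?r t z) b\<bar> \<le> e / K"
                using X(3)[OF _ wS t, of b] by (simp add: dist_real_def)
              then show "norm ((v \<bullet> b) * (?D (?r t w) b - ?D (?r t z) b)) \<le> (norm v * norm b) * (e / K)"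
                by (simp only: real_norm_def abs_mult) (intro mult_mono Cauchy_Schwarz_ineq2; simp)
            qed
            also have "\<dots> = norm v * (e / K) * (\<Sum>b\<in>B. norm b)"
              by (simp add: sum_distrib_left sum_divide_distrib mult.commute mult.left_commute)
            also have "\<dots> \<le> norm v * (e / K) * K"
              using e K by (intro mult_left_mono) (auto simp: K_def)
            also have "\<dots> = e * norm v" using K by simp
            finally show ?thesis .
          qed
        qed (use e in simp)
      qed (use yb d in auto)
      then show "\<bar>f (?r t y) - f (?r t z) - t * (\<Sum>b\<in>B. ((y - z) \<bullet> b) * ?D (?r t z) b)\<bar> \<le> e * norm (y - z)"
        by (simp add: inner_diff_left left_diff_distrib sum_subtractf right_diff_distrib algebra_simps)
    qed
  qed
qed

text \<open>Differentiation under the integral sign: the uniform remainder bound is integrated over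
  the unit interval. The inner derivative of the ray contributes a factor \<open>t\<close>, which is
  why the weight \<open>t ^ j\<close> is carried along.\<close>

lemma ray_integral_has_derivative:
  fixes f :: "'a::real_inner \<Rightarrow> real"
  assumes S: "open S" "convex S" "z0 \<in> S" and B: "onb B" and f: "Ck_on 1 S f" and z: "z \<in> S"
  shows "((\<lambda>z. integral {0..1} (\<lambda>t. t ^ j * f (z0 + t *\<^sub>R (z - z0)))) has_derivative
    (\<lambda>v. \<Sum>b\<in>B. (v \<bullet> b) * integral {0..1} (\<lambda>t. t ^ Suc j * frechet_derivative f (at (z0 + t *\<^sub>R (z - z0))) b))) (at z)"
    (is "(?g has_derivative ?g') _")
  unfolding has_derivative_at_alt
proof (intro conjI allI impI)
  let ?D = "\<lambda>y b. frechet_derivative f (at y) b"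
  let ?r = "\<lambda>t z. z0 + t *\<^sub>R (z - z0)"
  have finB: "finite B" using B by (simp add: onb_def)
  show "bounded_linear ?g'"
    by (intro bounded_linear_sum bounded_linear_mult_left[THEN bounded_linear_compose] bounded_linear_inner_left)
  fix e :: real assume e: "e > 0"
  from ray_increment_bound[OF S B f z e]
  obtain d where d: "d > 0" "\<And>y. norm (y - z) < d \<Longrightarrow> y \<in> S"
    "\<And>y t. norm (y - z) < d \<Longrightarrow> t \<in> {0..1} \<Longrightarrow>
      \<bar>f (?r t y) - f (?r t z) - t * (\<Sum>b\<in>B. ((y - z) \<bullet> b) * ?D (?r t z) b)\<bar> \<le> e * norm (y - z)"
    by blast
  have fc: "continuous_on S f" using Ck_on_Suc_imp[of 0 S f] f by simp
  have int: "(\<lambda>t. t ^ i * f (?r t y)) integrable_on {0..1}" if "y \<in> S" for y i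
    by (rule integrable_continuous_real[OF continuous_on_ray_integrand'[OF S(2,3) fc that]])
  have intD: "(\<lambda>t. t ^ i * ?D (?r t z) b) integrable_on {0..1}" for b i
    by (rule integrable_continuous_real[OF continuous_on_ray_integrand'[OF S(2,3) _ z]]) (use f in simp)
  show "\<exists>d>0. \<forall>y. norm (y - z) < d \<longrightarrow> norm (?g y - ?g z - ?g' (y - z)) \<le> e * norm (y - z)"
  proof (intro exI[of _ d] conjI d(1) allI impI)
    fix y assume y: "norm (y - z) < d"
    let ?I = "\<lambda>t. t ^ j * f (?r t y) - t ^ j * f (?r t z) - (\<Sum>b\<in>B. ((y - z) \<bullet> b) * (t ^ Suc j * ?D (?r t z) b))"
    have I: "(?I has_integral (?g y - ?g z - ?g' (y - z))) {0..1}"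
      by (intro has_integral_diff has_integral_sum finB has_integral_mult_right integrable_integral int intD d(2) y z)
    have "norm (?g y - ?g z - ?g' (y - z)) \<le> e * norm (y - z) * measure lborel (cbox 0 (1::real))"
    proof (rule has_integral_bound)
      show "0 \<le> e * norm (y - z)" using e by simp
      show "(?I has_integral (?g y - ?g z - ?g' (y - z))) (cbox 0 1)" using I by (simp add: cbox_interval)
      fix t :: real assume t: "t \<in> cbox 0 1"
      have "?I t = t ^ j * (f (?r t y) - f (?r t z) - t * (\<Sum>b\<in>B. ((y - z) \<bullet> b) * ?D (?r t z) b))"
        by (simp add: right_diff_distrib sum_distrib_left mult_ac)
      also have "norm \<dots> \<le> 1 * (e * norm (y - z))"
        unfolding real_norm_def abs_mult using t d(3)[OF y, of t]
        by (intro mult_mono) (auto simp: power_le_one cbox_interval power_abs)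
      finally show "norm (?I t) \<le> e * norm (y - z)" by simp
    qed
    then show "norm (?g y - ?g z - ?g' (y - z)) \<le> e * norm (y - z)" by simp
  qed
qed

lemma Ck_on_Suc_imp_C1: "Ck_on (Suc k) S f \<Longrightarrow> Ck_on 1 S f"
  by (rule Ck_on_le[of _ "Suc k"]) simp_all

text \<open>The derivative is a combination of integrals of the same kind, with a partial derivative
  in place of \<open>f\<close> and \<open>Suc j\<close> in place of \<open>j\<close>; the induction
  on \<open>k\<close> therefore generalises over both.\<close>

lemma ray_integral_Ck:
  fixes f :: "'a::real_inner \<Rightarrow> real"
  assumes S: "open S" "convex S" "z0 \<in> S" and B: "onb (B::'a set)" and f: "Ck_on k S f"
  shows "Ck_on k S (\<lambda>z. integral {0..1} (\<lambda>t. t ^ j * f (z0 + t *\<^sub>R (z - z0))))"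
  using f
proof (induction k arbitrary: f j)
  case 0
  then show ?case using ray_integral_continuous[OF S(2,3)] by simp
next
  case (Suc k)
  have C1: "Ck_on 1 S f" using Suc.prems by (rule Ck_on_Suc_imp_C1)
  note D = ray_integral_has_derivative[OF S B C1]
  show ?case
  proof (rule Ck_on_Suc_deriv[OF S(1) D])
    show "Ck_on k S (\<lambda>z. \<Sum>b\<in>B. (v \<bullet> b) * integral {0..1} (\<lambda>t. t ^ Suc j * frechet_derivative f (at (z0 + t *\<^sub>R (z - z0))) b))" for v
      using Suc.prems
      by (intro Ck_on_sum[OF S(1)] Ck_on_bounded_linear[OF S(1) bounded_linear_mult_right] Suc.IH) simp
  qed
qed

text \<open>\<open>g b z\<close> is the mean of the partial derivative in direction \<open>b\<close>
  over the segment from \<open>z0\<close> to \<open>z\<close>, and the identity is the fundamental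
  theorem of calculus along that segment. The factor \<open>t ^ 0\<close> presents it as a ray
  integral with \<open>j = 0\<close>, whence smoothness.\<close>

lemma hadamard:
  fixes f :: "'a::real_inner \<Rightarrow> real"
  assumes S: "open S" "convex S" "z0 \<in> S" and B: "onb B" and f: "smooth_on S f"
  shows "\<exists>g. \<forall>b. smooth_on S (g b) \<and> g b z0 = frechet_derivative f (at z0) b \<and>
    (\<forall>z\<in>S. f z - f z0 = (\<Sum>b\<in>B. ((z - z0) \<bullet> b) * g b z))"
proof -
  let ?D = "\<lambda>y b. frechet_derivative f (at y) b"
  let ?r = "\<lambda>t z. z0 + t *\<^sub>R (z - z0)"
  define g where "g = (\<lambda>b z. integral {0..1} (\<lambda>t::real. t ^ 0 * ?D (?r t z) b))"
  have 1: "smooth_on S (g b)" for b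
    using smooth_on_frechet[OF f, of b] ray_integral_Ck[OF S B] unfolding g_def smooth_on_def by blast
  have 2: "g b z0 = ?D z0 b" for b by (simp add: g_def)
  have fd: "f differentiable (at x)" if "x \<in> S" for x using smooth_on_differentiable[OF f that] .
  have 3: "f z - f z0 = (\<Sum>b\<in>B. ((z - z0) \<bullet> b) * g b z)" if z: "z \<in> S" for z
  proof -
    have "((\<lambda>t. f (?r t z)) has_vector_derivative ?D (?r t z) (z - z0)) (at t within {0..1})"
      if t: "t \<in> {0..1}" for t
    proof -
      have rS: "?r t z \<in> S" by (rule ray_in_convex[OF S(2,3) z t])
      have "((\<lambda>t. ?r t z) has_derivative (\<lambda>s. s *\<^sub>R (z - z0))) (at t within {0..1})"
        by (auto intro!: derivative_eq_intros)
      from has_derivative_compose[OF this has_derivative_frechet[OF fd[OF rS]]]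
      show ?thesis using bounded_linear_frechet[OF fd[OF rS]]
        by (simp add: has_vector_derivative_def linear_simps)
    qed
    then have "((\<lambda>t. ?D (?r t z) (z - z0)) has_integral (f (?r 1 z) - f (?r 0 z))) {0..1}"
      by (intro fundamental_theorem_of_calculus) auto
    then have A: "((\<lambda>t. ?D (?r t z) (z - z0)) has_integral (f z - f z0)) {0..1}" by simp
    have "((\<lambda>t. \<Sum>b\<in>B. ((z - z0) \<bullet> b) * (t ^ 0 * ?D (?r t z) b)) has_integral (\<Sum>b\<in>B. ((z - z0) \<bullet> b) * g b z)) {0..1}"
    proof (intro has_integral_sum has_integral_mult_right)
      show "((\<lambda>t. t ^ 0 * ?D (?r t z) b) has_integral g b z) {0..1}" for b
        unfolding g_def
        by (intro integrable_integral integrable_continuous_real continuous_on_ray_integrand'[OF S(2,3) _ z]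
            smooth_on_continuous smooth_on_frechet f)
    qed (use B in \<open>simp add: onb_def\<close>)
    moreover have "(\<Sum>b\<in>B. ((z - z0) \<bullet> b) * (t ^ 0 * ?D (?r t z) b)) = ?D (?r t z) (z - z0)"
      if "t \<in> {0..1}" for t :: real
      using frechet_onb_expand[OF fd[OF ray_in_convex[OF S(2,3) z that]] B, of "z - z0"] by simp
    ultimately have "((\<lambda>t. ?D (?r t z) (z - z0)) has_integral (\<Sum>b\<in>B. ((z - z0) \<bullet> b) * g b z)) {0..1}"
      by (rule has_integral_eq[rotated])
    then show ?thesis using A has_integral_unique by blast
  qed
  show ?thesis using 1 2 3 by blast
qed

section \<open>A flat function and smooth bumps in the model space\<close>

text \<open>\<open>flat_exp 0\<close> is the classical function exp (-1/t), extended by zero to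
  \<open>t \<le> 0\<close>. The powers of 1/t are included so that the family is closed, up to
  linear combinations, under differentiation.\<close>

definition flat_exp :: "nat \<Rightarrow> real \<Rightarrow> real"
  where "flat_exp n t = (if t > 0 then (1 / t) ^ n * exp (- (1 / t)) else 0)"

text \<open>Substituting u = 1/t turns the right-hand limit into u^n / exp u at infinity; to the
  left of 0 the function is constant.\<close>

lemma flat_exp_tendsto: "(flat_exp n \<longlongrightarrow> 0) (at 0)"
proof -
  have "((\<lambda>x. x ^ n / exp x) \<longlongrightarrow> 0) (at_top :: real filter)" by (rule tendsto_power_div_exp_0)
  then have "((\<lambda>t. (1 / t) ^ n / exp (1 / t)) \<longlongrightarrow> 0) (at_right (0::real))"
    using filterlim_inverse_at_top_right by (auto simp: inverse_eq_divide intro: filterlim_compose)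
  then have "(flat_exp n \<longlongrightarrow> 0) (at_right 0)"
    by (rule Lim_transform_eventually) (auto simp: eventually_at_filter flat_exp_def exp_minus divide_inverse)
  moreover have "(flat_exp n \<longlongrightarrow> 0) (at_left 0)"
    by (rule Lim_transform_eventually[OF tendsto_const]) (auto simp: eventually_at_filter flat_exp_def)
  ultimately show ?thesis by (simp add: filterlim_split_at)
qed

lemma flat_exp_has_derivative:
  "(flat_exp n has_real_derivative (flat_exp (n + 2) t - real n * flat_exp (n + 1) t)) (at t)"
proof (cases t "0::real" rule: linorder_cases)
  case less
  have "((\<lambda>_. 0) has_real_derivative 0) (at t)" by simp
  then have "(flat_exp n has_real_derivative 0) (at t)"
    by (rule has_field_derivative_transform_within_open[where S = "{..<0}"]) (use less in \<open>auto simp: flat_exp_def\<close>)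
  then show ?thesis using less by (simp add: flat_exp_def)
next
  case equal
  \<comment> \<open>At 0 the difference quotient of \<open>flat_exp n\<close> is
    \<open>flat_exp (n + 1)\<close> itself, so its limit is already known.\<close>
  have "((\<lambda>h. (flat_exp n (0 + h) - flat_exp n 0) / h) \<longlongrightarrow> 0) (at 0)"
    by (rule Lim_transform_eventually[OF flat_exp_tendsto[of "n + 1"]])
      (auto simp: flat_exp_def eventually_at_filter)
  then show ?thesis using equal by (simp add: DERIV_def flat_exp_def)
next
  case greater
  have u: "((\<lambda>t. 1 / t) has_real_derivative - ((1 / t)\<^sup>2)) (at t)"
    using greater by (auto intro!: derivative_eq_intros simp: power2_eq_square)
  have "((\<lambda>t. (1 / t) ^ n * exp (- (1 / t))) has_real_derivative
      (1 / t) ^ n * (exp (- (1 / t)) * (1 / t)\<^sup>2) + real n * (- ((1 / t)\<^sup>2) * (1 / t) ^ (n - Suc 0)) * exp (- (1 / t))) (at t)"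
    using DERIV_mult'[OF DERIV_power[OF u, of n] DERIV_fun_exp[OF DERIV_minus[OF u]]] by simp
  \<comment> \<open>The exponent \<open>n - Suc 0\<close> produced by the power rule is truncated at
    \<open>n = 0\<close>, where the factor \<open>real n\<close> kills the term; hence the case
    split.\<close>
  also have "(1 / t) ^ n * (exp (- (1 / t)) * (1 / t)\<^sup>2) + real n * (- ((1 / t)\<^sup>2) * (1 / t) ^ (n - Suc 0)) * exp (- (1 / t)) =
      (1 / t) ^ (n + 2) * exp (- (1 / t)) - real n * ((1 / t) ^ (n + 1) * exp (- (1 / t)))"
    by (cases n) (simp_all only: power2_eq_square power_add power_Suc power_0 power_one_right diff_Suc_Suc diff_zero, simp_all add: algebra_simps)
  finally have "((\<lambda>t. (1 / t) ^ n * exp (- (1 / t))) has_real_derivative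
      (1 / t) ^ (n + 2) * exp (- (1 / t)) - real n * ((1 / t) ^ (n + 1) * exp (- (1 / t)))) (at t)" .
  then have "(flat_exp n has_real_derivative
      (1 / t) ^ (n + 2) * exp (- (1 / t)) - real n * ((1 / t) ^ (n + 1) * exp (- (1 / t)))) (at t)"
    by (rule has_field_derivative_transform_within_open[where S = "{0<..}"]) (use greater in \<open>auto simp: flat_exp_def\<close>)
  then show ?thesis using greater by (simp add: flat_exp_def)
qed

lemma smooth_flat_exp: "smooth_on UNIV (flat_exp n)"
proof -
  have "Ck_on k UNIV (flat_exp n)" for k
  proof (induction k arbitrary: n)
    case 0
    show ?case using flat_exp_has_derivative DERIV_isCont by (force simp: continuous_on_eq_continuous_at)
  next
    case (Suc k)
    show ?case
    proof (rule Ck_on_Suc_deriv)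
      show "(flat_exp n has_derivative (\<lambda>v. (flat_exp (n + 2) t + (- real n) * flat_exp (n + 1) t) * v)) (at t)" for t
        using flat_exp_has_derivative[of n t] by (simp add: has_field_derivative_def)
      show "Ck_on k UNIV (\<lambda>t. (flat_exp (n + 2) t + (- real n) * flat_exp (n + 1) t) * v)" for v
        by (intro Ck_on_bounded_linear[OF _ bounded_linear_mult_left] Ck_on_add
            Ck_on_bounded_linear[OF _ bounded_linear_mult_right] Suc.IH open_UNIV)
    qed simp
  qed
  then show ?thesis by (simp add: smooth_on_def)
qed

text \<open>Compose \<open>flat_exp 0\<close> with r^2 - |z - z0|^2, a polynomial that is positive
  exactly on the open ball, and divide by the value at the centre. The difference is written as a
  sum with a negation to match the closure lemmas.\<close>

lemma smooth_bump:
  fixes z0 :: "'a::real_inner"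
  assumes "r > 0" "\<exists>B::'a set. onb B"
  shows "\<exists>\<rho>::'a \<Rightarrow> real. smooth_on UNIV \<rho> \<and> \<rho> z0 = 1 \<and> (\<forall>z. dist z z0 \<ge> r \<longrightarrow> \<rho> z = 0)"
proof -
  define q where "q = (\<lambda>z::'a. r\<^sup>2 + (- ((z + - z0) \<bullet> (z + - z0))))"
  define \<rho> where "\<rho> = (\<lambda>z::'a. inverse (flat_exp 0 (r\<^sup>2)) * flat_exp 0 (q z))"
  have "smooth_on UNIV q" unfolding q_def
    by (intro smooth_on_add smooth_on_const smooth_on_bounded_linear[OF _ bounded_linear_minus[OF bounded_linear_ident]]
        smooth_on_bilinear[OF _ bounded_bilinear_inner] smooth_on_id open_UNIV)
  then have "smooth_on UNIV \<rho>" unfolding \<rho>_def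
    by (intro smooth_on_bounded_linear[OF _ bounded_linear_mult_right]
        smooth_on_compose[of UNIV q UNIV "flat_exp 0"] smooth_flat_exp open_UNIV exI[of _ "{1}"] onb_real) auto
  moreover have "\<rho> z0 = 1" using assms(1) by (simp add: \<rho>_def q_def flat_exp_def)
  moreover have "\<rho> z = 0" if "dist z z0 \<ge> r" for z
  proof -
    have "r\<^sup>2 \<le> (norm (z - z0))\<^sup>2" using that assms(1) by (intro power_mono) (auto simp: dist_norm)
    then show ?thesis by (simp add: \<rho>_def q_def flat_exp_def dot_square_norm)
  qed
  ultimately show ?thesis by blast
qed


section \<open>Smooth maps near a point\<close>

text \<open>A weakening of \<open>smooth_manifold\<close>, without separation and countability axioms, that holds for
  products and for the one-chart atlas of a model space.\<close>

definition smooth_atlas :: "('m::topological_space, 'e::real_inner) chart set \<Rightarrow> bool"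
  where "smooth_atlas A \<longleftrightarrow>
    (\<exists>B::'e set. onb B) \<and> (\<forall>x. \<exists>U \<phi>. (U, \<phi>) \<in> A \<and> x \<in> U) \<and>
    (\<forall>U \<phi>. (U, \<phi>) \<in> A \<longrightarrow> open U \<and> open (\<phi> ` U) \<and> inj_on \<phi> U \<and> continuous_on U \<phi> \<and>
       continuous_on (\<phi> ` U) (inv_into U \<phi>)) \<and>
    (\<forall>U \<phi> V \<psi>. (U, \<phi>) \<in> A \<longrightarrow> (V, \<psi>) \<in> A \<longrightarrow> smooth_on (\<phi> ` (U \<inter> V)) (\<psi> \<circ> inv_into U \<phi>))"

text \<open>Makes a model space a manifold, so that charts, their inverses and real-valued functions
  are treated as maps between manifolds and compose with all others.\<close>

definition std_atlas :: "('e, 'e::real_normed_vector) chart set"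
  where "std_atlas = {(UNIV, id)}"

text \<open>Smoothness on a neighbourhood \<open>W\<close> of \<open>x\<close>, witnessed by some
  pair of charts. It is easy to establish; \<open>smooth_at_charts\<close> then supplies any desired
  charts and arbitrarily small neighbourhoods. Continuity is a consequence.\<close>

definition smooth_at ::
    "('m::topological_space, 'e::real_normed_vector) chart set \<Rightarrow>
     ('n::topological_space, 'f::real_normed_vector) chart set \<Rightarrow> ('m \<Rightarrow> 'n) \<Rightarrow> 'm \<Rightarrow> bool"
  where "smooth_at A B F x \<longleftrightarrow> (\<exists>U \<phi> V \<psi> W. (U, \<phi>) \<in> A \<and> (V, \<psi>) \<in> B \<and> open W \<and> x \<in> W \<and> W \<subseteq> U \<and>
    F ` W \<subseteq> V \<and> smooth_on (\<phi> ` W) (\<psi> \<circ> F \<circ> inv_into U \<phi>))"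

lemma smooth_atI:
  "(U, \<phi>) \<in> A \<Longrightarrow> (V, \<psi>) \<in> B \<Longrightarrow> open W \<Longrightarrow> x \<in> W \<Longrightarrow> W \<subseteq> U \<Longrightarrow> F ` W \<subseteq> V \<Longrightarrow>
    smooth_on (\<phi> ` W) (\<psi> \<circ> F \<circ> inv_into U \<phi>) \<Longrightarrow> smooth_at A B F x"
  unfolding smooth_at_def by (rule exI[of _ U], rule exI[of _ \<phi>], rule exI[of _ V], rule exI[of _ \<psi>], rule exI[of _ W]) blast

lemma smooth_on_eq:
  "open S \<Longrightarrow> smooth_on S f \<Longrightarrow> (\<And>x. x \<in> S \<Longrightarrow> f x = g x) \<Longrightarrow> smooth_on S g"
  using smooth_on_cong[of S f g] by simp

lemma smooth_manifold_atlas: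
  fixes A :: "('m::{t2_space, second_countable_topology}, 'e::real_inner) chart set"
  assumes "smooth_manifold A" shows "smooth_atlas A"
  unfolding smooth_atlas_def
proof (intro conjI allI impI)
  show "\<exists>B::'e set. onb B" using assms onb_exists by (auto simp: smooth_manifold_def)
  show "\<exists>U \<phi>. (U, \<phi>) \<in> A \<and> x \<in> U" for x
  proof -
    have "x \<in> (\<Union>(U, \<phi>)\<in>A. U)" using assms by (simp add: smooth_manifold_def)
    then show ?thesis by auto
  qed
  fix U \<phi> assume U: "(U, \<phi>) \<in> A"
  then have h: "open U" "open (\<phi> ` U)" "\<exists>\<psi>. homeomorphism U (\<phi> ` U) \<phi> \<psi>"
    using assms unfolding smooth_manifold_def by auto
  then show "open U" "open (\<phi> ` U)" by auto
  from h obtain \<psi> where h: "homeomorphism U (\<phi> ` U) \<phi> \<psi>" by blast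
  show "continuous_on U \<phi>" using h by (simp add: homeomorphism_def)
  show inj: "inj_on \<phi> U" using h by (metis homeomorphism_apply1 inj_onI)
  have "continuous_on (\<phi> ` U) \<psi>" using h by (simp add: homeomorphism_def)
  moreover have "\<psi> z = inv_into U \<phi> z" if "z \<in> \<phi> ` U" for z
    using that inj h by (auto simp: homeomorphism_def)
  ultimately show "continuous_on (\<phi> ` U) (inv_into U \<phi>)" by (simp cong: continuous_on_cong)
next
  fix U \<phi> V \<psi> assume "(U, \<phi>) \<in> A" "(V, \<psi>) \<in> A"
  then show "smooth_on (\<phi> ` (U \<inter> V)) (\<psi> \<circ> inv_into U \<phi>)"
    using assms unfolding smooth_manifold_def by auto
qed

context
  fixes A :: "('m::topological_space, 'e::real_inner) chart set"
  assumes A: "smooth_atlas A"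
begin

lemma atlas_onb: "\<exists>B::'e set. onb B"
  using A by (simp add: smooth_atlas_def)

lemma atlas_cover: obtains U \<phi> where "(U, \<phi>) \<in> A" "x \<in> U"
proof -
  have "\<exists>U \<phi>. (U, \<phi>) \<in> A \<and> x \<in> U" using A by (simp add: smooth_atlas_def)
  then show thesis using that by blast
qed

lemma chartD:
  assumes "(U, \<phi>) \<in> A"
  shows "open U" "open (\<phi> ` U)" "inj_on \<phi> U" "continuous_on U \<phi>" "continuous_on (\<phi> ` U) (inv_into U \<phi>)"
  using A assms unfolding smooth_atlas_def by blast+

lemma chart_inv [simp]: "(U, \<phi>) \<in> A \<Longrightarrow> x \<in> U \<Longrightarrow> inv_into U \<phi> (\<phi> x) = x"
  using chartD(3) by (rule inv_into_f_f)

lemma chart_transition: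
  "(U, \<phi>) \<in> A \<Longrightarrow> (V, \<psi>) \<in> A \<Longrightarrow> smooth_on (\<phi> ` (U \<inter> V)) (\<psi> \<circ> inv_into U \<phi>)"
  using A unfolding smooth_atlas_def by blast

lemma chart_open_image:
  assumes U: "(U, \<phi>) \<in> A" and "open W" "W \<subseteq> U"
  shows "open (\<phi> ` W)"
proof -
  have "open (inv_into U \<phi> -` W \<inter> \<phi> ` U)"
    using continuous_on_open_vimage[OF chartD(2)[OF U]] chartD(5)[OF U] assms(2) by blast
  also have "inv_into U \<phi> -` W \<inter> \<phi> ` U = \<phi> ` W"
    using assms(3) chart_inv[OF U] by (force simp: image_iff)
  finally show ?thesis .
qed

end

text \<open>On \<open>W\<close> the map is the inverse chart of the target after the local
  representative after the chart of the source, three continuous maps.\<close>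

lemma smooth_at_continuous_on:
  assumes A: "smooth_atlas A" and B: "smooth_atlas B" and U: "(U, \<phi>) \<in> A" and V: "(V, \<psi>) \<in> B"
    and W: "open W" "W \<subseteq> U" "F ` W \<subseteq> V" "smooth_on (\<phi> ` W) (\<psi> \<circ> F \<circ> inv_into U \<phi>)"
  shows "continuous_on W F"
proof -
  have "continuous_on W (\<lambda>y. inv_into V \<psi> ((\<psi> \<circ> F \<circ> inv_into U \<phi>) (\<phi> y)))"
  proof (rule continuous_on_compose2[OF chartD(5)[OF B V]])
    show "continuous_on W (\<lambda>y. (\<psi> \<circ> F \<circ> inv_into U \<phi>) (\<phi> y))"
      by (rule continuous_on_compose2[OF smooth_on_continuous[OF W(4)]])
        (use continuous_on_subset[OF chartD(4)[OF A U] W(2)] in auto)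
    show "(\<lambda>y. (\<psi> \<circ> F \<circ> inv_into U \<phi>) (\<phi> y)) ` W \<subseteq> \<psi> ` V"
      using W chart_inv[OF A U] by force
  qed
  moreover have "inv_into V \<psi> ((\<psi> \<circ> F \<circ> inv_into U \<phi>) (\<phi> y)) = F y" if "y \<in> W" for y
  proof -
    have "inv_into U \<phi> (\<phi> y) = y" "F y \<in> V" using that W chart_inv[OF A U] by auto
    then show ?thesis using chart_inv[OF B V] by simp
  qed
  ultimately show ?thesis by (simp cong: continuous_on_cong)
qed

text \<open>In the new charts the representative is the old one between two transition maps.
  Continuity of \<open>F\<close> makes the preimage of \<open>V'\<close> open, which allows
  \<open>W\<close> to shrink until the transition maps apply.\<close>

lemma smooth_at_charts:
  assumes A: "smooth_atlas A" and B: "smooth_atlas B" and F: "smooth_at A B F x"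
    and U': "(U', \<phi>') \<in> A" "x \<in> U'" and V': "(V', \<psi>') \<in> B" "F x \<in> V'" and N: "open N" "x \<in> N"
  obtains W where "open W" "x \<in> W" "W \<subseteq> U'" "W \<subseteq> N" "F ` W \<subseteq> V'" "continuous_on W F"
    "smooth_on (\<phi>' ` W) (\<psi>' \<circ> F \<circ> inv_into U' \<phi>')"
proof -
  obtain U \<phi> V \<psi> W0 where U: "(U, \<phi>) \<in> A" and V: "(V, \<psi>) \<in> B"
    and W0: "open W0" "x \<in> W0" "W0 \<subseteq> U" "F ` W0 \<subseteq> V" "smooth_on (\<phi> ` W0) (\<psi> \<circ> F \<circ> inv_into U \<phi>)"
    using F unfolding smooth_at_def by auto
  have cF: "continuous_on W0 F" by (rule smooth_at_continuous_on[OF A B U V W0(1,3,4,5)])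
  define W where "W = (F -` V' \<inter> W0) \<inter> U' \<inter> N"
  have "open (F -` V' \<inter> W0)"
    using cF continuous_on_open_vimage[OF W0(1)] chartD(1)[OF B V'(1)] by blast
  then have W: "open W" "x \<in> W" using chartD(1)[OF A U'(1)] N U' V' W0 by (auto simp: W_def)
  have WS: "W \<subseteq> W0" "W \<subseteq> U'" "W \<subseteq> N" "W \<subseteq> U" "F ` W \<subseteq> V" "F ` W \<subseteq> V'" using W0 by (auto simp: W_def)
  have oW: "open (\<phi>' ` W)" by (rule chart_open_image[OF A U'(1) W(1) WS(2)])
  let ?t1 = "\<phi> \<circ> inv_into U' \<phi>'" and ?h = "\<psi> \<circ> F \<circ> inv_into U \<phi>" and ?t2 = "\<psi>' \<circ> inv_into V \<psi>"
  have s1: "smooth_on (\<phi>' ` W) ?t1"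
    using chart_transition[OF A U'(1) U] by (rule smooth_on_subset) (use WS in auto)
  have s2: "smooth_on (\<phi>' ` W) (\<lambda>z. ?h (?t1 z))"
    by (rule smooth_on_compose[OF oW atlas_onb[OF A] _ W0(5) s1])
      (use WS chart_inv[OF A U'(1)] in \<open>auto simp: subset_iff\<close>)
  have i1: "?h (?t1 (\<phi>' y)) = \<psi> (F y)" if "y \<in> W" for y
  proof -
    have "inv_into U' \<phi>' (\<phi>' y) = y" "inv_into U \<phi> (\<phi> y) = y"
      using that WS chart_inv[OF A U'(1)] chart_inv[OF A U] by auto
    then show ?thesis by simp
  qed
  have "smooth_on (\<phi>' ` W) (\<lambda>z. ?t2 (?h (?t1 z)))"
    by (rule smooth_on_compose[OF oW atlas_onb[OF B] _ chart_transition[OF B V V'(1)] s2])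
      (use WS i1 in \<open>auto simp: subset_iff\<close>)
  moreover have "?t2 (?h (?t1 z)) = (\<psi>' \<circ> F \<circ> inv_into U' \<phi>') z" if z: "z \<in> \<phi>' ` W" for z
  proof -
    obtain y where y: "y \<in> W" "z = \<phi>' y" using z by blast
    have "inv_into U' \<phi>' (\<phi>' y) = y" "inv_into V \<psi> (\<psi> (F y)) = F y"
      using y(1) WS chart_inv[OF A U'(1)] chart_inv[OF B V] by auto
    then show ?thesis using i1[OF y(1)] y(2) by (simp only: comp_apply)
  qed
  ultimately have "smooth_on (\<phi>' ` W) (\<psi>' \<circ> F \<circ> inv_into U' \<phi>')"
    by (rule smooth_on_eq[OF oW])
  then show ?thesis using that[OF W WS(2,3,6) continuous_on_subset[OF cF WS(1)]] by simp
qed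

lemma smooth_map_on_imp_smooth_at:
  assumes A: "smooth_atlas A" and B: "smooth_atlas B" and F: "smooth_map_on A B S F" and S: "open S" "x \<in> S"
  shows "smooth_at A B F x"
proof -
  obtain U \<phi> where U: "(U, \<phi>) \<in> A" "x \<in> U" using atlas_cover[OF A] .
  obtain V \<psi> where V: "(V, \<psi>) \<in> B" "F x \<in> V" using atlas_cover[OF B] .
  have "open (F -` V \<inter> S)"
    using F continuous_on_open_vimage[OF S(1)] chartD(1)[OF B V(1)] unfolding smooth_map_on_def by blast
  then have "open (U \<inter> S \<inter> F -` V)" using chartD(1)[OF A U(1)] by (metis inf_assoc inf_commute open_Int)
  moreover have "smooth_on (\<phi> ` (U \<inter> S \<inter> F -` V)) (\<psi> \<circ> F \<circ> inv_into U \<phi>)"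
    using F U V unfolding smooth_map_on_def by blast
  ultimately show ?thesis unfolding smooth_at_def using U V S
    by (intro exI[of _ U] exI[of _ \<phi>] exI[of _ V] exI[of _ \<psi>] exI[of _ "U \<inter> S \<inter> F -` V"]) auto
qed

lemma smooth_at_compose:
  assumes A: "smooth_atlas A" and B: "smooth_atlas B" and C: "smooth_atlas C"
    and F: "smooth_at A B F x" and G: "smooth_at B C G (F x)"
  shows "smooth_at A C (\<lambda>y. G (F y)) x"
proof -
  obtain U \<phi> where U: "(U, \<phi>) \<in> A" "x \<in> U" using atlas_cover[OF A] .
  obtain V \<psi> where V: "(V, \<psi>) \<in> B" "F x \<in> V" using atlas_cover[OF B] .
  obtain Z \<kappa> where Z: "(Z, \<kappa>) \<in> C" "G (F x) \<in> Z" using atlas_cover[OF C] .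
  obtain W2 where W2: "open W2" "F x \<in> W2" "W2 \<subseteq> V" "G ` W2 \<subseteq> Z" "smooth_on (\<psi> ` W2) (\<kappa> \<circ> G \<circ> inv_into V \<psi>)"
    using smooth_at_charts[OF B C G V Z open_UNIV UNIV_I] by metis
  obtain W1 where W1: "open W1" "x \<in> W1" "W1 \<subseteq> U" "F ` W1 \<subseteq> V" "continuous_on W1 F"
      "smooth_on (\<phi> ` W1) (\<psi> \<circ> F \<circ> inv_into U \<phi>)"
    using smooth_at_charts[OF A B F U V open_UNIV UNIV_I] by metis
  define W where "W = F -` W2 \<inter> W1"
  have "open (F -` W2 \<inter> W1)" using W1(5) W2(1) continuous_on_open_vimage[OF W1(1)] by blast
  then have W: "open W" "x \<in> W" "W \<subseteq> U" "W \<subseteq> W1"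
    using W1 W2 by (auto simp: W_def)
  have oW: "open (\<phi> ` W)" by (rule chart_open_image[OF A U(1) W(1,3)])
  have inv: "inv_into U \<phi> (\<phi> y) = y" if "y \<in> W" for y using that W chart_inv[OF A U(1)] by auto
  have invF: "inv_into V \<psi> (\<psi> (F y)) = F y" if "y \<in> W" for y
    using that W1(4) chart_inv[OF B V(1)] W(4) by auto
  have "smooth_on (\<phi> ` W) (\<lambda>z. (\<kappa> \<circ> G \<circ> inv_into V \<psi>) ((\<psi> \<circ> F \<circ> inv_into U \<phi>) z))"
    by (rule smooth_on_compose[OF oW atlas_onb[OF B] _ W2(5) smooth_on_subset[OF W1(6)]])
      (use W inv in \<open>auto simp: W_def\<close>)
  moreover have "(\<kappa> \<circ> G \<circ> inv_into V \<psi>) ((\<psi> \<circ> F \<circ> inv_into U \<phi>) z) = (\<kappa> \<circ> (\<lambda>y. G (F y)) \<circ> inv_into U \<phi>) z"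
    if "z \<in> \<phi> ` W" for z using that inv invF by auto
  ultimately have "smooth_on (\<phi> ` W) (\<kappa> \<circ> (\<lambda>y. G (F y)) \<circ> inv_into U \<phi>)"
    by (rule smooth_on_eq[OF oW])
  then show ?thesis unfolding smooth_at_def using U Z W W2(4)
    by (intro exI[of _ U] exI[of _ \<phi>] exI[of _ Z] exI[of _ \<kappa>] exI[of _ W]) (auto simp: W_def)
qed

lemma smooth_at_cong:
  assumes A: "smooth_atlas A" and B: "smooth_atlas B" and N: "open N" "x \<in> N" "\<And>y. y \<in> N \<Longrightarrow> F y = G y"
    and F: "smooth_at A B F x"
  shows "smooth_at A B G x"
proof -
  obtain U \<phi> where U: "(U, \<phi>) \<in> A" "x \<in> U" using atlas_cover[OF A] .
  obtain V \<psi> where V: "(V, \<psi>) \<in> B" "F x \<in> V" using atlas_cover[OF B] .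
  obtain W where W: "open W" "x \<in> W" "W \<subseteq> U" "W \<subseteq> N" "F ` W \<subseteq> V" "smooth_on (\<phi> ` W) (\<psi> \<circ> F \<circ> inv_into U \<phi>)"
    using smooth_at_charts[OF A B F U V N(1,2)] by metis
  have "smooth_on (\<phi> ` W) (\<psi> \<circ> G \<circ> inv_into U \<phi>)"
  proof (subst smooth_on_cong[OF chart_open_image[OF A U(1) W(1,3)], symmetric])
    show "(\<psi> \<circ> F \<circ> inv_into U \<phi>) z = (\<psi> \<circ> G \<circ> inv_into U \<phi>) z" if "z \<in> \<phi> ` W" for z
      using that W chart_inv[OF A U(1)] N(3) by (auto simp: subset_iff)
  qed (rule W)
  moreover have "G ` W = F ` W" by (rule image_cong) (use W N in auto)
  ultimately show ?thesis unfolding smooth_at_def using U V W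
    by (intro exI[of _ U] exI[of _ \<phi>] exI[of _ V] exI[of _ \<psi>] exI[of _ W]) simp
qed

lemma smooth_at_vimage_nhd:
  assumes A: "smooth_atlas A" and B: "smooth_atlas B" and F: "smooth_at A B F x" and S: "open S" "F x \<in> S"
  shows "\<exists>N. open N \<and> x \<in> N \<and> (\<forall>y\<in>N. F y \<in> S)"
proof -
  obtain U \<phi> where U: "(U, \<phi>) \<in> A" "x \<in> U" using atlas_cover[OF A] .
  obtain V \<psi> where V: "(V, \<psi>) \<in> B" "F x \<in> V" using atlas_cover[OF B] .
  obtain W where W: "open W" "x \<in> W" "continuous_on W F"
    using smooth_at_charts[OF A B F U V open_UNIV UNIV_I] by metis
  then have "open (F -` S \<inter> W)" using S continuous_on_open_vimage[OF W(1)] by blast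
  then show ?thesis using W S by (intro exI[of _ "F -` S \<inter> W"]) auto
qed

lemma smooth_at_id: assumes A: "smooth_atlas A" shows "smooth_at A A (\<lambda>x. x) x"
proof -
  obtain U \<phi> where U: "(U, \<phi>) \<in> A" "x \<in> U" using atlas_cover[OF A] .
  have "smooth_on (\<phi> ` U) (\<phi> \<circ> (\<lambda>x. x) \<circ> inv_into U \<phi>)"
    using chart_transition[OF A U(1) U(1)] by (simp add: comp_def)
  then show ?thesis unfolding smooth_at_def using U chartD(1)[OF A U(1)] by blast
qed

lemma smooth_at_const: assumes A: "smooth_atlas A" and B: "smooth_atlas B" shows "smooth_at A B (\<lambda>x. c) x"
proof -
  obtain U \<phi> where U: "(U, \<phi>) \<in> A" "x \<in> U" using atlas_cover[OF A] .
  obtain V \<psi> where V: "(V, \<psi>) \<in> B" "c \<in> V" using atlas_cover[OF B] .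
  have "smooth_on (\<phi> ` U) (\<psi> \<circ> (\<lambda>x. c) \<circ> inv_into U \<phi>)" by (simp add: comp_def smooth_on_const)
  then show ?thesis unfolding smooth_at_def using U V chartD(1)[OF A U(1)] by blast
qed

section \<open>Products of manifolds and the one-chart atlas\<close>

lemma prod_atlasI: "(U, \<phi>) \<in> A \<Longrightarrow> (V, \<psi>) \<in> B \<Longrightarrow> (U \<times> V, map_prod \<phi> \<psi>) \<in> prod_atlas A B"
  unfolding prod_atlas_def by blast

lemma inv_into_prod:
  assumes "smooth_atlas A" "smooth_atlas B" "(U, \<phi>) \<in> A" "(V, \<psi>) \<in> B" "z \<in> \<phi> ` U" "w \<in> \<psi> ` V"
  shows "inv_into (U \<times> V) (map_prod \<phi> \<psi>) (z, w) = (inv_into U \<phi> z, inv_into V \<psi> w)"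
proof (rule inv_into_f_eq)
  show "inj_on (map_prod \<phi> \<psi>) (U \<times> V)"
    using chartD(3)[OF assms(1,3)] chartD(3)[OF assms(2,4)] by (rule map_prod_inj_on)
  show "(inv_into U \<phi> z, inv_into V \<psi> w) \<in> U \<times> V" "map_prod \<phi> \<psi> (inv_into U \<phi> z, inv_into V \<psi> w) = (z, w)"
    using assms(5,6) by (auto simp: inv_into_into f_inv_into_f)
qed

lemma map_prod_image_Times: "map_prod f g ` (S \<times> T) = (f ` S) \<times> (g ` T)"
  by force

lemma smooth_atlas_prod:
  assumes A: "smooth_atlas A" and B: "smooth_atlas B"
  shows "smooth_atlas (prod_atlas A B)"
  unfolding smooth_atlas_def
proof (intro conjI allI impI)
  show "\<exists>B::('b \<times> 'd) set. onb B" using onb_prod atlas_onb[OF A] atlas_onb[OF B] by blast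
  show "\<exists>U \<phi>. (U, \<phi>) \<in> prod_atlas A B \<and> x \<in> U" for x
    using atlas_cover[OF A, of "fst x"] atlas_cover[OF B, of "snd x"]
    by (metis mem_Times_iff prod_atlasI)
next
  fix W \<kappa> assume "(W, \<kappa>) \<in> prod_atlas A B"
  then obtain U \<phi> V \<psi> where W: "W = U \<times> V" "\<kappa> = map_prod \<phi> \<psi>" and U: "(U, \<phi>) \<in> A" and V: "(V, \<psi>) \<in> B"
    unfolding prod_atlas_def by blast
  show "open W" "open (\<kappa> ` W)"
    using chartD(1,2)[OF A U] chartD(1,2)[OF B V] by (auto simp: W map_prod_image_Times open_Times)
  show "inj_on \<kappa> W" using chartD(3)[OF A U] chartD(3)[OF B V] W by (auto intro: map_prod_inj_on)
  have "continuous_on (U \<times> V) (\<lambda>x. (\<phi> (fst x), \<psi> (snd x)))"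
    by (intro continuous_intros continuous_on_compose2[OF chartD(4)[OF A U]] continuous_on_compose2[OF chartD(4)[OF B V]]) auto
  then show "continuous_on W \<kappa>" by (simp add: W map_prod_def split_beta')
  have "continuous_on (\<phi> ` U \<times> \<psi> ` V) (\<lambda>x. (inv_into U \<phi> (fst x), inv_into V \<psi> (snd x)))"
    by (intro continuous_intros continuous_on_compose2[OF chartD(5)[OF A U]] continuous_on_compose2[OF chartD(5)[OF B V]]) auto
  moreover have "(inv_into U \<phi> (fst x), inv_into V \<psi> (snd x)) = inv_into (U \<times> V) (map_prod \<phi> \<psi>) x"
    if "x \<in> \<phi> ` U \<times> \<psi> ` V" for x
    using that inv_into_prod[OF A B U V, of "fst x" "snd x"] by auto
  ultimately show "continuous_on (\<kappa> ` W) (inv_into W \<kappa>)"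
    by (simp add: W map_prod_image_Times cong: continuous_on_cong)
next
  fix W \<kappa> W' \<kappa>' assume "(W, \<kappa>) \<in> prod_atlas A B" "(W', \<kappa>') \<in> prod_atlas A B"
  then obtain U \<phi> V \<psi> U' \<phi>' V' \<psi>' where W: "W = U \<times> V" "\<kappa> = map_prod \<phi> \<psi>" and U: "(U, \<phi>) \<in> A" and V: "(V, \<psi>) \<in> B"
    and W': "W' = U' \<times> V'" "\<kappa>' = map_prod \<phi>' \<psi>'" and U': "(U', \<phi>') \<in> A" and V': "(V', \<psi>') \<in> B"
    unfolding prod_atlas_def by blast
  let ?S = "\<phi> ` (U \<inter> U')" and ?T = "\<psi> ` (V \<inter> V')"
  have im: "\<kappa> ` (W \<inter> W') = ?S \<times> ?T" by (simp add: W W' Times_Int_Times map_prod_image_Times)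
  have o: "open (?S \<times> ?T)"
    by (intro open_Times chart_open_image[OF A U] chart_open_image[OF B V] open_Int
        chartD(1)[OF A U] chartD(1)[OF A U'] chartD(1)[OF B V] chartD(1)[OF B V']) auto
  have s1: "smooth_on (?S \<times> ?T) (\<lambda>z. (\<phi>' \<circ> inv_into U \<phi>) (fst z))"
    by (rule smooth_on_compose[OF o atlas_onb[OF A] _ chart_transition[OF A U U']])
      (auto intro: smooth_on_bounded_linear[OF o bounded_linear_fst smooth_on_id])
  have s2: "smooth_on (?S \<times> ?T) (\<lambda>z. (\<psi>' \<circ> inv_into V \<psi>) (snd z))"
    by (rule smooth_on_compose[OF o atlas_onb[OF B] _ chart_transition[OF B V V']])
      (auto intro: smooth_on_bounded_linear[OF o bounded_linear_snd smooth_on_id])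
  have "smooth_on (?S \<times> ?T) (\<lambda>z. ((\<phi>' \<circ> inv_into U \<phi>) (fst z), (\<psi>' \<circ> inv_into V \<psi>) (snd z)))"
    by (rule smooth_on_Pair[OF o s1 s2])
  moreover have "((\<phi>' \<circ> inv_into U \<phi>) (fst z), (\<psi>' \<circ> inv_into V \<psi>) (snd z)) = (\<kappa>' \<circ> inv_into W \<kappa>) z"
    if "z \<in> ?S \<times> ?T" for z
  proof -
    have "inv_into (U \<times> V) (map_prod \<phi> \<psi>) (fst z, snd z) = (inv_into U \<phi> (fst z), inv_into V \<psi> (snd z))"
      by (rule inv_into_prod[OF A B U V]) (use that in auto)
    then show ?thesis by (simp add: W W')
  qed
  ultimately show "smooth_on (\<kappa> ` (W \<inter> W')) (\<kappa>' \<circ> inv_into W \<kappa>)"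
    unfolding im by (rule smooth_on_eq[OF o])
qed

lemma smooth_at_Pair:
  assumes A: "smooth_atlas A" and B: "smooth_atlas B" and C: "smooth_atlas C"
    and F: "smooth_at A B F x" and G: "smooth_at A C G x"
  shows "smooth_at A (prod_atlas B C) (\<lambda>y. (F y, G y)) x"
proof -
  obtain U \<phi> where U: "(U, \<phi>) \<in> A" "x \<in> U" using atlas_cover[OF A] .
  obtain V \<psi> where V: "(V, \<psi>) \<in> B" "F x \<in> V" using atlas_cover[OF B] .
  obtain Z \<kappa> where Z: "(Z, \<kappa>) \<in> C" "G x \<in> Z" using atlas_cover[OF C] .
  obtain W1 where W1: "open W1" "x \<in> W1" "W1 \<subseteq> U" "F ` W1 \<subseteq> V" "smooth_on (\<phi> ` W1) (\<psi> \<circ> F \<circ> inv_into U \<phi>)"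
    using smooth_at_charts[OF A B F U V open_UNIV UNIV_I] by metis
  obtain W2 where W2: "open W2" "x \<in> W2" "W2 \<subseteq> U" "G ` W2 \<subseteq> Z" "smooth_on (\<phi> ` W2) (\<kappa> \<circ> G \<circ> inv_into U \<phi>)"
    using smooth_at_charts[OF A C G U Z open_UNIV UNIV_I] by metis
  have o: "open (\<phi> ` (W1 \<inter> W2))" by (rule chart_open_image[OF A U(1)]) (use W1 W2 in auto)
  have "smooth_on (\<phi> ` (W1 \<inter> W2)) (\<lambda>z. ((\<psi> \<circ> F \<circ> inv_into U \<phi>) z, (\<kappa> \<circ> G \<circ> inv_into U \<phi>) z))"
    by (intro smooth_on_Pair o smooth_on_subset[OF W1(5)] smooth_on_subset[OF W2(5)]) auto
  also have "(\<lambda>z. ((\<psi> \<circ> F \<circ> inv_into U \<phi>) z, (\<kappa> \<circ> G \<circ> inv_into U \<phi>) z)) =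
      map_prod \<psi> \<kappa> \<circ> (\<lambda>y. (F y, G y)) \<circ> inv_into U \<phi>" by auto
  finally have "smooth_on (\<phi> ` (W1 \<inter> W2)) (map_prod \<psi> \<kappa> \<circ> (\<lambda>y. (F y, G y)) \<circ> inv_into U \<phi>)" .
  then show ?thesis
    by (rule smooth_atI[OF U(1) prod_atlasI[OF V(1) Z(1)], rotated -1]) (use W1 W2 in auto)
qed

lemma smooth_at_fst: assumes A: "smooth_atlas A" and B: "smooth_atlas B" shows "smooth_at (prod_atlas A B) A fst x"
proof -
  obtain U \<phi> where U: "(U, \<phi>) \<in> A" "fst x \<in> U" using atlas_cover[OF A] .
  obtain V \<psi> where V: "(V, \<psi>) \<in> B" "snd x \<in> V" using atlas_cover[OF B] .
  have o: "open (\<phi> ` U \<times> \<psi> ` V)" using chartD(2)[OF A U(1)] chartD(2)[OF B V(1)] by (rule open_Times)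
  have "smooth_on (\<phi> ` U \<times> \<psi> ` V) fst"
    by (rule smooth_on_bounded_linear[OF o bounded_linear_fst smooth_on_id])
  moreover have "fst z = (\<phi> \<circ> fst \<circ> inv_into (U \<times> V) (map_prod \<phi> \<psi>)) z" if "z \<in> \<phi> ` U \<times> \<psi> ` V" for z
    using that inv_into_prod[OF A B U(1) V(1), of "fst z" "snd z"] by (auto simp: f_inv_into_f)
  ultimately have "smooth_on (\<phi> ` U \<times> \<psi> ` V) (\<phi> \<circ> fst \<circ> inv_into (U \<times> V) (map_prod \<phi> \<psi>))"
    by (rule smooth_on_eq[OF o])
  then show ?thesis unfolding smooth_at_def
    using U V prod_atlasI[OF U(1) V(1)] chartD(1)[OF A U(1)] chartD(1)[OF B V(1)]
    by (intro exI[of _ "U \<times> V"] exI[of _ "map_prod \<phi> \<psi>"] exI[of _ U] exI[of _ \<phi>] exI[of _ "U \<times> V"])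
      (auto simp: map_prod_image_Times open_Times mem_Times_iff)
qed

lemma smooth_at_snd: assumes A: "smooth_atlas A" and B: "smooth_atlas B" shows "smooth_at (prod_atlas A B) B snd x"
proof -
  obtain U \<phi> where U: "(U, \<phi>) \<in> A" "fst x \<in> U" using atlas_cover[OF A] .
  obtain V \<psi> where V: "(V, \<psi>) \<in> B" "snd x \<in> V" using atlas_cover[OF B] .
  have o: "open (\<phi> ` U \<times> \<psi> ` V)" using chartD(2)[OF A U(1)] chartD(2)[OF B V(1)] by (rule open_Times)
  have "smooth_on (\<phi> ` U \<times> \<psi> ` V) snd"
    by (rule smooth_on_bounded_linear[OF o bounded_linear_snd smooth_on_id])
  moreover have "snd z = (\<psi> \<circ> snd \<circ> inv_into (U \<times> V) (map_prod \<phi> \<psi>)) z" if "z \<in> \<phi> ` U \<times> \<psi> ` V" for z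
    using that inv_into_prod[OF A B U(1) V(1), of "fst z" "snd z"] by (auto simp: f_inv_into_f)
  ultimately have "smooth_on (\<phi> ` U \<times> \<psi> ` V) (\<psi> \<circ> snd \<circ> inv_into (U \<times> V) (map_prod \<phi> \<psi>))"
    by (rule smooth_on_eq[OF o])
  then show ?thesis unfolding smooth_at_def
    using U V prod_atlasI[OF U(1) V(1)] chartD(1)[OF A U(1)] chartD(1)[OF B V(1)]
    by (intro exI[of _ "U \<times> V"] exI[of _ "map_prod \<phi> \<psi>"] exI[of _ V] exI[of _ \<psi>] exI[of _ "U \<times> V"])
      (auto simp: map_prod_image_Times open_Times mem_Times_iff)
qed

lemma smooth_atlas_std: "\<exists>B::'e::real_inner set. onb B \<Longrightarrow> smooth_atlas (std_atlas :: ('e, 'e) chart set)"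
  by (auto simp: smooth_atlas_def std_atlas_def inv_id smooth_on_id id_def[symmetric])
    (simp_all add: id_def smooth_on_id)

lemma smooth_atlas_real: "smooth_atlas (std_atlas :: (real, real) chart set)"
  using smooth_atlas_std onb_real by blast

lemma prod_atlas_std: "prod_atlas std_atlas std_atlas = std_atlas"
  by (auto simp: prod_atlas_def std_atlas_def map_prod.id)

lemma smooth_at_std:
  assumes "open S" "x \<in> S" "smooth_on S f"
  shows "smooth_at std_atlas std_atlas f x"
  unfolding smooth_at_def std_atlas_def using assms by (auto simp: inv_id)

lemma smooth_at_stdD:
  assumes "\<exists>B::'e::real_inner set. onb B" "\<exists>B::'f::real_inner set. onb B"
    "smooth_at std_atlas std_atlas (f :: 'e \<Rightarrow> 'f) x"
  shows "\<exists>S. open S \<and> x \<in> S \<and> smooth_on S f"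
proof -
  have "(UNIV, id) \<in> (std_atlas :: ('e, 'e) chart set)" "(UNIV, id) \<in> (std_atlas :: ('f, 'f) chart set)"
    by (auto simp: std_atlas_def)
  from smooth_at_charts[OF smooth_atlas_std[OF assms(1)] smooth_atlas_std[OF assms(2)] assms(3) this(1) UNIV_I this(2) UNIV_I open_UNIV UNIV_I]
  obtain W where "open W" "x \<in> W" "smooth_on (id ` W) (id \<circ> f \<circ> inv id)" by metis
  then show ?thesis by (auto simp: inv_id)
qed

lemma smooth_at_chart:
  assumes A: "smooth_atlas A" and U: "(U, \<phi>) \<in> A" "x \<in> U"
  shows "smooth_at A std_atlas \<phi> x"
proof -
  have "smooth_on (\<phi> ` U) (id \<circ> \<phi> \<circ> inv_into U \<phi>)" using chart_transition[OF A U(1) U(1)] by simp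
  then show ?thesis unfolding smooth_at_def std_atlas_def using U chartD(1)[OF A U(1)] by blast
qed

lemma smooth_at_chart_inv:
  assumes A: "smooth_atlas A" and U: "(U, \<phi>) \<in> A" "z \<in> \<phi> ` U"
  shows "smooth_at std_atlas A (inv_into U \<phi>) z"
proof -
  have o: "open (\<phi> ` U)" by (rule chartD(2)[OF A U(1)])
  have "smooth_on (\<phi> ` U) (\<phi> \<circ> inv_into U \<phi> \<circ> inv_into UNIV id)"
    by (subst smooth_on_cong[OF o, of _ "\<lambda>x. x"]) (auto simp: f_inv_into_f smooth_on_id inv_id)
  then show ?thesis unfolding smooth_at_def std_atlas_def using U o
    by (intro exI[of _ UNIV] exI[of _ id] exI[of _ U] exI[of _ \<phi>] exI[of _ "\<phi> ` U"]) (auto simp: inv_into_into)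
qed


section \<open>Smooth functions and tangent spaces\<close>

text \<open>Replaces the chartwise definition by a local condition at each point, so that smoothness
  can be checked separately on the members of an open cover.\<close>

lemma smooth_functions_iff:
  assumes A: "smooth_atlas A"
  shows "f \<in> smooth_functions A \<longleftrightarrow> (\<forall>x. smooth_at A std_atlas f x)"
proof
  assume f: "f \<in> smooth_functions A"
  show "\<forall>x. smooth_at A std_atlas f x"
  proof
    fix x
    obtain U \<phi> where U: "(U, \<phi>) \<in> A" "x \<in> U" using atlas_cover[OF A] .
    have "smooth_on (\<phi> ` U) (f \<circ> inv_into U \<phi>)" using f U unfolding smooth_functions_def by auto
    then show "smooth_at A std_atlas f x" using U chartD(1)[OF A U(1)]
      by (intro smooth_atI[of U \<phi> A UNIV id std_atlas U]) (auto simp: std_atlas_def)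
  qed
next
  assume f: "\<forall>x. smooth_at A std_atlas f x"
  have "smooth_on (\<phi> ` U) (f \<circ> inv_into U \<phi>)" if U: "(U, \<phi>) \<in> A" for U \<phi>
  proof (rule smooth_on_local)
    fix z assume "z \<in> \<phi> ` U"
    then obtain x where x: "x \<in> U" "z = \<phi> x" by blast
    have R: "(UNIV, id) \<in> (std_atlas :: (real, real) chart set)" by (simp add: std_atlas_def)
    obtain W where W: "open W" "x \<in> W" "W \<subseteq> U" "smooth_on (\<phi> ` W) (id \<circ> f \<circ> inv_into U \<phi>)"
      using smooth_at_charts[OF A smooth_atlas_real f[rule_format] U x(1) R UNIV_I open_UNIV UNIV_I] by metis
    then show "\<exists>T. open T \<and> z \<in> T \<and> smooth_on T (f \<circ> inv_into U \<phi>)"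
      using x chart_open_image[OF A U W(1,3)] by (intro exI[of _ "\<phi> ` W"]) auto
  qed
  then show "f \<in> smooth_functions A" by (auto simp: smooth_functions_def)
qed

text \<open>A pair of real functions is a smooth map into the product of two lines, whose product
  atlas is again the one-chart atlas; sums and products become compositions.\<close>

lemma smooth_at_real_op:
  assumes A: "smooth_atlas A" and f: "smooth_at A std_atlas (f :: _ \<Rightarrow> real) x" and g: "smooth_at A std_atlas (g :: _ \<Rightarrow> real) x"
    and h: "smooth_on UNIV (h :: real \<times> real \<Rightarrow> real)"
  shows "smooth_at A std_atlas (\<lambda>y. h (f y, g y)) x"
proof (rule smooth_at_compose[OF A _ smooth_atlas_real, where F = "\<lambda>y. (f y, g y)" and G = h])
  show "smooth_at A std_atlas (\<lambda>y. (f y, g y)) x"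
    using smooth_at_Pair[OF A smooth_atlas_real smooth_atlas_real f g] by (simp add: prod_atlas_std)
  show "smooth_at std_atlas std_atlas h (f x, g x)"
    by (rule smooth_at_std[OF open_UNIV UNIV_I h])
  show "smooth_atlas (std_atlas :: (real \<times> real, real \<times> real) chart set)"
    using smooth_atlas_std onb_prod[OF onb_real onb_real] by blast
qed

lemma smooth_at_add:
  assumes "smooth_atlas A" "smooth_at A std_atlas f x" "smooth_at A std_atlas g x"
  shows "smooth_at A std_atlas (\<lambda>y. f y + g y :: real) x"
  using smooth_at_real_op[OF assms, of "\<lambda>z. fst z + snd z"]
  by (simp add: smooth_on_add smooth_on_bounded_linear[OF _ bounded_linear_fst] smooth_on_bounded_linear[OF _ bounded_linear_snd] smooth_on_id)

lemma smooth_at_mult: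
  assumes "smooth_atlas A" "smooth_at A std_atlas f x" "smooth_at A std_atlas g x"
  shows "smooth_at A std_atlas (\<lambda>y. f y * g y :: real) x"
  using smooth_at_real_op[OF assms, of "\<lambda>z. fst z * snd z"]
  by (simp add: smooth_on_bilinear[OF _ bounded_bilinear_mult] smooth_on_bounded_linear[OF _ bounded_linear_fst] smooth_on_bounded_linear[OF _ bounded_linear_snd] smooth_on_id)

lemma smooth_functions_const: "smooth_atlas A \<Longrightarrow> (\<lambda>_. c) \<in> smooth_functions A"
  by (simp add: smooth_functions_iff smooth_at_const smooth_atlas_real)

lemma smooth_functions_zero: "smooth_atlas A \<Longrightarrow> 0 \<in> smooth_functions A"
  using smooth_functions_const[of A 0] by (simp add: zero_fun_def)

lemma smooth_functions_add:
  "smooth_atlas A \<Longrightarrow> f \<in> smooth_functions A \<Longrightarrow> g \<in> smooth_functions A \<Longrightarrow> (\<lambda>x. f x + g x) \<in> smooth_functions A"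
  by (simp add: smooth_functions_iff smooth_at_add)

lemma smooth_functions_plus:
  "smooth_atlas A \<Longrightarrow> f \<in> smooth_functions A \<Longrightarrow> g \<in> smooth_functions A \<Longrightarrow> f + g \<in> smooth_functions A"
  using smooth_functions_add by (simp add: plus_fun_def)

lemma smooth_functions_mult:
  "smooth_atlas A \<Longrightarrow> f \<in> smooth_functions A \<Longrightarrow> g \<in> smooth_functions A \<Longrightarrow> (\<lambda>x. f x * g x) \<in> smooth_functions A"
  by (simp add: smooth_functions_iff smooth_at_mult)

lemma smooth_functions_cmult:
  "smooth_atlas A \<Longrightarrow> f \<in> smooth_functions A \<Longrightarrow> (\<lambda>x. c * f x) \<in> smooth_functions A"
  using smooth_functions_mult smooth_functions_const by blast

lemma smooth_functions_scaleR:
  "smooth_atlas A \<Longrightarrow> f \<in> smooth_functions A \<Longrightarrow> c *\<^sub>R f \<in> smooth_functions A"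
  using smooth_functions_cmult by (simp add: scaleR_fun_def)

lemma smooth_functions_sum:
  assumes "smooth_atlas A" "\<And>i. i \<in> I \<Longrightarrow> f i \<in> smooth_functions A"
  shows "(\<lambda>x. \<Sum>i\<in>I. f i x) \<in> smooth_functions A"
  using assms(2) by (induction I rule: infinite_finite_induct)
    (auto simp: smooth_functions_const[OF assms(1)] smooth_functions_add[OF assms(1)])

section \<open>Cut-off functions on a compact manifold\<close>

text \<open>Regularity of compact Hausdorff spaces: the complement of \<open>N\<close> is compact,
  so finitely many Hausdorff separations of \<open>x\<close> from its points suffice.\<close>

lemma regular_nhd:
  fixes x :: "'m::t2_space"
  assumes "compact (UNIV :: 'm set)" "open N" "x \<in> N"
  obtains V where "open V" "x \<in> V" "closure V \<subseteq> N"
proof -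
  have "compact (- N)" using assms by (metis Compl_eq_Diff_UNIV compact_Int_closed closed_Compl inf_top.left_neutral)
  have "\<exists>V W. open V \<and> open W \<and> x \<in> V \<and> y \<in> W \<and> V \<inter> W = {}" if "y \<in> - N" for y
    using that assms(3) by (intro hausdorff) auto
  then obtain V W where VW: "\<And>y. y \<in> - N \<Longrightarrow> open (V y) \<and> open (W y) \<and> x \<in> V y \<and> y \<in> W y \<and> V y \<inter> W y = {}"
    by metis
  obtain F where F: "F \<subseteq> - N" "finite F" "- N \<subseteq> (\<Union>y\<in>F. W y)"
    by (rule compactE_image[OF \<open>compact (- N)\<close>, of "- N" W]) (use VW in auto)
  have oW: "open (\<Union>y\<in>F. W y)" using F VW by auto
  have "(\<Inter>y\<in>F. V y) \<subseteq> - (\<Union>y\<in>F. W y)" using F VW by fast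
  then have "closure (\<Inter>y\<in>F. V y) \<subseteq> - (\<Union>y\<in>F. W y)" using oW by (intro closure_minimal) (auto simp only: closed_Compl)
  then have "closure (\<Inter>y\<in>F. V y) \<subseteq> N" using F(3) by blast
  moreover have "open (\<Inter>y\<in>F. V y)" "x \<in> (\<Inter>y\<in>F. V y)" using F VW by (auto intro!: open_INT)
  ultimately show ?thesis using that by blast
qed

text \<open>A bump in a chart is transplanted to the manifold. The closed set \<open>K\<close> is
  returned together with the function because products with locally defined functions are extended
  by zero across its complement.\<close>

lemma bump_exists:
  fixes A :: "('m::t2_space, 'e::real_inner) chart set"
  assumes A: "smooth_atlas A" and c: "compact (UNIV :: 'm set)" and N: "open N" "x \<in> N"
  shows "\<exists>\<eta> K. \<eta> \<in> smooth_functions A \<and> \<eta> x = 1 \<and> closed K \<and> K \<subseteq> N \<and> (\<forall>y. y \<notin> K \<longrightarrow> \<eta> y = 0)"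
proof -
  obtain U \<phi> where U: "(U, \<phi>) \<in> A" "x \<in> U" using atlas_cover[OF A] .
  obtain V where V: "open V" "x \<in> V" "closure V \<subseteq> U \<inter> N"
    using regular_nhd[OF c, of "U \<inter> N" x] chartD(1)[OF A U(1)] N U by (metis IntI open_Int)
  have VU: "V \<subseteq> U" using V closure_subset by fastforce
  have "open (\<phi> ` V)" by (rule chart_open_image[OF A U(1) V(1) VU])
  then obtain r where r: "r > 0" "ball (\<phi> x) r \<subseteq> \<phi> ` V"
    using V by (meson imageI open_contains_ball)
  obtain \<rho> :: "'e \<Rightarrow> real" where \<rho>: "smooth_on UNIV \<rho>" "\<rho> (\<phi> x) = 1" "\<And>z. dist z (\<phi> x) \<ge> r / 2 \<Longrightarrow> \<rho> z = 0"
    using smooth_bump[of "r / 2" "\<phi> x"] r atlas_onb[OF A] by auto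
  \<comment> \<open>Outside \<open>U\<close> the chart is meaningless, and the preimage of a closed
    ball is closed in \<open>U\<close> only. Intersecting with \<open>closure V\<close>, which lies
    in \<open>U\<close>, gives a set closed in the whole manifold; injectivity of the chart places
    it inside \<open>V\<close>.\<close>
  define K where "K = closure V \<inter> \<phi> -` cball (\<phi> x) (r / 2)"
  define \<eta> where "\<eta> = (\<lambda>y. if y \<in> K then \<rho> (\<phi> y) else 0)"
  have "continuous_on (closure V) \<phi>" using chartD(4)[OF A U(1)] V by (auto intro: continuous_on_subset)
  then have K: "closed K" unfolding K_def by (intro continuous_closed_preimage) auto
  have KV: "K \<subseteq> V"
  proof
    fix y assume y: "y \<in> K"
    then have "\<phi> y \<in> ball (\<phi> x) r" "y \<in> U" using r V by (auto simp: K_def)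
    then obtain y' where "y' \<in> V" "\<phi> y = \<phi> y'" using r by blast
    then show "y \<in> V" using chartD(3)[OF A U(1)] VU \<open>y \<in> U\<close> by (metis inj_onD subsetD)
  qed
  have "smooth_at A std_atlas \<eta> y" for y
  proof (cases "y \<in> V")
    case True
    have y: "y \<in> U" using True VU by auto
    have "smooth_at A std_atlas (\<lambda>y. \<rho> (\<phi> y)) y"
      by (rule smooth_at_compose[OF A smooth_atlas_std[OF atlas_onb[OF A]] smooth_atlas_real
            smooth_at_chart[OF A U(1) y] smooth_at_std[OF open_UNIV UNIV_I \<rho>(1)]])
    then show ?thesis
    proof (rule smooth_at_cong[OF A smooth_atlas_real V(1) True, rotated])
      fix w assume "w \<in> V"
      then have "w \<notin> K \<Longrightarrow> dist (\<phi> w) (\<phi> x) \<ge> r / 2"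
        using closure_subset[of V] by (auto simp: K_def dist_commute)
      then show "\<rho> (\<phi> w) = \<eta> w" using \<rho>(3) by (auto simp: \<eta>_def)
    qed
  next
    case False
    then show ?thesis using KV K
      by (intro smooth_at_cong[OF A smooth_atlas_real _ _ _ smooth_at_const[OF A smooth_atlas_real], of "- K" y 0])
        (auto simp: \<eta>_def)
  qed
  then have "\<eta> \<in> smooth_functions A" by (simp add: smooth_functions_iff[OF A])
  moreover have "\<eta> x = 1" using \<rho>(2) V(2) r closure_subset[of V] by (auto simp: \<eta>_def K_def)
  moreover have "K \<subseteq> N" using V by (auto simp: K_def)
  ultimately show ?thesis using K by (intro exI[of _ \<eta>] exI[of _ K]) (auto simp: \<eta>_def)
qed

text \<open>The function \<open>f\<close> matters only near \<open>K\<close>: at points of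
  \<open>K\<close> both factors are smooth, and the complement of \<open>K\<close> is open with
  vanishing product.\<close>

lemma smooth_extend_by_zero:
  assumes A: "smooth_atlas A" and \<eta>: "\<eta> \<in> smooth_functions A" and K: "closed K" "\<And>y. y \<notin> K \<Longrightarrow> \<eta> y = 0"
    and f: "\<And>y. y \<in> K \<Longrightarrow> smooth_at A std_atlas (f :: _ \<Rightarrow> real) y"
  shows "(\<lambda>y. \<eta> y * f y) \<in> smooth_functions A"
  unfolding smooth_functions_iff[OF A]
proof
  fix y
  show "smooth_at A std_atlas (\<lambda>y. \<eta> y * f y) y"
  proof (cases "y \<in> K")
    case True
    then show ?thesis using smooth_at_mult[OF A _ f] \<eta> by (simp add: smooth_functions_iff[OF A])
  next
    case False
    then show ?thesis using K
      by (intro smooth_at_cong[OF A smooth_atlas_real _ _ _ smooth_at_const[OF A smooth_atlas_real], of "- K" y 0]) auto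
  qed
qed

section \<open>Tangent vectors as derivations, and frames from charts\<close>

lemma linear_map_on_sum:
  assumes V: "subspace V" and I: "finite I" and L: "linear_map_on V L" and u: "\<And>i. i \<in> I \<Longrightarrow> u i \<in> V"
  shows "L (\<Sum>i\<in>I. k i *\<^sub>R u i) = (\<Sum>i\<in>I. k i *\<^sub>R L (u i))"
  using I u
proof (induction I rule: finite_induct)
  case empty
  have "L (0 *\<^sub>R 0) = 0 *\<^sub>R L 0" using L subspace_0[OF V] unfolding linear_map_on_def by blast
  then show ?case by simp
next
  case (insert i I)
  have "k i *\<^sub>R u i \<in> V" "(\<Sum>i\<in>I. k i *\<^sub>R u i) \<in> V" "u i \<in> V"
    using insert.prems by (auto intro!: subspace_sum[OF V] subspace_scale[OF V])
  then show ?case using insert L by (simp add: linear_map_on_def)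
qed

lemma sum_fun_apply: "(\<Sum>i\<in>I. f i) x = (\<Sum>i\<in>I. f i x)"
  by (induction I rule: infinite_finite_induct) auto

text \<open>The directional derivative read in a chart. It is set to zero off
  \<open>smooth_functions A\<close> because a tangent vector, as an element of a
  \<open>dual_space\<close>, has to vanish there.\<close>

definition chart_deriv ::
    "('m, 'e::real_normed_vector) chart set \<Rightarrow> 'm set \<Rightarrow> ('m \<Rightarrow> 'e) \<Rightarrow> 'm \<Rightarrow> 'e \<Rightarrow> 'm tangent"
  where "chart_deriv A U \<phi> x a = (\<lambda>f. if f \<in> smooth_functions A
    then frechet_derivative (f \<circ> inv_into U \<phi>) (at (\<phi> x)) a else 0)"

lemma tangentD:
  assumes "v \<in> tangent_space A x"
  shows "f \<in> smooth_functions A \<Longrightarrow> g \<in> smooth_functions A \<Longrightarrow> v (\<lambda>y. f y + g y) = v f + v g"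
    "f \<in> smooth_functions A \<Longrightarrow> v (\<lambda>y. c * f y) = c * v f"
    "f \<in> smooth_functions A \<Longrightarrow> g \<in> smooth_functions A \<Longrightarrow> v (\<lambda>y. f y * g y) = f x * v g + g x * v f"
    "f \<notin> smooth_functions A \<Longrightarrow> v f = 0"
  using assms by (auto simp: tangent_space_def dual_space_def linear_map_on_def plus_fun_def scaleR_fun_def)

lemma tangentI:
  assumes "\<And>f g. f \<in> smooth_functions A \<Longrightarrow> g \<in> smooth_functions A \<Longrightarrow> v (\<lambda>y. f y + g y) = v f + v g"
    "\<And>c f. f \<in> smooth_functions A \<Longrightarrow> v (\<lambda>y. c * f y) = c * v f"
    "\<And>f g. f \<in> smooth_functions A \<Longrightarrow> g \<in> smooth_functions A \<Longrightarrow> v (\<lambda>y. f y * g y) = f x * v g + g x * v f"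
    "\<And>f. f \<notin> smooth_functions A \<Longrightarrow> v f = 0"
  shows "v \<in> tangent_space A x"
  using assms by (auto simp: tangent_space_def dual_space_def linear_map_on_def plus_fun_def scaleR_fun_def)

lemma subspace_tangent: "subspace (tangent_space A x)"
  by (auto simp: subspace_def tangent_space_def dual_space_def linear_map_on_def scaleR_fun_def algebra_simps)

lemma tangent_const:
  assumes A: "smooth_atlas A" and v: "v \<in> tangent_space A x"
  shows "v (\<lambda>_. c) = 0"
proof -
  have "v (\<lambda>_. 1 * 1) = 1 * v (\<lambda>_. 1) + 1 * v (\<lambda>_. 1)"
    by (rule tangentD(3)[OF v]) (auto intro: smooth_functions_const[OF A])
  then have "v (\<lambda>_. 1) = 0" by simp
  then show ?thesis using tangentD(2)[OF v smooth_functions_const[OF A, of 1], of c] by simp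
qed

lemma tangent_sum:
  assumes A: "smooth_atlas A" and v: "v \<in> tangent_space A x" and f: "\<And>i. i \<in> I \<Longrightarrow> f i \<in> smooth_functions A"
  shows "v (\<lambda>y. \<Sum>i\<in>I. f i y) = (\<Sum>i\<in>I. v (f i))"
  using f
  by (induction I rule: infinite_finite_induct)
    (simp_all add: tangent_const[OF A v] tangentD(1)[OF v] smooth_functions_sum[OF A])

lemma chart_deriv_tangent:
  assumes A: "smooth_atlas A" and U: "(U, \<phi>) \<in> A" "x \<in> U"
  shows "chart_deriv A U \<phi> x a \<in> tangent_space A x"
proof (rule tangentI)
  let ?s = "\<lambda>f. f \<circ> inv_into U \<phi>"
  have d: "(?s f has_derivative frechet_derivative (?s f) (at (\<phi> x))) (at (\<phi> x))"
    if f: "f \<in> smooth_functions A" for f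
    using f U by (intro has_derivative_frechet smooth_on_differentiable[of "\<phi> ` U"]) (auto simp: smooth_functions_def)
  have x: "inv_into U \<phi> (\<phi> x) = x" by (rule chart_inv[OF A U])
  fix f assume f: "f \<in> smooth_functions A"
  show "chart_deriv A U \<phi> x a (\<lambda>y. c * f y) = c * chart_deriv A U \<phi> x a f" for c
    using frechet_eqI[OF has_derivative_mult_right[OF d[OF f], of c]] smooth_functions_cmult[OF A f]
    by (simp add: chart_deriv_def f comp_def)
  fix g assume g: "g \<in> smooth_functions A"
  show "chart_deriv A U \<phi> x a (\<lambda>y. f y + g y) = chart_deriv A U \<phi> x a f + chart_deriv A U \<phi> x a g"
    using frechet_eqI[OF has_derivative_add[OF d[OF f] d[OF g]]] smooth_functions_add[OF A f g]
    by (simp add: chart_deriv_def f g comp_def)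
  show "chart_deriv A U \<phi> x a (\<lambda>y. f y * g y) = f x * chart_deriv A U \<phi> x a g + g x * chart_deriv A U \<phi> x a f"
    using frechet_eqI[OF has_derivative_mult[OF d[OF f] d[OF g]]] smooth_functions_mult[OF A f g] x
    by (simp add: chart_deriv_def f g comp_def)
qed (simp add: chart_deriv_def)

text \<open>The \<open>h b\<close> are the chart coordinates centred at \<open>x\<close>, times a
  cut-off; they do not depend on \<open>v\<close>, so \<open>v (h b)\<close> are linear coordinates
  of \<open>v\<close>. Hadamard's lemma writes \<open>f - f x\<close> as a sum of products of
  coordinates with smooth functions, and the product rule keeps only the derivative of the
  coordinates, since these vanish at \<open>x\<close>. A ball inside the chart image is used because
  Hadamard's lemma needs convexity.\<close>

lemma tangent_frame:
  fixes A :: "('m::t2_space, 'e::real_inner) chart set"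
  assumes A: "smooth_atlas A" and c: "compact (UNIV :: 'm set)" and U: "(U, \<phi>) \<in> A" "x \<in> U" and B: "onb (B::'e set)"
  shows "\<exists>h. (\<forall>b. h b \<in> smooth_functions A \<and> h b x = 0) \<and>
    (\<forall>v\<in>tangent_space A x. v = (\<Sum>b\<in>B. v (h b) *\<^sub>R chart_deriv A U \<phi> x b))"
proof -
  obtain r where r: "r > 0" "ball (\<phi> x) r \<subseteq> \<phi> ` U"
    using chartD(2)[OF A U(1)] U(2) by (meson imageI open_contains_ball)
  let ?S = "ball (\<phi> x) r"
  define N where "N = \<phi> -` ?S \<inter> U"
  have N: "open N" "x \<in> N" "N \<subseteq> U"
    using continuous_on_open_vimage[OF chartD(1)[OF A U(1)]] chartD(4)[OF A U(1)] U r by (auto simp: N_def)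
  obtain \<eta> K where \<eta>: "\<eta> \<in> smooth_functions A" "\<eta> x = 1" and K: "closed K" "K \<subseteq> N" "\<And>y. y \<notin> K \<Longrightarrow> \<eta> y = 0"
    using bump_exists[OF A c N(1,2)] by blast
  have pull: "(\<lambda>y. \<eta> y * g (\<phi> y)) \<in> smooth_functions A" if g: "smooth_on ?S g" for g
  proof (rule smooth_extend_by_zero[OF A \<eta>(1) K(1,3)])
    fix y assume "y \<in> K"
    then have y: "y \<in> U" "\<phi> y \<in> ?S" using K N by (auto simp: N_def)
    show "smooth_at A std_atlas (\<lambda>y. g (\<phi> y)) y"
      by (rule smooth_at_compose[OF A smooth_atlas_std[OF atlas_onb[OF A]] smooth_atlas_real
            smooth_at_chart[OF A U(1) y(1)] smooth_at_std[OF open_ball y(2) g]])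
  qed
  define h where "h = (\<lambda>b y. \<eta> y * ((\<phi> y + - \<phi> x) \<bullet> b))"
  have "smooth_on ?S (\<lambda>z. (z + - \<phi> x) \<bullet> b)" for b
    by (intro smooth_on_bounded_linear[OF _ bounded_linear_inner_left] smooth_on_add smooth_on_id smooth_on_const open_ball)
  then have h: "h b \<in> smooth_functions A" for b
    unfolding h_def by (rule pull[of "\<lambda>z. (z + - \<phi> x) \<bullet> b"])
  have hx: "h b x = 0" for b by (simp add: h_def)
  have "v f = (\<Sum>b\<in>B. v (h b) * chart_deriv A U \<phi> x b f)" if v: "v \<in> tangent_space A x" for v f
  proof (cases "f \<in> smooth_functions A")
    case False
    then show ?thesis using tangentD(4)[OF v] by (simp add: chart_deriv_def)
  next
    case f: True
    let ?f = "f \<circ> inv_into U \<phi>"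
    have "smooth_on (\<phi> ` U) ?f" using f U(1) by (auto simp: smooth_functions_def)
    then have "smooth_on ?S ?f" using r smooth_on_subset by blast
    moreover have "\<phi> x \<in> ?S" using r by simp
    ultimately obtain g where gg: "\<forall>b. smooth_on ?S (g b) \<and> g b (\<phi> x) = frechet_derivative ?f (at (\<phi> x)) b \<and>
      (\<forall>z\<in>?S. ?f z - ?f (\<phi> x) = (\<Sum>b\<in>B. ((z - \<phi> x) \<bullet> b) * g b z))"
      using hadamard[OF open_ball convex_ball _ B, of "\<phi> x" "\<phi> x" r ?f] by blast
    have g: "smooth_on ?S (g b)" "g b (\<phi> x) = frechet_derivative ?f (at (\<phi> x)) b"
      "z \<in> ?S \<Longrightarrow> ?f z - ?f (\<phi> x) = (\<Sum>b\<in>B. ((z - \<phi> x) \<bullet> b) * g b z)" for b z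
      using gg by blast+
    define G where "G = (\<lambda>b y. \<eta> y * g b (\<phi> y))"
    have G: "G b \<in> smooth_functions A" for b unfolding G_def by (rule pull[OF g(1)])
    \<comment> \<open>Two factors \<eta> are needed, one to globalise the coordinate in
      \<open>h b\<close> and one for the Hadamard coefficient in \<open>G b\<close>. On the left
      they are harmless: \<open>\<eta> x = 1\<close>, and \<open>f - f x\<close> vanishes at
      \<open>x\<close>.\<close>
    have eq: "(\<lambda>y. (\<eta> y * \<eta> y) * (f y + - f x)) = (\<lambda>y. \<Sum>b\<in>B. h b y * G b y)"
    proof
      fix y
      show "(\<eta> y * \<eta> y) * (f y + - f x) = (\<Sum>b\<in>B. h b y * G b y)"
      proof (cases "y \<in> K")
        case True
        then have y: "y \<in> U" "\<phi> y \<in> ?S" using K N by (auto simp: N_def)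
        have "f y - f x = (\<Sum>b\<in>B. ((\<phi> y - \<phi> x) \<bullet> b) * g b (\<phi> y))"
          using g(3)[OF y(2)] chart_inv[OF A U(1) y(1)] chart_inv[OF A U] by simp
        then have "(\<eta> y * \<eta> y) * (f y + - f x) = (\<eta> y * \<eta> y) * (\<Sum>b\<in>B. ((\<phi> y - \<phi> x) \<bullet> b) * g b (\<phi> y))" by simp
        then show ?thesis by (simp add: h_def G_def sum_distrib_left mult_ac)
      qed (simp add: h_def G_def K(3))
    qed
    have f': "(\<lambda>y. f y + - f x) \<in> smooth_functions A"
      by (rule smooth_functions_add[OF A f smooth_functions_const[OF A]])
    have "v (\<lambda>y. (\<eta> y * \<eta> y) * (f y + - f x)) = (\<eta> x * \<eta> x) * v (\<lambda>y. f y + - f x) + (f x + - f x) * v (\<lambda>y. \<eta> y * \<eta> y)"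
      by (rule tangentD(3)[OF v smooth_functions_mult[OF A \<eta>(1) \<eta>(1)] f'])
    also have "\<dots> = v f" using tangentD(1)[OF v f smooth_functions_const[OF A, of "- f x"]] \<eta>(2) tangent_const[OF A v] by simp
    finally have "v f = v (\<lambda>y. \<Sum>b\<in>B. h b y * G b y)" unfolding eq by simp
    also have "\<dots> = (\<Sum>b\<in>B. v (\<lambda>y. h b y * G b y))"
      by (rule tangent_sum[OF A v smooth_functions_mult[OF A h G]])
    also have "\<dots> = (\<Sum>b\<in>B. v (h b) * chart_deriv A U \<phi> x b f)"
      using tangentD(3)[OF v h G] by (simp add: hx G_def \<eta>(2) g(2) chart_deriv_def f mult.commute)
    finally show ?thesis .
  qed
  then have "v = (\<Sum>b\<in>B. v (h b) *\<^sub>R chart_deriv A U \<phi> x b)" if "v \<in> tangent_space A x" for v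
    using that by (intro ext) (simp add: sum_fun_apply scaleR_fun_def)
  then show ?thesis using h hx by (intro exI[of _ h]) simp
qed

lemma smooth_at_chart_deriv:
  assumes A: "smooth_atlas A" and U: "(U, \<phi>) \<in> A" "x \<in> U"
  shows "smooth_at A std_atlas (\<lambda>y. chart_deriv A U \<phi> y b f) x"
proof (cases "f \<in> smooth_functions A")
  case True
  then have "smooth_on (\<phi> ` U) (f \<circ> inv_into U \<phi>)" using U(1) by (auto simp: smooth_functions_def)
  from smooth_at_std[OF chartD(2)[OF A U(1)] _ smooth_on_frechet[OF this, of b], of "\<phi> x"]
  have "smooth_at std_atlas std_atlas (\<lambda>z. frechet_derivative (f \<circ> inv_into U \<phi>) (at z) b) (\<phi> x)"
    using U by blast
  from smooth_at_compose[OF A smooth_atlas_std[OF atlas_onb[OF A]] smooth_atlas_real smooth_at_chart[OF A U] this]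
  have "smooth_at A std_atlas (\<lambda>y. frechet_derivative (f \<circ> inv_into U \<phi>) (at (\<phi> y)) b) x" .
  then show ?thesis using True by (simp add: chart_deriv_def)
qed (simp add: chart_deriv_def smooth_at_const A smooth_atlas_real)

lemma subspace_vector_fields:
  assumes A: "smooth_atlas A" shows "subspace (vector_fields A)"
  using subspace_tangent[of A] smooth_functions_plus[OF A] smooth_functions_scaleR[OF A] smooth_functions_zero[OF A]
  by (auto simp: subspace_def vector_fields_def plus_fun_def scaleR_fun_def zero_fun_def)

text \<open>The coefficients of \<open>v\<close> in the chart frame at \<open>x\<close> are frozen
  and attached to the cut-off coordinate fields, which agree with the frame at
  \<open>x\<close>.\<close>

lemma vector_field_through:
  fixes A :: "('m::t2_space, 'e::real_inner) chart set"
  assumes A: "smooth_atlas A" and c: "compact (UNIV :: 'm set)" and v: "v \<in> tangent_space A x"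
  shows "\<exists>X\<in>vector_fields A. X x = v"
proof -
  obtain U \<phi> where U: "(U, \<phi>) \<in> A" "x \<in> U" using atlas_cover[OF A] .
  obtain B :: "'e set" where B: "onb B" using atlas_onb[OF A] by blast
  obtain h where h: "v = (\<Sum>b\<in>B. v (h b) *\<^sub>R chart_deriv A U \<phi> x b)"
    using tangent_frame[OF A c U B] v by blast
  obtain \<eta> K where \<eta>: "\<eta> \<in> smooth_functions A" "\<eta> x = 1" and K: "closed K" "K \<subseteq> U" "\<And>y. y \<notin> K \<Longrightarrow> \<eta> y = 0"
    using bump_exists[OF A c chartD(1)[OF A U(1)] U(2)] by blast
  define E where "E = (\<lambda>b y. \<eta> y *\<^sub>R chart_deriv A U \<phi> y b)"
  have "E b \<in> vector_fields A" for b
  proof -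
    have "E b y \<in> tangent_space A y" for y
    proof (cases "y \<in> U")
      case True
      then show ?thesis unfolding E_def by (intro subspace_scale subspace_tangent chart_deriv_tangent[OF A U(1)])
    next
      case False
      then have "\<eta> y = 0" using K by blast
      then show ?thesis using subspace_0[OF subspace_tangent] by (simp add: E_def)
    qed
    moreover have "(\<lambda>y. E b y f) \<in> smooth_functions A" for f
      unfolding E_def scaleR_fun_def real_scaleR_def
      by (rule smooth_extend_by_zero[OF A \<eta>(1) K(1,3)]) (use K in \<open>auto intro: smooth_at_chart_deriv[OF A U(1)]\<close>)
    ultimately show ?thesis by (simp add: vector_fields_def)
  qed
  then have "(\<Sum>b\<in>B. v (h b) *\<^sub>R E b) \<in> vector_fields A"
    by (intro subspace_sum subspace_scale subspace_vector_fields[OF A])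
  moreover have "(\<Sum>b\<in>B. v (h b) *\<^sub>R E b) x = v"
    by (subst (2) h) (simp add: sum_fun_apply E_def \<eta>(2) scaleR_fun_def)
  ultimately show ?thesis by blast
qed

text \<open>Take the combination of the coordinates \<open>h b\<close> whose coefficients are the
  values of \<xi> on the chart frame. Applying \<open>v\<close> to it reassembles \<xi> on the
  expansion of \<open>v\<close>.\<close>

lemma function_with_differential:
  fixes A :: "('m::t2_space, 'e::real_inner) chart set"
  assumes A: "smooth_atlas A" and c: "compact (UNIV :: 'm set)" and \<xi>: "\<xi> \<in> cotangent_space A x"
  shows "\<exists>f\<in>smooth_functions A. f x = 0 \<and> differential A f x = \<xi>"
proof -
  obtain U \<phi> where U: "(U, \<phi>) \<in> A" "x \<in> U" using atlas_cover[OF A] .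
  obtain B :: "'e set" where B: "onb B" using atlas_onb[OF A] by blast
  obtain h where h: "\<And>b. h b \<in> smooth_functions A" "\<And>b. h b x = 0"
    "\<And>v. v \<in> tangent_space A x \<Longrightarrow> v = (\<Sum>b\<in>B. v (h b) *\<^sub>R chart_deriv A U \<phi> x b)"
    using tangent_frame[OF A c U B] by blast
  let ?e = "chart_deriv A U \<phi> x"
  define f where "f = (\<lambda>y. \<Sum>b\<in>B. \<xi> (?e b) * h b y)"
  have f: "f \<in> smooth_functions A" unfolding f_def
    by (intro smooth_functions_sum[OF A] smooth_functions_cmult[OF A] h)
  have lin: "\<xi> (\<Sum>b\<in>I. k b *\<^sub>R ?e b) = (\<Sum>b\<in>I. k b * \<xi> (?e b))" if "finite I" for I k
    using linear_map_on_sum[OF subspace_tangent that, of A x \<xi> ?e k] chart_deriv_tangent[OF A U] \<xi>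
    by (simp add: dual_space_def)
  have "differential A f x v = \<xi> v" for v
  proof (cases "v \<in> tangent_space A x")
    case True
    have "v f = (\<Sum>b\<in>B. \<xi> (?e b) * v (h b))" unfolding f_def
      using tangent_sum[OF A True smooth_functions_cmult[OF A h(1)]] tangentD(2)[OF True h(1)] by simp
    also have "\<dots> = \<xi> (\<Sum>b\<in>B. v (h b) *\<^sub>R ?e b)" using lin B by (simp add: onb_def mult.commute)
    also have "\<dots> = \<xi> v" using h(3)[OF True] by simp
    finally show ?thesis using True by (simp add: differential_def)
  next
    case False
    then show ?thesis using \<xi> by (auto simp: differential_def dual_space_def)
  qed
  then show ?thesis using f h(2) by (intro bexI[of _ f]) (auto simp: f_def)
qed

text \<open>Serves the smoothness of the adjoint action. In product charts the partial derivative is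
  the full derivative in the direction \<open>(0, b)\<close>, restricted to the slice over
  \<open>\<phi> y\<close>, hence smooth in the first variable.\<close>

lemma smooth_at_partial_derivative:
  fixes A :: "('m::topological_space, 'e::real_inner) chart set" and C :: "('n::topological_space, 'f::real_inner) chart set"
  assumes A: "smooth_atlas A" and C: "smooth_atlas C" and K: "smooth_at (prod_atlas A C) std_atlas K (g, y)"
    and U: "(U, \<phi>) \<in> C" "y \<in> U"
  shows "smooth_at A std_atlas (\<lambda>g. frechet_derivative (\<lambda>z. K (g, inv_into U \<phi> z)) (at (\<phi> y)) b :: real) g"
proof -
  obtain V \<psi> where V: "(V, \<psi>) \<in> A" "g \<in> V" using atlas_cover[OF A] .
  note oA = atlas_onb[OF A] and oC = atlas_onb[OF C]
  have oAC: "\<exists>B::('e \<times> 'f) set. onb B" using oA oC onb_prod by blast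
  have oR: "\<exists>B::real set. onb B" using onb_real by blast
  note sA = smooth_atlas_std[OF oA] and sC = smooth_atlas_std[OF oC]
  let ?p = "(\<psi> g, \<phi> y)"
  let ?i = "\<lambda>p. (inv_into V \<psi> (fst p), inv_into U \<phi> (snd p))"
  let ?K = "\<lambda>p. K (?i p)"
  have fst: "smooth_at std_atlas std_atlas fst ?p" and snd: "smooth_at std_atlas std_atlas snd ?p"
    using smooth_at_fst[OF sA sC, of ?p] smooth_at_snd[OF sA sC, of ?p] by (simp_all add: prod_atlas_std)
  have iA: "smooth_at std_atlas A (inv_into V \<psi>) (fst ?p)" and iC: "smooth_at std_atlas C (inv_into U \<phi>) (snd ?p)"
    using smooth_at_chart_inv[OF A V(1)] smooth_at_chart_inv[OF C U(1)] U V by auto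
  have "smooth_at std_atlas (prod_atlas A C) ?i ?p"
    by (rule smooth_at_Pair[OF smooth_atlas_std[OF oAC] A C smooth_at_compose[OF smooth_atlas_std[OF oAC] sA A fst iA]
          smooth_at_compose[OF smooth_atlas_std[OF oAC] sC C snd iC]])
  then have "smooth_at std_atlas std_atlas ?K ?p"
    by (rule smooth_at_compose[OF smooth_atlas_std[OF oAC] smooth_atlas_prod[OF A C] smooth_atlas_real, where F = ?i and G = K])
      (use K chart_inv[OF A V] chart_inv[OF C U] in \<open>simp only: fst_conv snd_conv\<close>)
  then have "\<exists>S. open S \<and> ?p \<in> S \<and> smooth_on S ?K"
    by (rule smooth_at_stdD[OF oAC oR])
  then obtain S where S: "open S" "?p \<in> S" "smooth_on S ?K"
    by (elim exE conjE) (rule that)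
  let ?L = "\<lambda>p. frechet_derivative ?K (at p) (0, b)"
  have "smooth_at A (prod_atlas std_atlas std_atlas) (\<lambda>g. (\<psi> g, \<phi> y)) g"
    by (rule smooth_at_Pair[OF A sA sC smooth_at_chart[OF A V] smooth_at_const[OF A sC]])
  then have 1: "smooth_at A std_atlas (\<lambda>g. (\<psi> g, \<phi> y)) g" by (simp add: prod_atlas_std)
  have 2: "smooth_at A std_atlas (\<lambda>g. ?L (\<psi> g, \<phi> y)) g"
    by (rule smooth_at_compose[OF A smooth_atlas_std[OF oAC] smooth_atlas_real 1 smooth_at_std[OF S(1,2) smooth_on_frechet[OF S(3)]]])
  have "\<exists>N. open N \<and> g \<in> N \<and> (\<forall>g'\<in>N. (\<psi> g', \<phi> y) \<in> S)"
    by (rule smooth_at_vimage_nhd[OF A smooth_atlas_std[OF oAC] 1 S(1,2)])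
  then obtain N where N: "open N" "g \<in> N" and NS: "\<forall>g'\<in>N. (\<psi> g', \<phi> y) \<in> S"
    by (elim exE conjE) (rule that)
  show ?thesis
  proof (rule smooth_at_cong[OF A smooth_atlas_real _ _ _ 2])
    show "open (N \<inter> V)" "g \<in> N \<inter> V" using N V chartD(1)[OF A V(1)] by auto
    fix g' assume g': "g' \<in> N \<inter> V"
    have "((\<lambda>z. (\<psi> g', z)) has_derivative (\<lambda>v. (0, v))) (at (\<phi> y))"
      by (auto intro!: derivative_eq_intros)
    moreover have "(?K has_derivative frechet_derivative ?K (at (\<psi> g', \<phi> y))) (at (\<psi> g', \<phi> y))"
      using g' NS by (intro has_derivative_frechet smooth_on_differentiable[OF S(3)]) simp
    ultimately have "((\<lambda>z. ?K (\<psi> g', z)) has_derivative (\<lambda>v. frechet_derivative ?K (at (\<psi> g', \<phi> y)) (0, v))) (at (\<phi> y))"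
      by (rule has_derivative_compose)
    moreover have "(\<lambda>z. ?K (\<psi> g', z)) = (\<lambda>z. K (g', inv_into U \<phi> z))"
      using chart_inv[OF A V(1), of g'] g' by simp
    ultimately have "((\<lambda>z. K (g', inv_into U \<phi> z)) has_derivative (\<lambda>v. frechet_derivative ?K (at (\<psi> g', \<phi> y)) (0, v))) (at (\<phi> y))"
      by (simp only:)
    from frechet_eqI[OF this] show "?L (\<psi> g', \<phi> y) = frechet_derivative (\<lambda>z. K (g', inv_into U \<phi> z)) (at (\<phi> y)) b"
      by (simp only:)
  qed
qed


section \<open>Principal bundles\<close>

lemma pushforward_tangent:
  assumes A: "smooth_atlas A" and B: "smooth_atlas B" and F: "\<And>y. smooth_at A B F y" and v: "v \<in> tangent_space A x"
  shows "pushforward B F v \<in> tangent_space B (F x)"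
proof -
  have s: "(\<lambda>y. f (F y)) \<in> smooth_functions A" if "f \<in> smooth_functions B" for f
    using that smooth_at_compose[OF A B smooth_atlas_real F] by (simp add: smooth_functions_iff[OF A] smooth_functions_iff[OF B])
  show ?thesis
  proof (rule tangentI)
    fix f assume f: "f \<in> smooth_functions B"
    show "pushforward B F v (\<lambda>y. c * f y) = c * pushforward B F v f" for c
      using f smooth_functions_cmult[OF B f] tangentD(2)[OF v s[OF f]] by (simp add: pushforward_def comp_def)
    fix g assume g: "g \<in> smooth_functions B"
    show "pushforward B F v (\<lambda>y. f y + g y) = pushforward B F v f + pushforward B F v g"
      using f g smooth_functions_add[OF B f g] tangentD(1)[OF v s[OF f] s[OF g]] by (simp add: pushforward_def comp_def)
    show "pushforward B F v (\<lambda>y. f y * g y) = f (F x) * pushforward B F v g + g (F x) * pushforward B F v f"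
      using f g smooth_functions_mult[OF B f g] tangentD(3)[OF v s[OF f] s[OF g]] by (simp add: pushforward_def comp_def)
  qed (simp add: pushforward_def)
qed

text \<open>With a cut-off \<open>\<eta>\<close>, the image of \<open>v\<close> under a map \<open>F\<close> smooth only near \<open>x\<close> is
  \<open>f \<mapsto> v (\<eta> (f \<circ> F - f (F x)))\<close>.  The product rule holds because \<open>v\<close> kills \<open>\<eta> h k\<close> when \<open>h x = k x = 0\<close>:
  it takes the same value on \<open>\<eta>\<^sup>2 h k = (\<eta> h) (\<eta> k)\<close>.\<close>

lemma tangent_local_pushforward:
  fixes A :: "('m::t2_space, 'e::real_inner) chart set"
  assumes A: "smooth_atlas A" and B: "smooth_atlas B" and c: "compact (UNIV :: 'm set)"
    and U: "open U" "x \<in> U" and F: "\<And>y. y \<in> U \<Longrightarrow> smooth_at A B F y" and v: "v \<in> tangent_space A x"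
  shows "\<exists>w\<in>tangent_space B (F x). \<forall>f\<in>smooth_functions B. \<forall>g\<in>smooth_functions A.
    (\<forall>y\<in>U. f (F y) = g y) \<longrightarrow> w f = v g"
proof -
  obtain \<eta> K where \<eta>: "\<eta> \<in> smooth_functions A" "\<eta> x = 1" and K: "closed K" "K \<subseteq> U" "\<And>y. y \<notin> K \<Longrightarrow> \<eta> y = 0"
    using bump_exists[OF A c U] by blast
  define E where "E = (\<lambda>f y. \<eta> y * (f (F y) + - f (F x)))"
  have E: "E f \<in> smooth_functions A" if f: "f \<in> smooth_functions B" for f
    unfolding E_def
  proof (rule smooth_extend_by_zero[OF A \<eta>(1) K(1,3)])
    fix y assume "y \<in> K"
    then have "smooth_at A B F y" using K F by blast
    then show "smooth_at A std_atlas (\<lambda>y. f (F y) + - f (F x)) y"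
      using f smooth_at_compose[OF A B smooth_atlas_real, of F y f]
      by (intro smooth_at_add[OF A] smooth_at_const[OF A smooth_atlas_real]) (simp_all add: smooth_functions_iff[OF B])
  qed
  have Ex: "E f x = 0" for f by (simp add: E_def)
  define w where "w = (\<lambda>f. if f \<in> smooth_functions B then v (E f) else 0)"
  have "w \<in> tangent_space B (F x)"
  proof (rule tangentI)
    fix f assume f: "f \<in> smooth_functions B"
    have "E (\<lambda>y. k * f y) = (\<lambda>y. k * E f y)" for k by (simp add: E_def fun_eq_iff algebra_simps)
    then show "w (\<lambda>y. k * f y) = k * w f" for k
      using f smooth_functions_cmult[OF B f] tangentD(2)[OF v E[OF f]] by (simp add: w_def)
    fix g assume g: "g \<in> smooth_functions B"
    have "E (\<lambda>y. f y + g y) = (\<lambda>y. E f y + E g y)" by (simp add: E_def fun_eq_iff algebra_simps)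
    then show "w (\<lambda>y. f y + g y) = w f + w g"
      using f g smooth_functions_add[OF B f g] tangentD(1)[OF v E[OF f] E[OF g]] by (simp add: w_def)
    let ?fg = "\<lambda>y. f y * g y"
    have fg: "?fg \<in> smooth_functions B" by (rule smooth_functions_mult[OF B f g])
    have "(\<lambda>y. \<eta> y * E ?fg y) = (\<lambda>y. E f y * E g y + \<eta> y * (f (F x) * E g y + g (F x) * E f y))"
      by (simp add: E_def fun_eq_iff algebra_simps)
    then have "v (\<lambda>y. \<eta> y * E ?fg y) = v (\<lambda>y. E f y * E g y + \<eta> y * (f (F x) * E g y + g (F x) * E f y))" by simp
    moreover have "v (\<lambda>y. \<eta> y * E ?fg y) = v (E ?fg)"
      using tangentD(3)[OF v \<eta>(1) E[OF fg]] by (simp add: Ex \<eta>(2))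
    moreover have "v (\<lambda>y. E f y * E g y + \<eta> y * (f (F x) * E g y + g (F x) * E f y)) = f (F x) * v (E g) + g (F x) * v (E f)"
    proof -
      have c1: "(\<lambda>y. f (F x) * E g y) \<in> smooth_functions A" and c2: "(\<lambda>y. g (F x) * E f y) \<in> smooth_functions A"
        using smooth_functions_cmult[OF A] E[OF f] E[OF g] by auto
      note c12 = smooth_functions_add[OF A c1 c2]
      show ?thesis
        using tangentD(1)[OF v smooth_functions_mult[OF A E[OF f] E[OF g]] smooth_functions_mult[OF A \<eta>(1) c12]]
          tangentD(3)[OF v E[OF f] E[OF g]] tangentD(3)[OF v \<eta>(1) c12] tangentD(1)[OF v c1 c2]
          tangentD(2)[OF v E[OF f]] tangentD(2)[OF v E[OF g]]
        by (simp add: Ex \<eta>(2))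
    qed
    ultimately show "w ?fg = f (F x) * w g + g (F x) * w f"
      using f g fg by (simp add: w_def)
  qed (simp add: w_def)
  moreover have "w f = v g" if f: "f \<in> smooth_functions B" and g: "g \<in> smooth_functions A" and fg: "\<And>y. y \<in> U \<Longrightarrow> f (F y) = g y" for f g
  proof -
    have "E f = (\<lambda>y. \<eta> y * (g y + - g x))"
    proof
      show "E f y = \<eta> y * (g y + - g x)" for y using fg[of y] fg[OF U(2)] K by (cases "y \<in> K") (auto simp: E_def)
    qed
    moreover have "v (\<lambda>y. \<eta> y * (g y + - g x)) = v g"
      using tangentD(3)[OF v \<eta>(1) smooth_functions_add[OF A g smooth_functions_const[OF A, of "- g x"]]]
        tangentD(1)[OF v g smooth_functions_const[OF A, of "- g x"]] tangent_const[OF A v]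
      by (simp add: \<eta>(2))
    ultimately show ?thesis using f by (simp add: w_def)
  qed
  ultimately show ?thesis by blast
qed

section \<open>Group action, local sections and horizontal lifts\<close>

locale smooth_principal_bundle =
  fixes P :: "('m::{t2_space, second_countable_topology}, 'em::real_inner,
               'g::{t2_space, second_countable_topology}, 'eg::real_inner,
               'p::{t2_space, second_countable_topology}, 'ep::real_inner) pbundle"
  assumes principal: "principal_bundle P"
    and compact_base: "compact (UNIV :: 'm set)" and compact_group: "compact (UNIV :: 'g set)"

lemma (in smooth_principal_bundle) atlases [simp]:
  "smooth_atlas (base P)" "smooth_atlas (total P)" "smooth_atlas (grp P)"
  using principal by (auto simp: principal_bundle_def lie_group_def intro: smooth_manifold_atlas)

lemma (in smooth_principal_bundle) bundleD:
  "group (mul P) (gunit P) (ginv P)" "surj (proj P)" "act P p (gunit P) = p"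
  "act P (act P p g) h = act P p (mul P g h)" "proj P (act P p g) = proj P p"
  using principal by (auto simp: principal_bundle_def lie_group_def)

lemma (in smooth_principal_bundle) grp_simps [simp]:
  "mul P (mul P a b) c = mul P a (mul P b c)" "mul P (gunit P) a = a" "mul P a (gunit P) = a"
  "mul P (ginv P a) a = gunit P" "mul P a (ginv P a) = gunit P" "ginv P (gunit P) = gunit P"
  "mul P (ginv P a) (mul P a b) = b" "mul P a (mul P (ginv P a) b) = b" "ginv P (ginv P a) = a"
  "ginv P (mul P a b) = mul P (ginv P b) (ginv P a)"
proof -
  interpret G: group "mul P" "gunit P" "ginv P" by (rule bundleD)
  show "mul P (mul P a b) c = mul P a (mul P b c)" "mul P (gunit P) a = a" "mul P a (gunit P) = a"
    "mul P (ginv P a) a = gunit P" "mul P a (ginv P a) = gunit P" "ginv P (gunit P) = gunit P" "ginv P (ginv P a) = a"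
    "ginv P (mul P a b) = mul P (ginv P b) (ginv P a)"
    by (simp_all add: G.assoc G.inverse_distrib_swap)
  show "mul P (ginv P a) (mul P a b) = b" "mul P a (mul P (ginv P a) b) = b"
    by (simp_all add: G.assoc[symmetric])
qed

lemma (in smooth_principal_bundle) smooth_at_mul:
  assumes "smooth_atlas A" "smooth_at A (grp P) F x" "smooth_at A (grp P) H x"
  shows "smooth_at A (grp P) (\<lambda>y. mul P (F y) (H y)) x"
proof -
  have "smooth_map_on (prod_atlas (grp P) (grp P)) (grp P) UNIV (\<lambda>(g, h). mul P g h)"
    using principal by (simp add: principal_bundle_def lie_group_def)
  from smooth_map_on_imp_smooth_at[OF smooth_atlas_prod[OF atlases(3,3)] atlases(3) this open_UNIV UNIV_I, of "(F x, H x)"]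
  have "smooth_at (prod_atlas (grp P) (grp P)) (grp P) (\<lambda>(g, h). mul P g h) (F x, H x)" .
  from smooth_at_compose[OF assms(1) smooth_atlas_prod[OF atlases(3,3)] atlases(3)
      smooth_at_Pair[OF assms(1) atlases(3,3) assms(2,3)] this]
  show ?thesis by simp
qed

lemma (in smooth_principal_bundle) smooth_at_act:
  assumes "smooth_atlas A" "smooth_at A (total P) F x" "smooth_at A (grp P) H x"
  shows "smooth_at A (total P) (\<lambda>y. act P (F y) (H y)) x"
proof -
  have "smooth_map_on (prod_atlas (total P) (grp P)) (total P) UNIV (\<lambda>(g, h). act P g h)"
    using principal by (simp add: principal_bundle_def)
  from smooth_map_on_imp_smooth_at[OF smooth_atlas_prod[OF atlases(2,3)] atlases(2) this open_UNIV UNIV_I, of "(F x, H x)"]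
  have "smooth_at (prod_atlas (total P) (grp P)) (total P) (\<lambda>(g, h). act P g h) (F x, H x)" .
  from smooth_at_compose[OF assms(1) smooth_atlas_prod[OF atlases(2,3)] atlases(2)
      smooth_at_Pair[OF assms(1) atlases(2,3) assms(2,3)] this]
  show ?thesis by simp
qed

lemma (in smooth_principal_bundle) smooth_at_ginv: "smooth_at (grp P) (grp P) (ginv P) g"
  using principal smooth_map_on_imp_smooth_at[OF atlases(3,3) _ open_UNIV UNIV_I]
  by (simp add: principal_bundle_def lie_group_def)

lemma (in smooth_principal_bundle) smooth_at_proj: "smooth_at (total P) (base P) (proj P) p"
  using principal smooth_map_on_imp_smooth_at[OF atlases(2,1) _ open_UNIV UNIV_I]
  by (simp add: principal_bundle_def)

lemma (in smooth_principal_bundle) smooth_functions_proj: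
  "f \<in> smooth_functions (base P) \<Longrightarrow> (\<lambda>p. f (proj P p)) \<in> smooth_functions (total P)"
  using smooth_at_compose[OF atlases(2,1) smooth_atlas_real smooth_at_proj]
  by (simp add: smooth_functions_iff)

text \<open>Recasts a local trivialisation as the section through the unit together with the map
  \<Phi> measuring how far \<open>p\<close> is from it. The translate of
  \<open>\<sigma> (proj P p)\<close> by \<open>\<Phi> p\<close> has the same base point and the same
  \<Phi> as \<open>p\<close>, so both have the same preimage under \<tau>.\<close>

lemma (in smooth_principal_bundle) local_section:
  "\<exists>U \<sigma> \<Phi>. open U \<and> x0 \<in> U \<and>
     (\<forall>y\<in>U. smooth_at (base P) (total P) \<sigma> y \<and> proj P (\<sigma> y) = y) \<and>
     (\<forall>p. proj P p \<in> U \<longrightarrow> smooth_at (total P) (grp P) \<Phi> p \<and> act P (\<sigma> (proj P p)) (\<Phi> p) = p) \<and>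
     (\<forall>y\<in>U. \<forall>g. \<Phi> (act P (\<sigma> y) g) = g)"
proof -
  have "\<exists>U \<Phi> \<tau>. open U \<and> x0 \<in> U \<and>
      smooth_map_on (total P) (prod_atlas (base P) (grp P)) (proj P -` U) (\<lambda>p. (proj P p, \<Phi> p)) \<and>
      smooth_map_on (prod_atlas (base P) (grp P)) (total P) (U \<times> UNIV) \<tau> \<and>
      (\<forall>p\<in>proj P -` U. \<tau> (proj P p, \<Phi> p) = p) \<and>
      (\<forall>y\<in>U. \<forall>g. proj P (\<tau> (y, g)) = y \<and> \<Phi> (\<tau> (y, g)) = g) \<and>
      (\<forall>p\<in>proj P -` U. \<forall>g. \<Phi> (act P p g) = mul P (\<Phi> p) g)"
    using principal unfolding principal_bundle_def by (elim conjE allE[of _ x0])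
  then obtain U \<Phi> \<tau> where U: "open U" "x0 \<in> U"
    and s\<Phi>: "smooth_map_on (total P) (prod_atlas (base P) (grp P)) (proj P -` U) (\<lambda>p. (proj P p, \<Phi> p))"
    and s\<tau>: "smooth_map_on (prod_atlas (base P) (grp P)) (total P) (U \<times> UNIV) \<tau>"
    and inv1: "\<forall>p\<in>proj P -` U. \<tau> (proj P p, \<Phi> p) = p"
    and inv2: "\<forall>y\<in>U. \<forall>g. proj P (\<tau> (y, g)) = y \<and> \<Phi> (\<tau> (y, g)) = g"
    and equiv: "\<forall>p\<in>proj P -` U. \<forall>g. \<Phi> (act P p g) = mul P (\<Phi> p) g"
    by (elim exE conjE) (rule that)
  have "continuous_on UNIV (proj P)" using principal by (simp add: principal_bundle_def smooth_map_on_def)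
  then have oU: "open (proj P -` U)" using U(1) by (simp add: continuous_on_open_vimage)
  define \<sigma> where "\<sigma> = (\<lambda>y. \<tau> (y, gunit P))"
  note ab = smooth_atlas_prod[OF atlases(1,3)]
  have 1: "smooth_at (base P) (total P) \<sigma> y" if "y \<in> U" for y
  proof -
    have "smooth_at (prod_atlas (base P) (grp P)) (total P) \<tau> (y, gunit P)"
      by (rule smooth_map_on_imp_smooth_at[OF ab atlases(2) s\<tau>]) (use U that in \<open>auto intro: open_Times\<close>)
    from smooth_at_compose[OF atlases(1) ab atlases(2)
        smooth_at_Pair[OF atlases(1,1,3) smooth_at_id[OF atlases(1)] smooth_at_const[OF atlases(1,3)]] this]
    show ?thesis by (simp add: \<sigma>_def)
  qed
  have 2: "smooth_at (total P) (grp P) \<Phi> p" if "proj P p \<in> U" for p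
  proof -
    have "smooth_at (total P) (prod_atlas (base P) (grp P)) (\<lambda>p. (proj P p, \<Phi> p)) p"
      by (rule smooth_map_on_imp_smooth_at[OF atlases(2) ab s\<Phi> oU]) (use that in auto)
    from smooth_at_compose[OF atlases(2) ab atlases(3) this smooth_at_snd[OF atlases(1,3)]]
    show ?thesis by simp
  qed
  have 3: "proj P (\<sigma> y) = y" "\<Phi> (\<sigma> y) = gunit P" if "y \<in> U" for y using that inv2 by (simp_all add: \<sigma>_def)
  have 4: "\<Phi> (act P (\<sigma> y) g) = g" if "y \<in> U" for y g using that equiv 3 by simp
  have 5: "act P (\<sigma> (proj P p)) (\<Phi> p) = p" if p: "proj P p \<in> U" for p
  proof -
    let ?q = "act P (\<sigma> (proj P p)) (\<Phi> p)"
    have q: "proj P ?q = proj P p" "\<Phi> ?q = \<Phi> p" using 3 4 p bundleD(5) by auto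
    have "?q = \<tau> (proj P ?q, \<Phi> ?q)" using inv1[rule_format, of ?q] p q(1) by simp
    also have "\<dots> = \<tau> (proj P p, \<Phi> p)" by (simp only: q)
    also have "\<dots> = p" using inv1 p by simp
    finally show ?thesis .
  qed
  show ?thesis using U 1 2 3 4 5 by (intro exI[of _ U] exI[of _ \<sigma>] exI[of _ \<Phi>]) simp
qed

lemma (in smooth_principal_bundle) act_transitive:
  assumes "proj P p = proj P q" shows "\<exists>g. q = act P p g"
proof -
  obtain U \<sigma> \<Phi> where "proj P p \<in> U" and U: "\<forall>p. proj P p \<in> U \<longrightarrow> smooth_at (total P) (grp P) \<Phi> p \<and> act P (\<sigma> (proj P p)) (\<Phi> p) = p"
    using local_section[of "proj P p"] by (elim exE conjE) (rule that)
  then have p: "act P (\<sigma> (proj P p)) (\<Phi> p) = p" and q: "act P (\<sigma> (proj P p)) (\<Phi> q) = q"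
    using U[rule_format, of p] U[rule_format, of q] assms by simp_all
  have "act P (act P (\<sigma> (proj P p)) (\<Phi> p)) (mul P (ginv P (\<Phi> p)) (\<Phi> q)) = act P (\<sigma> (proj P p)) (\<Phi> q)"
    by (simp add: bundleD(4))
  then show ?thesis unfolding p q by metis
qed

lemma (in smooth_principal_bundle) act_free:
  assumes "act P p g = act P p h" shows "g = h"
proof -
  obtain U \<sigma> \<Phi> where x: "proj P p \<in> U" and U: "\<forall>p. proj P p \<in> U \<longrightarrow> smooth_at (total P) (grp P) \<Phi> p \<and> act P (\<sigma> (proj P p)) (\<Phi> p) = p"
    and \<Phi>: "\<forall>y\<in>U. \<forall>g. \<Phi> (act P (\<sigma> y) g) = g"
    using local_section[of "proj P p"] by (elim exE conjE) (rule that)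
  have p: "act P (\<sigma> (proj P p)) (\<Phi> p) = p" using U x by simp
  have "\<Phi> (act P p k) = mul P (\<Phi> p) k" for k
    using \<Phi>[rule_format, OF x, of "mul P (\<Phi> p) k"] by (simp add: bundleD(4)[symmetric] p)
  then have "mul P (\<Phi> p) g = mul P (\<Phi> p) h" using assms by metis
  then have "mul P (ginv P (\<Phi> p)) (mul P (\<Phi> p) g) = mul P (ginv P (\<Phi> p)) (mul P (\<Phi> p) h)" by simp
  then show ?thesis by (simp only: grp_simps)
qed

text \<open>Push \<open>v\<close> forward along a local section through \<open>p\<close>, then
  subtract the fundamental vector of its connection value. The connection reproduces fundamental
  vectors, so the difference is horizontal; they are vertical, so its projection is still
  \<open>v\<close>.\<close>

lemma (in smooth_principal_bundle) hlift_exists: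
  assumes conn: "principal_connection P" and v: "v \<in> tangent_space (base P) (proj P p)"
  shows "hlift P p v \<in> tangent_space (total P) p \<and> pushforward (base P) (proj P) (hlift P p v) = v \<and> conn P p (hlift P p v) = 0"
proof -
  obtain U \<sigma> \<Phi> where U: "open U" "proj P p \<in> U"
    and \<sigma>: "\<forall>y\<in>U. smooth_at (base P) (total P) \<sigma> y \<and> proj P (\<sigma> y) = y"
    and \<Phi>: "\<forall>p. proj P p \<in> U \<longrightarrow> smooth_at (total P) (grp P) \<Phi> p \<and> act P (\<sigma> (proj P p)) (\<Phi> p) = p"
    using local_section[of "proj P p"] by (elim exE conjE) (rule that)
  \<comment> \<open>Translating the section by the constant \<open>\<Phi> p\<close> makes it pass
    through \<open>p\<close>.\<close>
  define s where "s = (\<lambda>y. act P (\<sigma> y) (\<Phi> p))"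
  have s: "smooth_at (base P) (total P) s y" "proj P (s y) = y" if "y \<in> U" for y
    using \<sigma> that bundleD(5) unfolding s_def
    by (auto intro!: smooth_at_act[OF atlases(1)] smooth_at_const[OF atlases(1,3)])
  have sx: "s (proj P p) = p" using \<Phi> U by (simp add: s_def)
  obtain w0 where w0: "w0 \<in> tangent_space (total P) (s (proj P p))"
    "\<forall>f\<in>smooth_functions (total P). \<forall>g\<in>smooth_functions (base P). (\<forall>y\<in>U. f (s y) = g y) \<longrightarrow> w0 f = v g"
    using tangent_local_pushforward[OF atlases(1,2) compact_base U s(1) v] by blast
  have w0p: "w0 \<in> tangent_space (total P) p" using w0(1) sx by simp
  define X where "X = conn P p w0"
  have cD: "linear_map_on (tangent_space (total P) p) (conn P p)" "conn P p ` tangent_space (total P) p \<subseteq> lie_algebra P"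
    "\<And>X. X \<in> lie_algebra P \<Longrightarrow> conn P p (fundamental_vector P p X) = X"
    using conn unfolding principal_connection_def by blast+
  have X: "X \<in> lie_algebra P" using cD(2) w0p by (auto simp: X_def)
  have sa: "smooth_at (grp P) (total P) (act P p) g" for g
    using smooth_at_act[OF atlases(3) smooth_at_const[OF atlases(3,2)] smooth_at_id[OF atlases(3)]] .
  have F: "fundamental_vector P p X \<in> tangent_space (total P) p"
    using pushforward_tangent[OF atlases(3,2) sa X] bundleD(3) by (simp add: fundamental_vector_def)
  let ?w = "w0 + (- 1) *\<^sub>R fundamental_vector P p X"
  have wT: "?w \<in> tangent_space (total P) p"
    by (intro subspace_add[OF subspace_tangent] subspace_scale[OF subspace_tangent] w0p F)
  have F': "(- 1) *\<^sub>R fundamental_vector P p X \<in> tangent_space (total P) p"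
    by (rule subspace_scale[OF subspace_tangent F])
  have "conn P p ?w = conn P p w0 + (- 1) *\<^sub>R conn P p (fundamental_vector P p X)"
    using cD(1) w0p F F' unfolding linear_map_on_def by metis
  then have c0: "conn P p ?w = 0" using cD(3)[OF X] unfolding X_def by (simp only: scaleR_minus1_left add.right_inverse)
  have "pushforward (base P) (proj P) ?w f = v f" for f
  proof (cases "f \<in> smooth_functions (base P)")
    case True
    have fp: "(\<lambda>p. f (proj P p)) \<in> smooth_functions (total P)" by (rule smooth_functions_proj[OF True])
    have "w0 (\<lambda>p. f (proj P p)) = v f" using w0(2)[rule_format, OF fp True] s(2) by simp
    \<comment> \<open>Along the orbit of \<open>p\<close> the projection is constant, so
      \<open>X\<close> is applied to a constant function.\<close>
    moreover have "fundamental_vector P p X (\<lambda>p. f (proj P p)) = 0"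
      using fp tangent_const[OF atlases(3) X] by (simp add: fundamental_vector_def pushforward_def comp_def bundleD(5))
    ultimately show ?thesis using True by (simp add: pushforward_def comp_def scaleR_fun_def)
  next
    case False
    then show ?thesis using tangentD(4)[OF v] by (simp add: pushforward_def)
  qed
  then have "\<exists>w. w \<in> tangent_space (total P) p \<and> pushforward (base P) (proj P) w = v \<and> conn P p w = 0"
    using wT c0 by (intro exI[of _ ?w]) blast
  from someI_ex[OF this] show ?thesis unfolding hlift_def .
qed


section \<open>The adjoint bundle in a frame\<close>

lemma pushforward_add: "pushforward B F (v + w) = pushforward B F v + pushforward B F w"
  by (auto simp: pushforward_def fun_eq_iff)

lemma pushforward_scaleR: "pushforward B F (c *\<^sub>R v) = c *\<^sub>R pushforward B F v"
  by (auto simp: pushforward_def fun_eq_iff scaleR_fun_def)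

lemma pushforward_zero: "pushforward B F 0 = 0"
  by (auto simp: pushforward_def fun_eq_iff)

lemma (in smooth_principal_bundle) smooth_at_conj:
  "smooth_at (grp P) (grp P) (\<lambda>h. mul P (mul P g h) (ginv P g)) x"
  by (intro smooth_at_mul atlases smooth_at_const smooth_at_id)

lemma (in smooth_principal_bundle) Ad_lie:
  assumes "X \<in> lie_algebra P" shows "Ad P g X \<in> lie_algebra P"
  using pushforward_tangent[OF atlases(3,3) smooth_at_conj assms, of g] by (simp add: Ad_def)

lemma (in smooth_principal_bundle) Ad_unit:
  assumes "X \<in> lie_algebra P" shows "Ad P (gunit P) X = X"
  using tangentD(4)[OF assms] by (auto simp: Ad_def pushforward_def fun_eq_iff comp_def)

lemma (in smooth_principal_bundle) Ad_mul: "Ad P (mul P g h) X = Ad P g (Ad P h X)"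
proof
  fix f
  have "(\<lambda>x. f (mul P (mul P g x) (ginv P g))) \<in> smooth_functions (grp P)" if "f \<in> smooth_functions (grp P)"
    using that smooth_at_compose[OF atlases(3,3) smooth_atlas_real smooth_at_conj]
    by (simp add: smooth_functions_iff del: grp_simps)
  then show "Ad P (mul P g h) X f = Ad P g (Ad P h X) f"
    by (simp add: Ad_def pushforward_def comp_def)
qed

lemma (in smooth_principal_bundle) subspace_ad_fibre: "subspace (ad_fibre P x)"
  using subspace_tangent[of "grp P" "gunit P"]
  unfolding subspace_def ad_fibre_def
  by (auto simp: Ad_def pushforward_add pushforward_scaleR pushforward_zero scaleR_fun_def[where ?'a = 'p])

lemma (in smooth_principal_bundle) ad_fibreD:
  assumes "a \<in> ad_fibre P (proj P p)"
  shows "a p \<in> lie_algebra P" "a (act P p g) = Ad P (ginv P g) (a p)"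
  using assms by (auto simp: ad_fibre_def)

lemma (in smooth_principal_bundle) ad_fibre_eqI:
  assumes a: "a \<in> ad_fibre P (proj P p)" and b: "b \<in> ad_fibre P (proj P p)" and ab: "a p = b p"
  shows "a = b"
proof
  fix q
  show "a q = b q"
  proof (cases "proj P q = proj P p")
    case True
    then obtain g where "q = act P p g" using act_transitive[of p q] by auto
    then show ?thesis using ad_fibreD(2)[OF a] ad_fibreD(2)[OF b] ab by simp
  next
    case False
    then show ?thesis using a b by (simp add: ad_fibre_def)
  qed
qed

text \<open>The inverse of evaluation at \<open>p\<close>, which identifies the fibre with the Lie
  algebra; it names the description inside \<open>to_frame\<close>.\<close>

definition ad_elt :: "('m, 'em, 'g, 'eg::real_normed_vector, 'p, 'ep) pbundle \<Rightarrow> 'p \<Rightarrow> 'g tangent \<Rightarrow> ('p, 'g) adj"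
  where "ad_elt P p X = (THE a. a \<in> ad_fibre P (proj P p) \<and> a p = X)"

lemma (in smooth_principal_bundle) ad_elt_eqI:
  assumes "a \<in> ad_fibre P (proj P p)" shows "ad_elt P p (a p) = a"
  unfolding ad_elt_def using assms ad_fibre_eqI by blast

lemma (in smooth_principal_bundle) ad_elt:
  assumes X: "X \<in> lie_algebra P"
  shows "ad_elt P p X \<in> ad_fibre P (proj P p)" "ad_elt P p X p = X"
proof -
  \<comment> \<open>Equivariance forces this formula. Freeness of the action makes the chosen group
    element the right one, and transitivity on the fibre shows that every point over the same base
    point is reached.\<close>
  define a where "a = (\<lambda>q. if proj P q = proj P p then Ad P (ginv P (SOME g. q = act P p g)) X else 0)"
  have some: "(SOME g. act P p h = act P p g) = h" for h
    using act_free by (intro some_equality) auto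
  have a: "a (act P p h) = Ad P (ginv P h) X" for h
    by (simp add: a_def bundleD(5) some)
  have ap: "a p = X" using a[of "gunit P"] X by (simp add: bundleD(3) Ad_unit)
  have "a \<in> ad_fibre P (proj P p)"
    unfolding ad_fibre_def
  proof (intro CollectI conjI allI impI)
    fix q assume "proj P q = proj P p"
    then obtain h where q: "q = act P p h" using act_transitive[of p q] by auto
    show "a q \<in> lie_algebra P" using X by (simp add: q a Ad_lie)
    show "a (act P q g) = Ad P (ginv P g) (a q)" for g
      by (simp add: q a bundleD(4) Ad_mul[symmetric])
  qed (simp add: a_def)
  from ad_elt_eqI[OF this] ap this show "ad_elt P p X \<in> ad_fibre P (proj P p)" "ad_elt P p X p = X" by simp_all
qed

lemma to_frame_eq: "to_frame P p \<psi> = (\<lambda>X. if X \<in> lie_algebra P then \<psi> (ad_elt P p X) else 0)"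
  unfolding to_frame_def ad_elt_def by (rule refl)

lemma (in smooth_principal_bundle) linear_ad_elt: "linear_map_on (lie_algebra P) (ad_elt P p)"
  unfolding linear_map_on_def
proof (intro conjI ballI allI)
  fix X assume X: "X \<in> lie_algebra P"
  show "ad_elt P p (c *\<^sub>R X) = c *\<^sub>R ad_elt P p X" for c
    using ad_elt_eqI[OF subspace_scale[OF subspace_ad_fibre ad_elt(1)[OF X, of p]], of c] ad_elt(2)[OF X, of p]
    by (simp add: scaleR_fun_def[where ?'a = 'p])
  fix Y assume Y: "Y \<in> lie_algebra P"
  show "ad_elt P p (X + Y) = ad_elt P p X + ad_elt P p Y"
    using ad_elt_eqI[OF subspace_add[OF subspace_ad_fibre ad_elt(1)[OF X, of p] ad_elt(1)[OF Y, of p]]]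
      ad_elt(2)[OF X, of p] ad_elt(2)[OF Y, of p] by simp
qed

lemma (in smooth_principal_bundle) from_frame_dual:
  assumes "\<phi> \<in> dual_space (lie_algebra P)" shows "from_frame P p \<phi> \<in> coad_fibre P (proj P p)"
  using assms ad_fibreD(1) subspace_add[OF subspace_ad_fibre] subspace_scale[OF subspace_ad_fibre]
  unfolding dual_space_def linear_map_on_def from_frame_def
  by (auto simp: scaleR_fun_def[where ?'a = 'p])

lemma (in smooth_principal_bundle) to_frame_dual:
  assumes "\<psi> \<in> coad_fibre P (proj P p)" shows "to_frame P p \<psi> \<in> dual_space (lie_algebra P)"
proof -
  have "linear_map_on (lie_algebra P) (to_frame P p \<psi>)"
    unfolding linear_map_on_def
  proof (intro conjI ballI allI)
    fix X assume X: "X \<in> lie_algebra P"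
    show "to_frame P p \<psi> (c *\<^sub>R X) = c *\<^sub>R to_frame P p \<psi> X" for c
      using assms X ad_elt(1)[OF X, of p] subspace_scale[OF subspace_tangent X, of c] linear_ad_elt[of p]
      by (simp add: to_frame_eq dual_space_def linear_map_on_def)
    fix Y assume Y: "Y \<in> lie_algebra P"
    show "to_frame P p \<psi> (X + Y) = to_frame P p \<psi> X + to_frame P p \<psi> Y"
      using assms X Y ad_elt(1)[OF X, of p] ad_elt(1)[OF Y, of p] subspace_add[OF subspace_tangent X Y] linear_ad_elt[of p]
      by (simp add: to_frame_eq dual_space_def linear_map_on_def)
  qed
  then show ?thesis by (simp add: dual_space_def to_frame_eq)
qed

lemma (in smooth_principal_bundle) from_to_frame:
  assumes "\<psi> \<in> coad_fibre P (proj P p)" shows "from_frame P p (to_frame P p \<psi>) = \<psi>"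
  using assms ad_fibreD(1)[of _ p] ad_elt_eqI[of _ p]
  by (intro ext) (auto simp: from_frame_def to_frame_eq dual_space_def)

text \<open>Moving the frame by \<open>g\<close> changes covectors by the coadjoint action, because
  \<open>a (act P p g) = Ad P (ginv P g) (a p)\<close>. This is how \<Phi> enters the test functions
  of a transported form.\<close>

lemma (in smooth_principal_bundle) to_from_frame_act:
  assumes "\<phi> \<in> dual_space (lie_algebra P)"
  shows "to_frame P p (from_frame P (act P p g) \<phi>) = (\<lambda>X. if X \<in> lie_algebra P then \<phi> (Ad P (ginv P g) X) else 0)"
  using ad_elt[of _ p] ad_fibreD(2)[of _ p g] by (intro ext) (auto simp: from_frame_def to_frame_eq bundleD(5))

lemma linear_map_on_from_frame: "linear_map_on V (from_frame P p)"
  by (auto simp: linear_map_on_def from_frame_def fun_eq_iff scaleR_fun_def)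

lemma linear_map_on_to_frame: "linear_map_on V (to_frame P p)"
  by (auto simp: linear_map_on_def to_frame_eq fun_eq_iff scaleR_fun_def)

lemma subspace_dual_space: "subspace (dual_space V)"
  by (auto simp: subspace_def dual_space_def linear_map_on_def scaleR_fun_def algebra_simps)

text \<open>Expanding \<open>X\<close> in a chart frame at the unit turns \<open>Ad P g X f\<close>
  into a combination, with constant coefficients, of partial derivatives at the unit of the
  conjugate of a variable point by \<open>g\<close>, composed with \<open>f\<close>.\<close>

lemma (in smooth_principal_bundle) Ad_smooth:
  assumes X: "X \<in> lie_algebra P" and f: "f \<in> smooth_functions (grp P)"
  shows "(\<lambda>g. Ad P g X f) \<in> smooth_functions (grp P)"
proof -
  obtain U \<phi> where U: "(U, \<phi>) \<in> grp P" "gunit P \<in> U" using atlas_cover[OF atlases(3)] .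
  obtain B :: "'eg set" where B: "onb B" using atlas_onb[OF atlases(3)] by blast
  obtain h where h: "X = (\<Sum>b\<in>B. X (h b) *\<^sub>R chart_deriv (grp P) U \<phi> (gunit P) b)"
    using tangent_frame[OF atlases(3) compact_group U B] X by blast
  let ?K = "\<lambda>z. f (mul P (mul P (fst z) (snd z)) (ginv P (fst z)))"
  note gg = smooth_atlas_prod[OF atlases(3,3)]
  have fs: "smooth_at (grp P) std_atlas f y" for y using f by (simp add: smooth_functions_iff)
  have K: "smooth_at (prod_atlas (grp P) (grp P)) std_atlas ?K z" for z
  proof -
    note fst = smooth_at_fst[OF atlases(3,3), of z] and snd = smooth_at_snd[OF atlases(3,3), of z]
    note m = smooth_at_mul[OF gg smooth_at_mul[OF gg fst snd] smooth_at_compose[OF gg atlases(3,3) fst smooth_at_ginv]]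
    show ?thesis by (rule smooth_at_compose[OF gg atlases(3) smooth_atlas_real m fs])
  qed
  have "Ad P g X f = (\<Sum>b\<in>B. X (h b) * frechet_derivative (\<lambda>z. ?K (g, inv_into U \<phi> z)) (at (\<phi> (gunit P))) b)" for g
  proof -
    have c: "(\<lambda>x. f (mul P (mul P g x) (ginv P g))) \<in> smooth_functions (grp P)"
      using smooth_at_compose[OF atlases(3,3) smooth_atlas_real smooth_at_conj fs]
      by (simp add: smooth_functions_iff del: grp_simps)
    have "Ad P g X f = X (\<lambda>x. f (mul P (mul P g x) (ginv P g)))"
      using f by (simp add: Ad_def pushforward_def comp_def)
    also have "\<dots> = (\<Sum>b\<in>B. X (h b) *\<^sub>R chart_deriv (grp P) U \<phi> (gunit P) b) (\<lambda>x. f (mul P (mul P g x) (ginv P g)))"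
      using h by (rule fun_cong)
    also have "\<dots> = (\<Sum>b\<in>B. X (h b) * frechet_derivative (\<lambda>z. ?K (g, inv_into U \<phi> z)) (at (\<phi> (gunit P))) b)"
      unfolding sum_fun_apply using c by (simp add: scaleR_fun_def chart_deriv_def comp_def)
    finally show ?thesis .
  qed
  then have eq: "(\<lambda>g. Ad P g X f) = (\<lambda>g. \<Sum>b\<in>B. X (h b) * frechet_derivative (\<lambda>z. ?K (g, inv_into U \<phi> z)) (at (\<phi> (gunit P))) b)"
    by (rule ext)
  show ?thesis unfolding eq
  proof (intro smooth_functions_sum[OF atlases(3)] smooth_functions_cmult[OF atlases(3)])
    show "(\<lambda>g. frechet_derivative (\<lambda>z. ?K (g, inv_into U \<phi> z)) (at (\<phi> (gunit P))) b) \<in> smooth_functions (grp P)" for b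
      unfolding smooth_functions_iff[OF atlases(3)]
      by (rule allI, rule smooth_at_partial_derivative[OF atlases(3,3) K U])
  qed
qed


section \<open>Multilinear maps\<close>

text \<open>Curves \<open>\<Sum>\<^sub>i c\<^sub>i e\<^sub>i\<close> with constant vectors \<open>e\<^sub>i \<in> V\<close> and coefficients in \<open>C\<close>, which stands for
  the functions that are smooth near a given set.\<close>

inductive curve_in :: "('x \<Rightarrow> real) set \<Rightarrow> 'v::real_vector set \<Rightarrow> ('x \<Rightarrow> 'v) \<Rightarrow> bool"
  for C V where
    zero: "curve_in C V (\<lambda>_. 0)"
  | step: "c \<in> C \<Longrightarrow> e \<in> V \<Longrightarrow> curve_in C V u \<Longrightarrow> curve_in C V (\<lambda>y. c y *\<^sub>R e + u y)"

definition function_algebra :: "('x \<Rightarrow> real) set \<Rightarrow> bool"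
  where "function_algebra C \<longleftrightarrow> (\<forall>c. (\<lambda>_. c) \<in> C) \<and>
    (\<forall>c\<in>C. \<forall>d\<in>C. (\<lambda>y. c y + d y) \<in> C \<and> (\<lambda>y. c y * d y) \<in> C)"

lemma curve_in_add:
  assumes "curve_in C V u" "curve_in C V w" shows "curve_in C V (\<lambda>y. u y + w y)"
  using assms(1)
proof induction
  case zero
  then show ?case using assms(2) by simp
next
  case (step c e u)
  then show ?case using curve_in.step[of c C e V "\<lambda>y. u y + w y"] by (simp add: add.assoc)
qed

lemma curve_in_mult:
  assumes C: "function_algebra C" "d \<in> C" and u: "curve_in C V u" shows "curve_in C V (\<lambda>y. d y *\<^sub>R u y)"
  using u
proof induction
  case zero
  then show ?case using curve_in.zero by simp
next
  case (step c e u)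
  then show ?case using C curve_in.step[of "\<lambda>y. d y * c y" C e V "\<lambda>y. d y *\<^sub>R u y"]
    by (simp add: function_algebra_def scaleR_add_right)
qed

lemma curve_in_single: "c \<in> C \<Longrightarrow> e \<in> V \<Longrightarrow> curve_in C V (\<lambda>y. c y *\<^sub>R e)"
  using curve_in.step[OF _ _ curve_in.zero, of c C e V] by simp

lemma curve_in_const: "function_algebra C \<Longrightarrow> e \<in> V \<Longrightarrow> curve_in C V (\<lambda>y. e)"
  using curve_in_single[of "\<lambda>_. 1" C e V] by (simp add: function_algebra_def)

lemma curve_in_sum:
  assumes "\<And>i. i \<in> I \<Longrightarrow> c i \<in> C" "\<And>i. i \<in> I \<Longrightarrow> e i \<in> V"
  shows "curve_in C V (\<lambda>y. \<Sum>i\<in>I. c i y *\<^sub>R e i)"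
  using assms by (induction I rule: infinite_finite_induct) (simp_all add: curve_in.intros)

lemma curve_in_real:
  assumes "function_algebra C" "curve_in C V u" shows "(u :: _ \<Rightarrow> real) \<in> C"
  using assms(2)
proof induction
  case zero
  then show ?case using assms(1) by (simp add: function_algebra_def)
next
  case (step c e u)
  then have "(\<lambda>y. c y * e) \<in> C" using assms(1) by (simp add: function_algebra_def)
  then show ?case using assms(1) step by (simp add: function_algebra_def)
qed

lemma multilinear_slot:
  assumes F: "F \<in> multilinear_maps n V W" and "length xs + Suc (length ys) = n" "set xs \<subseteq> V" "set ys \<subseteq> V" "u \<in> V"
  shows "w \<in> V \<Longrightarrow> F (xs @ (u + w) # ys) = F (xs @ u # ys) + F (xs @ w # ys)"
    "F (xs @ (c *\<^sub>R u) # ys) = c *\<^sub>R F (xs @ u # ys)"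
proof -
  let ?us = "xs @ u # ys"
  have "length ?us = n \<and> set ?us \<subseteq> V" using assms by auto
  then have "\<forall>i<n. linear_map_on V (\<lambda>u. F (?us[i := u]))"
    using F unfolding multilinear_maps_def by blast
  moreover have "length xs < n" using assms(2) by simp
  ultimately have "linear_map_on V (\<lambda>u. F (?us[length xs := u]))" by blast
  then have L: "linear_map_on V (\<lambda>u. F (xs @ u # ys))" by simp
  show "w \<in> V \<Longrightarrow> F (xs @ (u + w) # ys) = F (xs @ u # ys) + F (xs @ w # ys)"
    "F (xs @ (c *\<^sub>R u) # ys) = c *\<^sub>R F (xs @ u # ys)"
    using L assms(5) unfolding linear_map_on_def by blast+
qed

lemma multilinear_in: "F \<in> multilinear_maps n V W \<Longrightarrow> length us = n \<Longrightarrow> set us \<subseteq> V \<Longrightarrow> F us \<in> W"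
  unfolding multilinear_maps_def by blast

lemma multilinear_out: "F \<in> multilinear_maps n V W \<Longrightarrow> length us \<noteq> n \<or> \<not> set us \<subseteq> V \<Longrightarrow> F us = 0"
  unfolding multilinear_maps_def by blast

lemma curve_in_subspace: "subspace V \<Longrightarrow> curve_in C V u \<Longrightarrow> u y \<in> V"
  by (erule curve_in.induct) (auto intro: subspace_0 subspace_add subspace_scale)

text \<open>The arguments are worked off from the right: \<open>us\<close> still vary,
  \<open>vs\<close> are already constant. Unfolding the last curve term by term moves its constant
  vectors into \<open>vs\<close>, and the induction hypothesis, general in \<open>vs\<close>,
  handles the shorter list.\<close>

lemma curve_in_multilinear_aux:
  assumes C: "function_algebra C" and V: "subspace V" and F: "F \<in> multilinear_maps n V W"
    and "length us + length vs = n" "\<And>u. u \<in> set us \<Longrightarrow> curve_in C V u" "set vs \<subseteq> V"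
  shows "curve_in C W (\<lambda>y. F (map (\<lambda>u. u y) us @ vs))"
  using assms(4-)
proof (induction us arbitrary: vs rule: rev_induct)
  case Nil
  then show ?case using curve_in_const[OF C multilinear_in[OF F]] by simp
next
  case (snoc w us)
  have us: "set (map (\<lambda>u. u y) us) \<subseteq> V" for y
    using snoc.prems(2) curve_in_subspace[OF V, of C _ y] by auto
  have len: "length (map (\<lambda>u. u y) us) + Suc (length vs) = n" for y using snoc.prems(1) by simp
  have "curve_in C V w" using snoc.prems(2) by simp
  then have "curve_in C W (\<lambda>y. F (map (\<lambda>u. u y) us @ w y # vs))"
  proof induction
    case zero
    have "F (map (\<lambda>u. u y) us @ 0 # vs) = 0" for y
      using multilinear_slot(2)[OF F len us snoc.prems(3) subspace_0[OF V], of y 0] by simp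
    then show ?case using curve_in.zero by simp
  next
    case (step c e u)
    have "F (map (\<lambda>u. u y) us @ (c y *\<^sub>R e + u y) # vs) =
        c y *\<^sub>R F (map (\<lambda>u. u y) us @ e # vs) + F (map (\<lambda>u. u y) us @ u y # vs)" for y
      using multilinear_slot(1)[OF F len us snoc.prems(3) subspace_scale[OF V step(2)] curve_in_subspace[OF V step(3)], of y "c y" y]
        multilinear_slot(2)[OF F len us snoc.prems(3) step(2), of y "c y"] by simp
    moreover have "curve_in C W (\<lambda>y. F (map (\<lambda>u. u y) us @ e # vs))"
      using snoc.prems step(2) by (intro snoc.IH) auto
    ultimately show ?case using step by (simp add: curve_in_add curve_in_mult[OF C])
  qed
  then show ?case by simp
qed

lemma curve_in_multilinear:
  assumes "function_algebra C" "subspace V" "F \<in> multilinear_maps (length us) V W" "\<And>u. u \<in> set us \<Longrightarrow> curve_in C V u"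
  shows "curve_in C W (\<lambda>y. F (map (\<lambda>u. u y) us))"
  using curve_in_multilinear_aux[OF assms(1-3), of us "[]"] assms(4) by simp

text \<open>Here the multilinear form varies together with its arguments: it is unfolded into
  constant forms, each covered by the case of a fixed form.\<close>

lemma curve_in_apply:
  assumes C: "function_algebra C" and V: "subspace V" and S: "curve_in C (multilinear_maps (length us) V UNIV) S"
    and us: "\<And>u. u \<in> set us \<Longrightarrow> curve_in C V u"
  shows "(\<lambda>y. S y (map (\<lambda>u. u y) us) :: real) \<in> C"
  using S
proof induction
  case zero
  then show ?case using C by (simp add: function_algebra_def)
next
  case (step c e u)
  have "(\<lambda>y. e (map (\<lambda>u. u y) us)) \<in> C"
    using curve_in_real[OF C curve_in_multilinear[OF C V step(2) us]] .
  then show ?case using C step by (simp add: function_algebra_def scaleR_fun_def)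
qed

lemma curve_in_mono: "curve_in C V u \<Longrightarrow> V \<subseteq> W \<Longrightarrow> curve_in C W u"
  by (induction rule: curve_in.induct) (auto intro: curve_in.intros)

section \<open>Pullbacks of multilinear, alternating and symmetric maps\<close>

text \<open>Arguments are pulled back along \<open>L\<close> and values sent through
  \<open>T\<close>. The condition \<open>T 0 = 0\<close> serves the lists over \<open>V'\<close> of
  wrong length, where \<open>F\<close> is zero.\<close>

lemma multilinear_pullback:
  assumes F: "F \<in> multilinear_maps n V W" and L: "linear_map_on V' L" "L ` V' \<subseteq> V"
    and V': "subspace V'" and T: "linear_map_on W T" "T ` W \<subseteq> W'" "T 0 = 0"
  shows "(\<lambda>us. if set us \<subseteq> V' then T (F (map L us)) else 0) \<in> multilinear_maps n V' W'" (is "?G \<in> _")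
  unfolding multilinear_maps_def
proof (intro CollectI conjI allI impI)
  fix us assume us: "length us = n \<and> set us \<subseteq> V'"
  then have Lus: "length (map L us) = n" "set (map L us) \<subseteq> V" using L(2) by auto
  show "?G us \<in> W'" using us multilinear_in[OF F Lus] T(2) by auto
  fix i assume i: "i < n"
  have lin: "linear_map_on V (\<lambda>u. F ((map L us)[i := u]))"
    using F Lus i unfolding multilinear_maps_def by blast
  have in': "F ((map L us)[i := L u]) \<in> W" if "u \<in> V'" for u
    using Lus that L(2) by (intro multilinear_in[OF F] set_update_subsetI) auto
  have G: "?G (us[i := u]) = T (F ((map L us)[i := L u]))" if "u \<in> V'" for u
    using us that set_update_subset_insert[of us i u] by (auto simp: map_update)
  show "linear_map_on V' (\<lambda>u. ?G (us[i := u]))"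
    unfolding linear_map_on_def
  proof (intro conjI ballI allI)
    fix u assume u: "u \<in> V'"
    show "?G (us[i := c *\<^sub>R u]) = c *\<^sub>R ?G (us[i := u])" for c
    proof -
      have "?G (us[i := c *\<^sub>R u]) = T (F ((map L us)[i := c *\<^sub>R L u]))"
        using G[OF subspace_scale[OF V' u]] L(1) u by (simp add: linear_map_on_def)
      also have "\<dots> = c *\<^sub>R T (F ((map L us)[i := L u]))"
        using lin T(1) in'[OF u] L(2) u by (simp add: linear_map_on_def image_subset_iff)
      finally show ?thesis by (simp only: G[OF u])
    qed
    fix w assume w: "w \<in> V'"
    have "?G (us[i := u + w]) = T (F ((map L us)[i := L u + L w]))"
      using G[OF subspace_add[OF V' u w]] L(1) u w by (simp add: linear_map_on_def)
    also have "\<dots> = T (F ((map L us)[i := L u])) + T (F ((map L us)[i := L w]))"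
      using lin T(1) in'[OF u] in'[OF w] L(2) u w by (simp add: linear_map_on_def image_subset_iff)
    finally show "?G (us[i := u + w]) = ?G (us[i := u]) + ?G (us[i := w])"
      by (simp only: G[OF u] G[OF w])
  qed
next
  fix us assume "\<not> (length us = n \<and> set us \<subseteq> V')"
  then show "?G us = 0" using T(3) multilinear_out[OF F, of "map L us"] by auto
qed

lemma curve_in_linear:
  assumes L: "linear_map_on UNIV L" "L ` V \<subseteq> W" and u: "curve_in C V u"
  shows "curve_in C W (\<lambda>y. L (u y))"
  using u
proof induction
  case zero
  have "L 0 = 0" using L(1) unfolding linear_map_on_def by (metis UNIV_I scaleR_zero_left)
  then show ?case using curve_in.zero by simp
next
  case (step c e u)
  then show ?case using L curve_in.step[of c C "L e" W "\<lambda>y. L (u y)"] by (auto simp: linear_map_on_def)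
qed

lemma alternating_pullback:
  assumes F: "F \<in> alternating_maps n V W" and L: "linear_map_on V' L" "L ` V' \<subseteq> V"
    and V': "subspace V'" and T: "linear_map_on W T" "T ` W \<subseteq> W'" "T 0 = 0"
  shows "(\<lambda>us. if set us \<subseteq> V' then T (F (map L us)) else 0) \<in> alternating_maps n V' W'"
proof -
  have F': "F \<in> multilinear_maps n V W" "\<And>us i j. i < j \<Longrightarrow> j < length us \<Longrightarrow> us ! i = us ! j \<Longrightarrow> F us = 0"
    using F unfolding alternating_maps_def by blast+
  have "F (map L us) = 0" if "i < j" "j < length us" "us ! i = us ! j" for us i j
    using F'(2)[of i j "map L us"] that by simp
  then show ?thesis
    using multilinear_pullback[OF F'(1) L V' T] T(3) unfolding alternating_maps_def by auto
qed

text \<open>The factor \<open>c\<close> leaves room for the value of a cut-off function at the point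
  in question.\<close>

lemma Sym_pullback:
  assumes S: "S \<in> Sym q V" and L: "linear_map_on (dual_space V') L" "L ` dual_space V' \<subseteq> dual_space V"
  shows "(\<lambda>\<psi>s. if set \<psi>s \<subseteq> dual_space V' then c * S (map L \<psi>s) else 0) \<in> Sym q V'"
proof -
  have S': "S \<in> multilinear_maps q (dual_space V) UNIV" "\<And>us ws. mset us = mset ws \<Longrightarrow> S us = S ws"
    using S unfolding Sym_def by blast+
  have "(\<lambda>\<psi>s. if set \<psi>s \<subseteq> dual_space V' then c * S (map L \<psi>s) else 0) \<in> multilinear_maps q (dual_space V') UNIV"
    by (rule multilinear_pullback[OF S'(1) L subspace_dual_space]) (auto simp: linear_map_on_def algebra_simps)
  moreover have "(if set us \<subseteq> dual_space V' then c * S (map L us) else 0) = (if set ws \<subseteq> dual_space V' then c * S (map L ws) else 0)"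
    if "mset us = mset ws" for us ws
  proof -
    have "S (map L us) = S (map L ws)" using that by (intro S'(2)) simp
    then show ?thesis using mset_eq_setD[OF that] by simp
  qed
  ultimately show ?thesis unfolding Sym_def by blast
qed

lemma zero_in_Sym: "0 \<in> Sym q V"
  by (auto simp: Sym_def multilinear_maps_def linear_map_on_def)

lemma zero_in_alternating: "0 \<in> W \<Longrightarrow> 0 \<in> alternating_maps p V W"
  by (auto simp: alternating_maps_def multilinear_maps_def linear_map_on_def)


section \<open>Forms with a prescribed value at a point\<close>

text \<open>The chart frame at the unit with the chart forgotten: evaluation at the
  \<open>k b\<close> gives the coefficient functionals.\<close>

lemma (in smooth_principal_bundle) lie_frame:
  "\<exists>(B::'eg set) k E. finite B \<and> (\<forall>b. k b \<in> smooth_functions (grp P)) \<and> (\<forall>b. E b \<in> lie_algebra P) \<and>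
    (\<forall>X\<in>lie_algebra P. X = (\<Sum>b\<in>B. X (k b) *\<^sub>R E b))"
proof -
  obtain U \<phi> where U: "(U, \<phi>) \<in> grp P" "gunit P \<in> U" using atlas_cover[OF atlases(3)] .
  obtain B :: "'eg set" where B: "onb B" using atlas_onb[OF atlases(3)] by blast
  obtain k where k: "(\<forall>b. k b \<in> smooth_functions (grp P) \<and> k b (gunit P) = 0) \<and>
     (\<forall>X\<in>lie_algebra P. X = (\<Sum>b\<in>B. X (k b) *\<^sub>R chart_deriv (grp P) U \<phi> (gunit P) b))"
    using tangent_frame[OF atlases(3) compact_group U B] by (rule exE)
  have "\<forall>b. chart_deriv (grp P) U \<phi> (gunit P) b \<in> lie_algebra P"
    using chart_deriv_tangent[OF atlases(3) U] by blast
  then show ?thesis using k B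
    by (intro exI[of _ B] exI[of _ k] exI[of _ "chart_deriv (grp P) U \<phi> (gunit P)"]) (simp add: onb_def)
qed

text \<open>Expanding the argument \<open>X\<close> in the frame writes the moving covector as a sum
  of the fixed covectors \<open>X \<mapsto> X (k b)\<close>, with the coefficients
  \<open>\<phi> (Ad P (ginv P (\<Phi> p)) (E b))\<close>; what remains is that these depend smoothly
  on \<open>p\<close>.\<close>

lemma (in smooth_principal_bundle) dual_Ad_curve:
  assumes \<phi>: "\<phi> \<in> dual_space (lie_algebra P)"
    and \<Phi>: "\<And>p. p \<in> K \<Longrightarrow> smooth_at (total P) (grp P) \<Phi> p"
  shows "curve_in {f. \<forall>p\<in>K. smooth_at (total P) std_atlas f p} (dual_space (lie_algebra P))
    (\<lambda>p X. if X \<in> lie_algebra P then \<phi> (Ad P (ginv P (\<Phi> p)) X) else 0)"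
proof -
  let ?C = "{f. \<forall>p\<in>K. smooth_at (total P) std_atlas f p}" and ?L = "lie_algebra P"
  obtain B :: "'eg set" and k E where B: "finite B" and k: "\<forall>b. k b \<in> smooth_functions (grp P)"
    and E: "\<forall>b. E b \<in> ?L" and frame: "\<forall>X\<in>?L. X = (\<Sum>b\<in>B. X (k b) *\<^sub>R E b)"
    using lie_frame by (elim exE conjE) (rule that)
  have \<phi>lin: "\<phi> (\<Sum>b\<in>B. c b *\<^sub>R X b) = (\<Sum>b\<in>B. c b * \<phi> (X b))" if "\<And>b. X b \<in> ?L" for c X
    using linear_map_on_sum[OF subspace_tangent B, of "grp P" "gunit P" \<phi> X c] \<phi> that
    by (simp add: dual_space_def)
  have Adlin: "linear_map_on ?L (Ad P g)" for g
    by (simp add: linear_map_on_def Ad_def pushforward_add pushforward_scaleR)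
  have exp: "\<phi> (Ad P g X) = (\<Sum>b\<in>B. X (k b) * \<phi> (Ad P g (E b)))" if X: "X \<in> ?L" for g X
  proof -
    have "Ad P g X = Ad P g (\<Sum>b\<in>B. X (k b) *\<^sub>R E b)" using frame X by (metis (no_types))
    also have "\<dots> = (\<Sum>b\<in>B. X (k b) *\<^sub>R Ad P g (E b))"
      by (rule linear_map_on_sum[OF subspace_tangent B Adlin]) (use E in blast)
    finally have "Ad P g X = (\<Sum>b\<in>B. X (k b) *\<^sub>R Ad P g (E b))" .
    then show ?thesis using \<phi>lin[of "\<lambda>b. Ad P g (E b)" "\<lambda>b. X (k b)"] Ad_lie E by simp
  qed
  let ?E = "\<lambda>b X. if X \<in> ?L then X (k b) else 0"
  have Ed: "?E b \<in> dual_space ?L" for b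
    using subspace_add[OF subspace_tangent, of _ "grp P" "gunit P"] subspace_scale[OF subspace_tangent, of _ "grp P" "gunit P"]
    by (auto simp: dual_space_def linear_map_on_def scaleR_fun_def[where ?'a = "'g \<Rightarrow> real"])
  have "(\<lambda>p. \<phi> (Ad P (ginv P (\<Phi> p)) (E b))) \<in> ?C" for b
  proof (intro CollectI ballI)
    fix p assume p: "p \<in> K"
    \<comment> \<open>An abstract functional \<phi> gives no direct access to smoothness. A second
      expansion, now of \<open>Ad P g (E b)\<close>, reduces it to evaluations on the functions
      \<open>k d\<close>, where \<open>Ad_smooth\<close> applies.\<close>
    have "(\<lambda>g. \<phi> (Ad P g (E b))) = (\<lambda>g. \<Sum>d\<in>B. Ad P g (E b) (k d) * \<phi> (E d))"
    proof
      fix g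
      have "Ad P g (E b) \<in> ?L" using Ad_lie E by blast
      then have "Ad P g (E b) = (\<Sum>d\<in>B. Ad P g (E b) (k d) *\<^sub>R E d)" using frame by blast
      then have "\<phi> (Ad P g (E b)) = \<phi> (\<Sum>d\<in>B. Ad P g (E b) (k d) *\<^sub>R E d)" by (rule arg_cong)
      then show "\<phi> (Ad P g (E b)) = (\<Sum>d\<in>B. Ad P g (E b) (k d) * \<phi> (E d))" using \<phi>lin E by simp
    qed
    moreover have "(\<lambda>g. \<Sum>d\<in>B. Ad P g (E b) (k d) * \<phi> (E d)) \<in> smooth_functions (grp P)"
      using Ad_smooth E k
      by (intro smooth_functions_sum[OF atlases(3)] smooth_functions_mult[OF atlases(3)] smooth_functions_const[OF atlases(3)]) auto
    ultimately have "smooth_at (grp P) std_atlas (\<lambda>g. \<phi> (Ad P g (E b))) (ginv P (\<Phi> p))"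
      by (simp add: smooth_functions_iff)
    from smooth_at_compose[OF atlases(2,3) smooth_atlas_real smooth_at_compose[OF atlases(2,3,3) \<Phi>[OF p] smooth_at_ginv] this]
    show "smooth_at (total P) std_atlas (\<lambda>p. \<phi> (Ad P (ginv P (\<Phi> p)) (E b))) p" .
  qed
  then have "curve_in ?C (dual_space ?L) (\<lambda>p. \<Sum>b\<in>B. \<phi> (Ad P (ginv P (\<Phi> p)) (E b)) *\<^sub>R ?E b)"
    using Ed by (intro curve_in_sum)
  also have "(\<lambda>p. \<Sum>b\<in>B. \<phi> (Ad P (ginv P (\<Phi> p)) (E b)) *\<^sub>R ?E b) =
      (\<lambda>p X. if X \<in> ?L then \<phi> (Ad P (ginv P (\<Phi> p)) X) else 0)"
    by (intro ext) (simp add: sum_fun_apply scaleR_fun_def[where ?'a = "'g tangent"] exp mult.commute)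
  finally show ?thesis .
qed

lemma function_algebra_smooth:
  "smooth_atlas A \<Longrightarrow> function_algebra {f. \<forall>p\<in>K. smooth_at A std_atlas (f :: _ \<Rightarrow> real) p}"
  by (auto simp: function_algebra_def intro: smooth_at_const smooth_at_add smooth_at_mult smooth_atlas_real)

text \<open>Near \<open>x0\<close> take \<open>\<omega> y = \<eta> y\<close> times the pullback of \<open>F\<close> along \<open>A\<close>, which sends a vector at \<open>y\<close> to
  the one at \<open>x0\<close> with the same derivatives of the frame coordinates \<open>h\<close>, and along \<open>\<Theta> y\<close>, which
  identifies the coadjoint fibres over \<open>y\<close> and \<open>x0\<close> by the local section \<open>\<sigma>\<close>.\<close>

lemma (in smooth_principal_bundle) form_through:
  assumes F: "F \<in> form_fibre P r q x0"
  shows "\<exists>\<omega>\<in>forms P r q. \<omega> x0 = F"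
proof -
  obtain U \<sigma> \<Phi> where U: "open U" "x0 \<in> U"
    and \<sigma>: "\<forall>y\<in>U. smooth_at (base P) (total P) \<sigma> y \<and> proj P (\<sigma> y) = y"
    and \<Phi>: "\<forall>p. proj P p \<in> U \<longrightarrow> smooth_at (total P) (grp P) \<Phi> p \<and> act P (\<sigma> (proj P p)) (\<Phi> p) = p"
    using local_section[of x0] by (elim exE conjE) (rule that)
  have proj\<sigma>: "proj P (\<sigma> y) = y" if "y \<in> U" for y using \<sigma> that by blast
  obtain V0 \<phi> where V0: "(V0, \<phi>) \<in> base P" "x0 \<in> V0" using atlas_cover[OF atlases(1)] .
  obtain B :: "'em set" where B: "onb B" using atlas_onb[OF atlases(1)] by blast
  let ?T = "tangent_space (base P)" and ?e = "chart_deriv (base P) V0 \<phi> x0"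
  obtain h where "(\<forall>b. h b \<in> smooth_functions (base P) \<and> h b x0 = 0) \<and> (\<forall>v\<in>?T x0. v = (\<Sum>b\<in>B. v (h b) *\<^sub>R ?e b))"
    using tangent_frame[OF atlases(1) compact_base V0 B] by (rule exE)
  then have h: "h b \<in> smooth_functions (base P)" and frame: "v \<in> ?T x0 \<Longrightarrow> (\<Sum>b\<in>B. v (h b) *\<^sub>R ?e b) = v" for b v
    by auto
  have eT: "?e b \<in> ?T x0" for b by (rule chart_deriv_tangent[OF atlases(1) V0])
  define A where "A = (\<lambda>v :: 'm tangent. \<Sum>b\<in>B. v (h b) *\<^sub>R ?e b)"
  have Alin: "linear_map_on V A" for V
    unfolding linear_map_on_def
  proof (intro conjI ballI allI)
    have "(u + w) (h b) = u (h b) + w (h b)" for u w :: "'m tangent" and b by simp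
    then show "A (u + w) = A u + A w" for u w
      unfolding A_def by (simp only: scaleR_add_left sum.distrib)
    have "(c *\<^sub>R u) (h b) = c * u (h b)" for c and u :: "'m tangent" and b by (simp add: scaleR_fun_def)
    then show "A (c *\<^sub>R u) = c *\<^sub>R A u" for c u
      unfolding A_def scaleR_sum_right scaleR_scaleR by (simp only:)
  qed
  have AT: "A v \<in> ?T x0" for v unfolding A_def by (intro subspace_sum subspace_scale subspace_tangent eT)
  obtain \<eta> K where \<eta>: "\<eta> \<in> smooth_functions (base P)" "\<eta> x0 = 1" and K: "closed K" "K \<subseteq> U" "\<And>y. y \<notin> K \<Longrightarrow> \<eta> y = 0"
    using bump_exists[OF atlases(1) compact_base U] by blast
  define \<Theta> where "\<Theta> = (\<lambda>y \<psi>. from_frame P (\<sigma> x0) (to_frame P (\<sigma> y) \<psi>))"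
  have \<Theta>lin: "linear_map_on V (\<Theta> y)" for V y
    using linear_map_on_from_frame[of UNIV P "\<sigma> x0"] linear_map_on_to_frame[of UNIV P "\<sigma> y"]
    by (simp add: linear_map_on_def \<Theta>_def)
  have \<Theta>in: "\<Theta> y ` coad_fibre P y \<subseteq> coad_fibre P x0" if "y \<in> U" for y
  proof safe
    fix \<psi> assume "\<psi> \<in> coad_fibre P y"
    then have "to_frame P (\<sigma> y) \<psi> \<in> dual_space (lie_algebra P)" using to_frame_dual[of \<psi> "\<sigma> y"] proj\<sigma>[OF that] by simp
    from from_frame_dual[OF this, of "\<sigma> x0"] show "\<Theta> y \<psi> \<in> coad_fibre P x0" using proj\<sigma>[OF U(2)] by (simp add: \<Theta>_def)
  qed
  define T where "T = (\<lambda>y S \<psi>s. if set \<psi>s \<subseteq> coad_fibre P y then \<eta> y * S (map (\<Theta> y) \<psi>s) else (0::real))"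
  define \<omega> where "\<omega> = (\<lambda>y vs. if set vs \<subseteq> ?T y then T y (F (map A vs)) else 0)"
  have F': "F \<in> multilinear_maps r (?T x0) (Sym_ad P q x0)"
    using F unfolding form_fibre_def alternating_maps_def by blast
  have T0: "T y 0 = 0" for y by (simp add: T_def fun_eq_iff)
  have \<omega>form: "\<omega> y \<in> form_fibre P r q y" for y
  proof (cases "y \<in> U")
    case True
    have "T y ` Sym_ad P q x0 \<subseteq> Sym_ad P q y"
      using Sym_pullback[OF _ \<Theta>lin \<Theta>in[OF True]] by (auto simp: T_def)
    moreover have "linear_map_on (Sym_ad P q x0) (T y)"
      by (auto simp: linear_map_on_def T_def fun_eq_iff scaleR_fun_def algebra_simps)
    ultimately show ?thesis
      unfolding form_fibre_def \<omega>_def using F AT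
      by (intro alternating_pullback[of F r "?T x0" "Sym_ad P q x0" "?T y" A "T y" "Sym_ad P q y", OF _ Alin _ subspace_tangent _ _ T0])
        (auto simp: form_fibre_def)
  next
    case False
    \<comment> \<open>Over points outside \<open>U\<close> the section, and with it the
      identification of fibres, has no meaning; the vanishing cut-off hides this.\<close>
    then have "\<eta> y = 0" using K by blast
    then have "\<omega> y = 0" by (simp add: \<omega>_def T_def fun_eq_iff)
    then show ?thesis unfolding form_fibre_def by (simp only: zero_in_alternating[OF zero_in_Sym])
  qed
  have \<omega>x: "\<omega> x0 = F"
  proof (intro ext)
    fix vs \<psi>s
    show "\<omega> x0 vs \<psi>s = F vs \<psi>s"
    proof (cases "length vs = r \<and> set vs \<subseteq> ?T x0")
      case vs: True
      then have mapA: "map A vs = vs" using frame by (intro map_idI) (auto simp: A_def)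
      show ?thesis
      proof (cases "set \<psi>s \<subseteq> coad_fibre P x0")
        case True
        have "\<Theta> x0 \<psi> = \<psi>" if "\<psi> \<in> set \<psi>s" for \<psi>
          using from_to_frame[of \<psi> "\<sigma> x0"] that True proj\<sigma>[OF U(2)] by (auto simp: \<Theta>_def)
        then have "map (\<Theta> x0) \<psi>s = \<psi>s" by (intro map_idI)
        then show ?thesis using vs mapA True \<eta>(2) by (simp add: \<omega>_def T_def)
      next
        case False
        have "F vs \<in> multilinear_maps q (coad_fibre P x0) UNIV"
          using multilinear_in[OF F'] vs unfolding Sym_def by blast
        then have "F vs \<psi>s = 0" using multilinear_out False by blast
        then show ?thesis using vs False by (simp add: \<omega>_def T_def)
      qed
    next
      case False
      then have "F vs = 0" using multilinear_out[OF F'] by blast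
      moreover have "\<omega> x0 vs = 0"
        using multilinear_out[of "\<omega> x0" r _ _ vs] \<omega>form[of x0] False unfolding form_fibre_def alternating_maps_def by blast
      ultimately show ?thesis by simp
    qed
  qed
  \<comment> \<open>Sections of the symmetric powers are tested on the total space, so the closed
    set of the cut-off is pulled back there.\<close>
  let ?K = "proj P -` K"
  let ?C = "{f. \<forall>p\<in>?K. smooth_at (total P) std_atlas (f :: 'p \<Rightarrow> real) p}"
  have C: "function_algebra ?C" by (rule function_algebra_smooth[OF atlases(2)])
  have "continuous_on UNIV (proj P)" using principal by (simp add: principal_bundle_def smooth_map_on_def)
  then have clK: "closed ?K" using K(1) by (intro closed_vimage)
  have K\<Phi>: "smooth_at (total P) (grp P) \<Phi> p" "act P (\<sigma> (proj P p)) (\<Phi> p) = p" if "p \<in> ?K" for p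
    using \<Phi> that K by auto
  have "(\<lambda>x. \<omega> x (map (\<lambda>X. X x) Xs)) \<in> Sym_ad_sections P q"
    if Xs: "length Xs = r" "set Xs \<subseteq> vector_fields (base P)" for Xs
    unfolding Sym_ad_sections_def
  proof (intro CollectI conjI allI impI)
    have XT: "set (map (\<lambda>X. X x) Xs) \<subseteq> ?T x" for x using Xs by (auto simp: vector_fields_def)
    have \<omega>': "\<omega> x \<in> multilinear_maps r (?T x) (Sym_ad P q x)" for x
      using \<omega>form[of x] unfolding form_fibre_def alternating_maps_def by blast
    show "\<omega> x (map (\<lambda>X. X x) Xs) \<in> Sym_ad P q x" for x
      by (rule multilinear_in[OF \<omega>' _ XT]) (use Xs in simp)
    fix \<phi>s :: "('g tangent \<Rightarrow> real) list"
    assume \<phi>s: "length \<phi>s = q \<and> set \<phi>s \<subseteq> dual_space (lie_algebra P)"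
    \<comment> \<open>Seen from \<open>p\<close>, all arguments become curves in spaces over the
      single point \<open>x0\<close>: \<open>us\<close> collects the transported tangent vectors,
      \<open>\<psi>s\<close> the transported covectors. The fixed form \<open>F\<close> is then
      evaluated on these curves.\<close>
    define us where "us = map (\<lambda>X p. A (X (proj P p))) Xs"
    define \<psi>s where "\<psi>s = map (\<lambda>\<phi> p. from_frame P (\<sigma> x0) (\<lambda>X. if X \<in> lie_algebra P then \<phi> (Ad P (ginv P (\<Phi> p)) X) else 0)) \<phi>s"
    have us: "curve_in ?C (?T x0) u" if u: "u \<in> set us" for u
    proof -
      obtain X where X: "X \<in> vector_fields (base P)" "u = (\<lambda>p. A (X (proj P p)))"
        using u Xs by (auto simp: us_def)
      have "(\<lambda>p. X (proj P p) (h b)) \<in> ?C" for b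
        using smooth_functions_proj[of "\<lambda>x. X x (h b)"] X(1) h by (auto simp: vector_fields_def smooth_functions_iff)
      then show ?thesis unfolding X(2) A_def by (intro curve_in_sum eT)
    qed
    have \<psi>s: "curve_in ?C (coad_fibre P x0) u" if u: "u \<in> set \<psi>s" for u
    proof -
      obtain \<phi> where \<phi>: "\<phi> \<in> dual_space (lie_algebra P)"
        "u = (\<lambda>p. from_frame P (\<sigma> x0) (\<lambda>X. if X \<in> lie_algebra P then \<phi> (Ad P (ginv P (\<Phi> p)) X) else 0))"
        using u \<phi>s by (auto simp: \<psi>s_def)
      show ?thesis unfolding \<phi>(2)
        by (rule curve_in_linear[OF linear_map_on_from_frame _ dual_Ad_curve[OF \<phi>(1) K\<Phi>(1)]])
          (use from_frame_dual[of _ "\<sigma> x0"] proj\<sigma>[OF U(2)] in auto)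
    qed
    define G where "G = (\<lambda>p. F (map (\<lambda>u. u p) us) (map (\<lambda>u. u p) \<psi>s))"
    have "curve_in ?C (Sym_ad P q x0) (\<lambda>p. F (map (\<lambda>u. u p) us))"
      by (rule curve_in_multilinear[OF C subspace_tangent _ us]) (use F' Xs in \<open>simp add: us_def\<close>)
    then have "curve_in ?C (multilinear_maps (length \<psi>s) (coad_fibre P x0) UNIV) (\<lambda>p. F (map (\<lambda>u. u p) us))"
      by (rule curve_in_mono) (use \<phi>s in \<open>auto simp: Sym_def \<psi>s_def\<close>)
    from curve_in_apply[OF C subspace_dual_space this \<psi>s] have G: "G \<in> ?C" unfolding G_def .
    have "(\<lambda>p. \<eta> (proj P p) * G p) \<in> smooth_functions (total P)"
      by (rule smooth_extend_by_zero[OF atlases(2) smooth_functions_proj[OF \<eta>(1)] clK]) (use K G in auto)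
    also have "(\<lambda>p. \<eta> (proj P p) * G p) = (\<lambda>p. \<omega> (proj P p) (map (\<lambda>X. X (proj P p)) Xs) (map (from_frame P p) \<phi>s))"
    proof
      fix p
      show "\<eta> (proj P p) * G p = \<omega> (proj P p) (map (\<lambda>X. X (proj P p)) Xs) (map (from_frame P p) \<phi>s)"
      proof (cases "p \<in> ?K")
        case True
        \<comment> \<open>Here \<open>p\<close> is written as the translate of
          \<open>\<sigma> (proj P p)\<close> by \<open>\<Phi> p\<close>; passing from the frame at
          \<open>p\<close> to the one on the section produces the coadjoint action.\<close>
        have "\<Theta> (proj P p) (from_frame P p \<phi>) = from_frame P (\<sigma> x0) (\<lambda>X. if X \<in> lie_algebra P then \<phi> (Ad P (ginv P (\<Phi> p)) X) else 0)"
          if "\<phi> \<in> set \<phi>s" for \<phi>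
          using to_from_frame_act[of \<phi> "\<sigma> (proj P p)" "\<Phi> p"] that \<phi>s K\<Phi>(2)[OF True] by (auto simp: \<Theta>_def)
        then have 1: "map (\<Theta> (proj P p)) (map (from_frame P p) \<phi>s) = map (\<lambda>u. u p) \<psi>s" by (simp add: \<psi>s_def)
        have 2: "map A (map (\<lambda>X. X (proj P p)) Xs) = map (\<lambda>u. u p) us" by (simp add: us_def)
        have 3: "set (map (from_frame P p) \<phi>s) \<subseteq> coad_fibre P (proj P p)" using \<phi>s from_frame_dual by auto
        show ?thesis unfolding \<omega>_def T_def G_def using XT[of "proj P p"] 3 by (simp only: 1 2 if_True)
      next
        case False
        then have "\<eta> (proj P p) = 0" using K(3) by simp
        then show ?thesis by (simp add: \<omega>_def T_def)
      qed
    qed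
    finally show "(\<lambda>p. \<omega> (proj P p) (map (\<lambda>X. X (proj P p)) Xs) (map (from_frame P p) \<phi>s)) \<in> smooth_functions (total P)" .
  qed
  then have "\<omega> \<in> forms P r q" using \<omega>form unfolding forms_def by blast
  then show ?thesis using \<omega>x by blast
qed


section \<open>The wedge product with a covector\<close>

lemma length_omit: "i < length us \<Longrightarrow> length (omit i us) = length us - 1"
  by (simp add: omit_def)

lemma set_omit: "i < length us \<Longrightarrow> set us = insert (us ! i) (set (omit i us))"
  by (subst id_take_nth_drop[of i us]) (auto simp: omit_def)

lemma map_omit: "map f (omit i us) = omit i (map f us)"
  by (simp add: omit_def take_map drop_map)

lemma omit_update_same: "omit i (us[i := u]) = omit i us"
  by (simp add: omit_def)

lemma omit_update_other:
  assumes "i \<noteq> k" "i < length us" "k < length us"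
  shows "omit i (us[k := u]) = (omit i us)[(if k < i then k else k - 1) := u]"
proof (rule nth_equalityI)
  fix l assume "l < length (omit i (us[k := u]))"
  then have l: "l < length us - 1" using assms by (simp add: length_omit)
  have nth: "omit i ws ! l = (if l < i then ws ! l else ws ! Suc l)" if "length ws = length us" for ws :: "'a list"
    using l assms(2) that by (auto simp: omit_def nth_append min_def)
  show "omit i (us[k := u]) ! l = (omit i us)[(if k < i then k else k - 1) := u] ! l"
    using l assms nth[of us] nth[of "us[k := u]"] by (auto simp: nth_list_update length_omit)
qed (use assms in \<open>simp add: length_omit\<close>)

lemma scaleR_fun_apply: "(c *\<^sub>R f) x = c *\<^sub>R f x"
  by (simp add: scaleR_fun_def)

lemma subspace_multilinear: "subspace W \<Longrightarrow> subspace (multilinear_maps n V W)"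
  unfolding subspace_def multilinear_maps_def linear_map_on_def
  by (simp add: scaleR_fun_apply algebra_simps)

lemma subspace_Sym: "subspace (Sym q V)"
proof -
  have "Sym q V = multilinear_maps q (dual_space V) UNIV \<inter> {s. \<forall>us ws. mset us = mset ws \<longrightarrow> s us = s ws}"
    by (auto simp: Sym_def)
  moreover have "subspace {s :: 'a sym. \<forall>us ws. mset us = mset ws \<longrightarrow> s us = s ws}"
  proof (intro subspaceI CollectI allI impI)
    fix us ws :: "('a \<Rightarrow> real) list" assume m: "mset us = mset ws"
    show "(0 :: 'a sym) us = 0 ws" by simp
    fix s t :: "'a sym" and c
    assume "s \<in> {s. \<forall>us ws. mset us = mset ws \<longrightarrow> s us = s ws}"
    then have s: "s us = s ws" using m by blast
    then show "(c *\<^sub>R s) us = (c *\<^sub>R s) ws" by (simp only: scaleR_fun_apply)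
    assume "t \<in> {s. \<forall>us ws. mset us = mset ws \<longrightarrow> s us = s ws}"
    then have "t us = t ws" using m by blast
    then show "(s + t) us = (s + t) ws" using s by (simp only: plus_fun_apply)
  qed
  ultimately show ?thesis using subspace_inter[OF subspace_multilinear[OF subspace_UNIV]] by simp
qed

text \<open>Polarisation: expand \<open>F\<close> with \<open>a + b\<close> in both neighbouring
  slots; it vanishes there and on the two diagonal terms.\<close>

lemma alternating_swap:
  assumes F: "F \<in> alternating_maps n V W" and V: "subspace V"
    and "length xs + Suc (Suc (length ys)) = n" "set xs \<subseteq> V" "set ys \<subseteq> V" "a \<in> V" "b \<in> V"
  shows "F (xs @ a # b # ys) = - F (xs @ b # a # ys)"
proof -
  have F': "F \<in> multilinear_maps n V W" and alt: "\<And>us i j. i < j \<Longrightarrow> j < length us \<Longrightarrow> us ! i = us ! j \<Longrightarrow> F us = 0"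
    using F unfolding alternating_maps_def by blast+
  have z: "F (xs @ c # c # ys) = 0" for c
    by (rule alt[of "length xs" "Suc (length xs)"]) (auto simp: nth_append)
  have ab: "a + b \<in> V" using V assms by (simp add: subspace_add)
  have "F (xs @ (a + b) # (a + b) # ys) = F (xs @ a # (a + b) # ys) + F (xs @ b # (a + b) # ys)"
    by (rule multilinear_slot(1)[OF F']) (use assms ab in auto)
  also have "F (xs @ a # (a + b) # ys) = F (xs @ a # a # ys) + F (xs @ a # b # ys)"
    using multilinear_slot(1)[OF F', of "xs @ [a]" ys a b] assms by simp
  also have "F (xs @ b # (a + b) # ys) = F (xs @ b # a # ys) + F (xs @ b # b # ys)"
    using multilinear_slot(1)[OF F', of "xs @ [b]" ys a b] assms by simp
  finally show ?thesis using z by (simp add: eq_neg_iff_add_eq_0)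
qed

text \<open>\<open>a\<close> passes the entries of \<open>zs\<close> one at a time, each
  transposition of neighbours costing a sign.\<close>

lemma alternating_move:
  assumes F: "F \<in> alternating_maps n V W" and V: "subspace V"
    and "length xs + Suc (length zs + length ys) = n" "set xs \<subseteq> V" "set zs \<subseteq> V" "set ys \<subseteq> V" "a \<in> V"
  shows "F (xs @ zs @ a # ys) = (- 1) ^ length zs *\<^sub>R F (xs @ a # zs @ ys)"
  using assms(3-)
proof (induction zs arbitrary: xs)
  case (Cons b zs)
  have "F (xs @ (b # zs) @ a # ys) = (- 1) ^ length zs *\<^sub>R F (xs @ b # a # zs @ ys)"
    using Cons.IH[of "xs @ [b]"] Cons.prems by simp
  also have "F (xs @ b # a # zs @ ys) = - F (xs @ a # b # zs @ ys)"
    by (rule alternating_swap[OF F V]) (use Cons.prems in auto)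
  finally show ?case by simp
qed simp

lemma linear_map_on_combination:
  assumes "\<And>i. i \<in> I \<Longrightarrow> linear_map_on V (L i)"
  shows "linear_map_on V (\<lambda>u. \<Sum>i\<in>I. c i *\<^sub>R L i u)"
  unfolding linear_map_on_def
proof (intro conjI ballI allI)
  fix u assume u: "u \<in> V"
  show "(\<Sum>i\<in>I. c i *\<^sub>R L i (u + w)) = (\<Sum>i\<in>I. c i *\<^sub>R L i u) + (\<Sum>i\<in>I. c i *\<^sub>R L i w)" if "w \<in> V" for w
    unfolding sum.distrib[symmetric]
    by (rule sum.cong) (use assms u that in \<open>simp_all add: linear_map_on_def scaleR_add_right\<close>)
  show "(\<Sum>i\<in>I. c i *\<^sub>R L i (k *\<^sub>R u)) = k *\<^sub>R (\<Sum>i\<in>I. c i *\<^sub>R L i u)" for k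
    unfolding scaleR_sum_right
    by (rule sum.cong) (use assms u in \<open>simp_all add: linear_map_on_def mult.commute\<close>)
qed

text \<open>Summand by summand: either the removed entry lies outside \<open>V\<close> and \<xi>
  kills it, or the remaining list is still outside the domain of \<open>F\<close>.\<close>

lemma wedge_outside:
  assumes \<xi>: "\<xi> \<in> dual_space V" and F: "F \<in> multilinear_maps n V W" and us: "length us \<noteq> Suc n \<or> \<not> set us \<subseteq> V"
  shows "wedge \<xi> F us = 0"
proof -
  have "(\<xi> (us ! i)) *\<^sub>R F (omit i us) = 0" if i: "i < length us" for i
  proof (cases "us ! i \<in> V")
    case True
    then have "length (omit i us) \<noteq> n \<or> \<not> set (omit i us) \<subseteq> V"
      using us i set_omit[OF i] by (auto simp: length_omit)
    then show ?thesis using multilinear_out[OF F] by simp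
  next
    case False
    then show ?thesis using \<xi> by (simp add: dual_space_def)
  qed
  then show ?thesis unfolding wedge_def by (intro sum.neutral) (simp add: scaleR_scaleR[symmetric] del: scaleR_scaleR)
qed

text \<open>If the entries \<open>i\<close> and \<open>j\<close> coincide, every summand that
  removes another entry vanishes, since the repetition survives. The two remaining summands cancel:
  their lists differ by moving the repeated entry past the entries in between.\<close>

lemma wedge_alternating:
  assumes \<xi>: "\<xi> \<in> dual_space V" and F: "F \<in> alternating_maps n V W" and V: "subspace V" and W: "subspace W"
  shows "wedge \<xi> F \<in> alternating_maps (Suc n) V W"
proof -
  have F': "F \<in> multilinear_maps n V W" and alt: "\<And>us i j. i < j \<Longrightarrow> j < length us \<Longrightarrow> us ! i = us ! j \<Longrightarrow> F us = 0"
    using F unfolding alternating_maps_def by blast+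
  have om: "length (omit i us) = n" "set (omit i us) \<subseteq> V" if "length us = Suc n" "set us \<subseteq> V" "i < length us" for us i
    using that set_omit[of i us] by (auto simp: length_omit)
  have ml: "wedge \<xi> F \<in> multilinear_maps (Suc n) V W"
    unfolding multilinear_maps_def
  proof (intro CollectI conjI allI impI)
    fix us assume us: "length us = Suc n \<and> set us \<subseteq> V"
    show "wedge \<xi> F us \<in> W" unfolding wedge_def
      using us om by (intro subspace_sum[OF W] subspace_scale[OF W] multilinear_in[OF F']) auto
    fix k assume k: "k < Suc n"
    \<comment> \<open>Slot \<open>k\<close> enters the \<open>i\<close>-th summand through \<xi> if
      \<open>i = k\<close>, and otherwise through exactly one slot of \<open>F\<close>, so each
      summand is linear in it.\<close>
    have lin: "linear_map_on V (\<lambda>u. (\<xi> (us[k := u] ! i)) *\<^sub>R F (omit i (us[k := u])))" if i: "i < length us" for i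
    proof (cases "i = k")
      case True
      then show ?thesis using \<xi> us k
        by (auto simp: omit_update_same linear_map_on_def dual_space_def scaleR_add_left)
    next
      case False
      let ?k = "if k < i then k else k - 1"
      have "?k < n" using False i k us by auto
      then have "linear_map_on V (\<lambda>u. F ((omit i us)[?k := u]))"
        using F' om[OF _ _ i] us unfolding multilinear_maps_def by blast
      then show ?thesis using False i k us omit_update_other[OF False i]
        by (simp add: linear_map_on_def scaleR_add_right)
    qed
    have "linear_map_on V (\<lambda>u. \<Sum>i<length us. (- 1) ^ i *\<^sub>R ((\<xi> (us[k := u] ! i)) *\<^sub>R F (omit i (us[k := u]))))"
      using lin by (intro linear_map_on_combination) simp
    then show "linear_map_on V (\<lambda>u. wedge \<xi> F (us[k := u]))" by (simp add: wedge_def)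
  next
    fix us assume "\<not> (length us = Suc n \<and> set us \<subseteq> V)"
    then show "wedge \<xi> F us = 0" using wedge_outside[OF \<xi> F'] by blast
  qed
  moreover have "wedge \<xi> F us = 0" if ij: "i < j" "j < length us" "us ! i = us ! j" for us i j
  proof (cases "length us = Suc n \<and> set us \<subseteq> V")
    case False
    then show ?thesis using wedge_outside[OF \<xi> F'] by blast
  next
    case us: True
    define xs zs ys a where "xs = take i us" and "zs = take (j - Suc i) (drop (Suc i) us)" and "ys = drop (Suc j) us" and "a = us ! i"
    have d1: "drop (Suc i) us = zs @ a # ys"
    proof -
      have "drop (Suc i) us = zs @ drop (j - Suc i) (drop (Suc i) us)"
        unfolding zs_def by (rule append_take_drop_id[symmetric])
      also have "drop (j - Suc i) (drop (Suc i) us) = drop j us" using ij by simp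
      also have "drop j us = us ! j # ys" using ij by (simp add: ys_def Cons_nth_drop_Suc)
      finally show ?thesis using ij by (simp add: a_def)
    qed
    have u: "us = xs @ a # zs @ a # ys"
      using id_take_nth_drop[of i us] ij d1 by (simp add: xs_def a_def)
    have li: "length xs = i" "length zs = j - Suc i" using ij by (auto simp: xs_def zs_def)
    have oi: "omit i us = xs @ zs @ a # ys" by (simp add: omit_def d1 xs_def)
    have "take j us = take (length (xs @ a # zs)) ((xs @ a # zs) @ a # ys)"
      using arg_cong[OF u, of "take j"] li ij by simp
    also have "take (length ws) (ws @ a # ys) = ws" for ws by simp
    finally have oj: "omit j us = xs @ a # zs @ ys" by (simp add: omit_def ys_def)
    have sub: "set xs \<subseteq> V" "set zs \<subseteq> V" "set ys \<subseteq> V" "a \<in> V" using us arg_cong[OF u, of set] by auto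
    have len: "length xs + Suc (length zs + length ys) = n" using us arg_cong[OF u, of length] by simp
    have mv: "F (omit i us) = (- 1) ^ (j - Suc i) *\<^sub>R F (omit j us)"
      unfolding oi oj using alternating_move[OF F V len sub] li by simp
    let ?t = "\<lambda>k. ((- 1) ^ k * \<xi> (us ! k)) *\<^sub>R F (omit k us)"
    have zero: "?t k = 0" if k: "k < length us" "k \<noteq> i" "k \<noteq> j" for k
    proof -
      \<comment> \<open>The position of the old entry \<open>l\<close> once entry \<open>k\<close>
        is gone; it preserves the order of \<open>i\<close> and \<open>j\<close>.\<close>
      let ?s = "\<lambda>l. if l < k then l else l - 1"
      have nth: "omit k us ! ?s l = us ! l" if "l < length us" "l \<noteq> k" for l
        using that k by (auto simp: omit_def nth_append min_def)
      have "F (omit k us) = 0"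
        by (rule alt[of "?s i" "?s j"]) (use ij k nth[of i] nth[of j] in \<open>auto simp: length_omit\<close>)
      then show ?thesis by simp
    qed
    have "wedge \<xi> F us = (\<Sum>k\<in>{i, j}. ?t k)"
      unfolding wedge_def using ij zero by (intro sum.mono_neutral_right) auto
    also have "\<dots> = ?t i + ?t j" using ij by simp
    also have "\<dots> = (\<xi> a * ((- 1) ^ i * (- 1) ^ (j - Suc i) + (- 1) ^ j)) *\<^sub>R F (omit j us)"
      using ij(3) by (simp add: mv a_def algebra_simps)
    \<comment> \<open>Between the equal entries there are \<open>j - Suc i\<close> others, and
      \<open>i + (j - Suc i)\<close> is one less than \<open>j\<close>, so the signs are
      opposite.\<close>
    also have "(- 1) ^ i * (- 1) ^ (j - Suc i) + (- 1) ^ j = (0 :: real)"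
    proof -
      have "j = Suc (i + (j - Suc i))" using ij by simp
      then have "(- 1 :: real) ^ j = (- 1) ^ Suc (i + (j - Suc i))" by (rule arg_cong)
      also have "\<dots> = - ((- 1) ^ i * (- 1) ^ (j - Suc i))" by (simp only: power_Suc power_add mult_minus1)
      finally show ?thesis by simp
    qed
    finally show ?thesis by simp
  qed
  ultimately show ?thesis unfolding alternating_maps_def by blast
qed

section \<open>The principal symbol\<close>

text \<open>The horizontal lift acts as a derivation at \<open>p\<close> on the product of the
  pulled-back \<open>f\<close> with the section read in moving frames on the fixed covectors
  \<open>map (to_frame P p) \<psi>s\<close>. That second factor is smooth by the definition of a
  section, and at \<open>p\<close> it is \<open>s x \<psi>s\<close> because the two frame maps
  cancel.\<close>

lemma (in smooth_principal_bundle) Sym_ad_deriv_scale: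
  assumes conn: "principal_connection P" and s: "s \<in> Sym_ad_sections P q" and f: "f \<in> smooth_functions (base P)" "f x = 0"
    and v: "v \<in> tangent_space (base P) x"
  shows "Sym_ad_deriv P x v (\<lambda>y. f y *\<^sub>R s y) = v f *\<^sub>R s x"
proof
  fix \<psi>s
  define p where "p = (SOME p. proj P p = x)"
  obtain p0 where "x = proj P p0" using bundleD(2) by (rule surjE)
  then have px: "proj P p = x" unfolding p_def by (intro someI[of "\<lambda>p. proj P p = x" p0]) simp
  define w where "w = hlift P p v"
  have w: "w \<in> tangent_space (total P) p" "pushforward (base P) (proj P) w = v"
    using hlift_exists[OF conn, of v p] v px by (auto simp: w_def)
  have wf: "w (\<lambda>p. f (proj P p)) = v f" using fun_cong[OF w(2), of f] f(1) by (simp add: pushforward_def comp_def)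
  have sx: "s y \<in> multilinear_maps q (coad_fibre P y) UNIV" for y
    using s unfolding Sym_ad_sections_def Sym_def by blast
  have smooth: "(\<lambda>p. s (proj P p) (map (from_frame P p) \<phi>s)) \<in> smooth_functions (total P)"
    if "length \<phi>s = q \<and> set \<phi>s \<subseteq> dual_space (lie_algebra P)" for \<phi>s
    using s that unfolding Sym_ad_sections_def by blast
  show "Sym_ad_deriv P x v (\<lambda>y. f y *\<^sub>R s y) \<psi>s = (v f *\<^sub>R s x) \<psi>s"
  proof (cases "set \<psi>s \<subseteq> coad_fibre P x")
    case False
    then show ?thesis using multilinear_out[OF sx, of \<psi>s x] by (simp add: Sym_ad_deriv_def scaleR_fun_def)
  next
    case True
    define g where "g = (\<lambda>p'. s (proj P p') (map (from_frame P p' \<circ> to_frame P p) \<psi>s))"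
    have eq: "Sym_ad_deriv P x v (\<lambda>y. f y *\<^sub>R s y) \<psi>s = w (\<lambda>p'. f (proj P p') * g p')"
      using True by (simp add: Sym_ad_deriv_def p_def[symmetric] w_def g_def scaleR_fun_def)
    show ?thesis
    proof (cases "length \<psi>s = q")
      case False
      \<comment> \<open>A list of the wrong length makes the section vanish identically, and a
        derivation kills the zero function.\<close>
      then have "g = (\<lambda>_. 0)" "s x \<psi>s = 0" using multilinear_out[OF sx] by (auto simp: g_def)
      then show ?thesis unfolding eq using tangent_const[OF atlases(2) w(1)] by (simp add: scaleR_fun_def)
    next
      case len: True
      have "set (map (to_frame P p) \<psi>s) \<subseteq> dual_space (lie_algebra P)"
        using to_frame_dual[of _ p] True px by auto
      then have "(\<lambda>p'. s (proj P p') (map (from_frame P p') (map (to_frame P p) \<psi>s))) \<in> smooth_functions (total P)"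
        using len by (intro smooth) simp
      then have g: "g \<in> smooth_functions (total P)" by (simp add: g_def comp_def)
      have "map (from_frame P p \<circ> to_frame P p) \<psi>s = \<psi>s"
        using from_to_frame[of _ p] True px by (intro map_idI) auto
      then have gp: "g p = s x \<psi>s" by (simp add: g_def px)
      show ?thesis unfolding eq
        using tangentD(3)[OF w(1) smooth_functions_proj[OF f(1)] g] wf gp px f(2) by (simp add: scaleR_fun_def)
    qed
  qed
qed

lemma (in smooth_principal_bundle) zero_Sym_ad_section: "(\<lambda>_. 0) \<in> Sym_ad_sections P q"
  using zero_in_Sym smooth_functions_const[OF atlases(2), of 0] by (auto simp: Sym_ad_sections_def)

lemma (in smooth_principal_bundle) zero_form: "(\<lambda>_. 0) \<in> forms P r q"
  using zero_in_alternating[OF zero_in_Sym] zero_Sym_ad_section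
  unfolding forms_def form_fibre_def by auto

text \<open>An equality of functions on all lists, so lists of unsuitable length or with non-tangent
  entries are included; on tangent lists of any positive length the Koszul sum matches
  \<open>wedge\<close> term by term.\<close>

lemma (in smooth_principal_bundle) ext_deriv_scale:
  assumes conn: "principal_connection P" and \<omega>: "\<omega> \<in> forms P r q" and f: "f \<in> smooth_functions (base P)" "f x = 0"
  shows "ext_deriv P (\<lambda>y. f y *\<^sub>R \<omega> y) x = wedge (differential (base P) f x) (\<omega> x)"
proof
  fix vs
  let ?T = "tangent_space (base P)" and ?d = "differential (base P) f x"
  have \<omega>m: "\<omega> y \<in> multilinear_maps r (?T y) (Sym_ad P q y)" for y
    using \<omega> unfolding forms_def form_fibre_def alternating_maps_def by blast
  have d: "?d \<in> cotangent_space (base P) x"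
    using subspace_add[OF subspace_tangent, of _ "base P" x] subspace_scale[OF subspace_tangent, of _ "base P" x]
    by (auto simp: dual_space_def linear_map_on_def differential_def scaleR_fun_def)
  show "ext_deriv P (\<lambda>y. f y *\<^sub>R \<omega> y) x vs = wedge ?d (\<omega> x) vs"
  proof (cases "vs \<noteq> [] \<and> set vs \<subseteq> ?T x")
    case False
    \<comment> \<open>For the empty list \<open>wedge\<close> is an empty sum; otherwise some entry
      is not tangent at \<open>x\<close>.\<close>
    then have "wedge ?d (\<omega> x) vs = 0" using wedge_outside[OF d \<omega>m, of vs] by (auto simp: wedge_def)
    then show ?thesis using False by (auto simp: ext_deriv_def)
  next
    case vs: True
    define Xs where "Xs = (SOME Xs. set Xs \<subseteq> vector_fields (base P) \<and> map (\<lambda>X. X x) Xs = vs)"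
    \<comment> \<open>\<open>ext_deriv\<close> extends \<open>vs\<close> by an unspecified choice of
      vector fields; extending each entry separately shows that the choice has the required
      properties.\<close>
    have "\<forall>v\<in>?T x. \<exists>X\<in>vector_fields (base P). X x = v"
      using vector_field_through[OF atlases(1) compact_base] by blast
    then obtain X where X: "\<forall>v\<in>?T x. X v \<in> vector_fields (base P) \<and> X v x = v" by metis
    have "set (map X vs) \<subseteq> vector_fields (base P) \<and> map (\<lambda>X. X x) (map X vs) = vs"
      using vs X by (auto intro!: map_idI)
    then have Xs: "set Xs \<subseteq> vector_fields (base P)" "map (\<lambda>X. X x) Xs = vs"
      using someI_ex[of "\<lambda>Xs. set Xs \<subseteq> vector_fields (base P) \<and> map (\<lambda>X. X x) Xs = vs"] unfolding Xs_def by blast+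
    have term1: "Sym_ad_deriv P x (vs ! i) (\<lambda>y. (f y *\<^sub>R \<omega> y) (map (\<lambda>X. X y) (omit i Xs))) = ?d (vs ! i) *\<^sub>R \<omega> x (omit i vs)"
      if i: "i < length vs" for i
    proof -
      have oX: "set (omit i Xs) \<subseteq> vector_fields (base P)"
        using Xs(1) set_omit[of i Xs] i Xs(2) by (metis dual_order.trans length_map set_subset_Cons subset_insertI)
      \<comment> \<open>The length of \<open>vs\<close> is arbitrary. If \<open>r\<close> arguments
        do not remain, the form vanishes on them, and the zero section is still a smooth
        section.\<close>
      have sec: "(\<lambda>y. \<omega> y (map (\<lambda>X. X y) (omit i Xs))) \<in> Sym_ad_sections P q"
      proof (cases "length (omit i Xs) = r")
        case True
        then show ?thesis using \<omega> oX unfolding forms_def by blast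
      next
        case False
        then have "\<omega> y (map (\<lambda>X. X y) (omit i Xs)) = 0" for y by (intro multilinear_out[OF \<omega>m]) simp
        then show ?thesis using zero_Sym_ad_section by (simp only:)
      qed
      have vi: "vs ! i \<in> ?T x" using vs i by auto
      have "Sym_ad_deriv P x (vs ! i) (\<lambda>y. f y *\<^sub>R \<omega> y (map (\<lambda>X. X y) (omit i Xs))) =
          (vs ! i) f *\<^sub>R \<omega> x (map (\<lambda>X. X x) (omit i Xs))"
        by (rule Sym_ad_deriv_scale[OF conn sec f vi])
      moreover have "(f y *\<^sub>R \<omega> y) ws = f y *\<^sub>R \<omega> y ws" for y ws by (simp add: scaleR_fun_def)
      ultimately show ?thesis using vi by (simp add: map_omit Xs(2) differential_def)
    qed
    have term2: "(f x *\<^sub>R \<omega> x) ws = 0" for ws by (simp add: f(2))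
    have "ext_deriv P (\<lambda>y. f y *\<^sub>R \<omega> y) x vs =
        (\<Sum>i<length vs. (- 1) ^ i *\<^sub>R Sym_ad_deriv P x (vs ! i) (\<lambda>y. (f y *\<^sub>R \<omega> y) (map (\<lambda>X. X y) (omit i Xs))))
        + (\<Sum>j<length vs. \<Sum>i<j. (- 1) ^ (i + j) *\<^sub>R (f x *\<^sub>R \<omega> x) (vf_bracket (Xs ! i) (Xs ! j) x # omit i (omit j vs)))"
      unfolding ext_deriv_def Let_def Xs_def[symmetric] if_P[OF vs] by (rule refl)
    also have "\<dots> = (\<Sum>i<length vs. (- 1) ^ i *\<^sub>R (?d (vs ! i) *\<^sub>R \<omega> x (omit i vs)))"
      unfolding term2 by (simp only: scaleR_zero_right sum.neutral_const add_0_right) (intro sum.cong refl, simp only: term1 lessThan_iff)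
    also have "\<dots> = wedge ?d (\<omega> x) vs" by (simp only: wedge_def scaleR_scaleR)
    finally show ?thesis .
  qed
qed

lemma (in smooth_principal_bundle) S_section_through:
  assumes w: "w \<in> S_fibre P N x" shows "\<exists>s\<in>S_sections P N. s x = w"
proof -
  have "\<exists>\<omega>\<in>forms P r (N - r). \<omega> x = w r" if "r \<le> N" for r
    using w that by (intro form_through) (auto simp: S_fibre_def split: if_splits)
  then obtain \<omega> where \<omega>: "r \<le> N \<Longrightarrow> \<omega> r \<in> forms P r (N - r)" "r \<le> N \<Longrightarrow> \<omega> r x = w r" for r by metis
  define s where "s = (\<lambda>y r. if r \<le> N then \<omega> r y else 0)"
  have "s \<in> S_sections P N" using \<omega>(1) by (auto simp: S_sections_def S_fibre_def s_def forms_def)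
  moreover have "s x = w"
  proof
    show "s x r = w r" for r using w \<omega>(2)[of r] by (auto simp: s_def S_fibre_def dest: spec[of _ r])
  qed
  ultimately show ?thesis by blast
qed

lemma (in smooth_principal_bundle) D_op_scale:
  assumes conn: "principal_connection P" and \<delta>: "admissible_delta P \<delta>" and s: "s \<in> S_sections P N"
    and f: "f \<in> smooth_functions (base P)" "f x = 0"
  shows "D_op P \<delta> t (\<lambda>y. f y *\<^sub>R s y) x = wedge_S (differential (base P) f x) (s x)"
proof
  fix r
  \<comment> \<open>The zero function belongs to every symmetric power, so linearity in degree 0
    already gives \<open>\<delta> x 0 = 0\<close>.\<close>
  have "linear_map_on (Sym_ad P 0 x) (\<delta> x)" using \<delta> by (simp add: admissible_delta_def)
  then have "\<delta> x (0 *\<^sub>R 0) = 0 *\<^sub>R \<delta> x 0" using zero_in_Sym unfolding linear_map_on_def by blast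
  then have \<delta>0: "\<delta> x 0 = 0" by simp
  have fs: "(f y *\<^sub>R s y) k = f y *\<^sub>R s y k" for y k by (simp add: scaleR_fun_def[where ?'a = nat])
  \<comment> \<open>For \<open>k > N\<close> the subtraction \<open>N - k\<close> is truncated, but
    then the component is zero, and the zero form has every bidegree.\<close>
  have form: "(\<lambda>y. s y k) \<in> forms P k (N - k)" for k
  proof (cases "k \<le> N")
    case True
    then show ?thesis using s by (simp add: S_sections_def)
  next
    case False
    have "s y k \<in> (if k \<le> N then form_fibre P k (N - k) y else {0})" for y
      using s unfolding S_sections_def S_fibre_def by blast
    then have "s y k = 0" for y using False by (simp only: if_False singleton_iff)
    then show ?thesis using zero_form by (simp only:)
  qed
  have "((- 1) ^ r * t) *\<^sub>R (\<lambda>vs. \<delta> x ((f x *\<^sub>R s x) r vs)) = 0"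
  proof -
    have "(f x *\<^sub>R s x) r vs = 0" for vs by (simp add: f(2))
    then have "(\<lambda>vs. \<delta> x ((f x *\<^sub>R s x) r vs)) = (\<lambda>_. 0)" by (simp only: \<delta>0)
    also have "\<dots> = 0" by (simp only: zero_fun_def)
    finally show ?thesis by (simp only: scaleR_zero_right)
  qed
  then have "D_op P \<delta> t (\<lambda>y. f y *\<^sub>R s y) x r = (case r of 0 \<Rightarrow> 0 | Suc k \<Rightarrow> ext_deriv P (\<lambda>y. f y *\<^sub>R s y k) x)"
    unfolding D_op_def by (simp only: fs add_0_right)
  also have "\<dots> = wedge_S (differential (base P) f x) (s x) r"
    using ext_deriv_scale[OF conn form f] by (auto simp: wedge_S_def split: nat.split)
  finally show "D_op P \<delta> t (\<lambda>y. f y *\<^sub>R s y) x r = wedge_S (differential (base P) f x) (s x) r" .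
qed

lemma (in smooth_principal_bundle) principal_symbol_D_op:
  assumes conn: "principal_connection P" and \<delta>: "admissible_delta P \<delta>"
    and \<xi>: "\<xi> \<in> cotangent_space (base P) x" and w: "w \<in> S_fibre P N x"
  shows "principal_symbol (base P) (S_sections P N) 1 (D_op P \<delta> t) x \<xi> w = wedge_S \<xi> w"
  unfolding principal_symbol_def
proof (rule the_equality)
  \<comment> \<open>Every admissible pair of \<open>f\<close> and \<open>s\<close> yields the same
    value, which settles uniqueness in the description; the pair obtained below settles
    existence.\<close>
  have D: "(1 / fact 1) *\<^sub>R D_op P \<delta> t (\<lambda>y. f y ^ 1 *\<^sub>R s y) x = wedge_S \<xi> w"
    if "f \<in> smooth_functions (base P)" "f x = 0" "differential (base P) f x = \<xi>" "s \<in> S_sections P N" "s x = w" for f s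
    using D_op_scale[OF conn \<delta> that(4,1,2), of t]
    by (simp only: that(3,5) fact_1 div_by_1 scaleR_one power_one_right)
  obtain f where f: "f \<in> smooth_functions (base P)" "f x = 0 \<and> differential (base P) f x = \<xi>"
    using function_with_differential[OF atlases(1) compact_base \<xi>] by (rule bexE)
  obtain s where s: "s \<in> S_sections P N" "s x = w" using S_section_through[OF w] by (rule bexE)
  show "\<exists>f s. f \<in> smooth_functions (base P) \<and> f x = 0 \<and> differential (base P) f x = \<xi> \<and> s \<in> S_sections P N \<and> s x = w \<and>
      wedge_S \<xi> w = (1 / fact 1) *\<^sub>R D_op P \<delta> t (\<lambda>y. f y ^ 1 *\<^sub>R s y) x"
    using f s D[OF f(1) conjunct1[OF f(2)] conjunct2[OF f(2)] s, symmetric]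
    by (intro exI[of _ f] exI[of _ s] conjI) (simp_all only:)
  show "r = wedge_S \<xi> w" if "\<exists>f s. f \<in> smooth_functions (base P) \<and> f x = 0 \<and> differential (base P) f x = \<xi> \<and> s \<in> S_sections P N \<and> s x = w \<and>
      r = (1 / fact 1) *\<^sub>R D_op P \<delta> t (\<lambda>y. f y ^ 1 *\<^sub>R s y) x" for r
    using that by (elim exE conjE) (simp only: D)
qed


theorem lemmaA1:
  fixes P :: "('m::{t2_space, second_countable_topology}, 'em::real_inner,
               'g::{t2_space, second_countable_topology}, 'eg::real_inner,
               'p::{t2_space, second_countable_topology}, 'ep::real_inner) pbundle"
    and \<delta> :: "('m \<Rightarrow> ('p, 'g) adj \<Rightarrow> real) \<Rightarrow> 'm \<Rightarrow> ('p, 'g) adj sym \<Rightarrow> ('p, 'g) adj sym"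
  assumes M: "compact (UNIV :: 'm set)" "connected (UNIV :: 'm set)"
    and G: "compact (UNIV :: 'g set)" "connected (UNIV :: 'g set)"
      "semisimple (grp P) (mul P) (gunit P)"
    and P: "principal_bundle P" "principal_connection P"
    and \<delta>: "\<And>l. l \<in> coad_sections P \<Longrightarrow> cov_constant P l \<Longrightarrow> admissible_delta P (\<delta> l)"
  shows
    "(\<forall>l t N x. \<forall>\<xi>\<in>cotangent_space (base P) x. \<forall>w\<in>S_fibre P N x.
        l \<in> coad_sections P \<and> cov_constant P l \<longrightarrow>
        principal_symbol (base P) (S_sections P N) 1 (D_op P (\<delta> l) t) x \<xi> w = wedge_S \<xi> w) \<and>
     (\<forall>x p q. \<forall>\<xi>\<in>cotangent_space (base P) x. \<forall>\<omega>\<in>form_fibre P p q x.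
        wedge \<xi> \<omega> \<in> form_fibre P (Suc p) q x) \<and>
     (\<forall>l l' t t' N x. \<forall>\<xi>\<in>cotangent_space (base P) x. \<forall>w\<in>S_fibre P N x.
        l \<in> coad_sections P \<and> cov_constant P l \<and> l' \<in> coad_sections P \<and> cov_constant P l' \<longrightarrow>
        principal_symbol (base P) (S_sections P N) 1 (D_op P (\<delta> l) t) x \<xi> w =
        principal_symbol (base P) (S_sections P N) 1 (D_op P (\<delta> l') t') x \<xi> w)"
proof -
  interpret smooth_principal_bundle P using P(1) M(1) G(1) by unfold_locales
  have symbol: "principal_symbol (base P) (S_sections P N) 1 (D_op P (\<delta> l) t) x \<xi> w = wedge_S \<xi> w"
    if "\<xi> \<in> cotangent_space (base P) x" "w \<in> S_fibre P N x" "l \<in> coad_sections P \<and> cov_constant P l" for l t N x \<xi> w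
    using principal_symbol_D_op[OF P(2) \<delta> that(1,2)] that(3) by simp
  \<comment> \<open>The symmetric power is only the coefficient space of the alternating maps, so it
    stays fixed while the form degree rises by one.\<close>
  have "wedge \<xi> \<omega> \<in> form_fibre P (Suc p) q x"
    if "\<xi> \<in> cotangent_space (base P) x" "\<omega> \<in> form_fibre P p q x" for x p q \<xi> \<omega>
    using that unfolding form_fibre_def
    by (intro wedge_alternating subspace_tangent subspace_Sym)
  \<comment> \<open>Independence is transitivity: neither \<open>t\<close> nor the coadjoint section
    enters \<open>wedge_S \<xi> w\<close>.\<close>
  then show ?thesis using symbol by simp
qed

end
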